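(* Let $\mathsf{D}$ be a Hom-finite, Krull-Schmidt, $\mathbf{k}$-linear triangulated category (with shift $\Sigma$ and Serre functor $\mathbb{S}$) and let $w \geq 1$. Suppose $\mathsf{S}$ is a $w$-orthogonal collection in $\mathsf{D}$ whose extension closure $\langle \mathsf{S}\rangle$ is functorially finite in $\mathsf{D}$, and assume moreover that $\mathsf{S}$ is an $\mathbb{S}_{-w}$-subcategory of $\mathsf{D}$. Let $$\mathsf{Z} = \{ d \in \mathsf{D} \mid \mathrm{Hom}(\Sigma^i \mathsf{S}, d) = 0 \text{ and } \mathrm{Hom}(d, \Sigma^{-i}\mathsf{S}) = 0 \text{ for all } i = 0, \ldots, w-1 \}.$$ Then $\mathsf{Z}$ is a triangulated category, with shift functor $\langle 1\rangle$ and class of triangles $\Delta$ as described in the context.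
   Context: $\mathbf{k}$ is an algebraically closed field. All subcategories are full and strict (closed under isomorphism). For subcategories $\mathsf{X},\mathsf{Y}$ of $\mathsf{D}$, $\mathsf{X}*\mathsf{Y}$ is the subcategory of those $d$ for which there is a triangle $x\to d\to y\to\Sigma x$ with $x\in\mathsf{X}$, $y\in\mathsf{Y}$; $\mathsf{X}$ is extension-closed if $\mathsf{X}*\mathsf{X}=\mathsf{X}$, and $\langle\mathsf{X}\rangle$ is the smallest extension-closed subcategory containing $\mathsf{X}$. $\mathrm{Hom}(\mathsf{X},d)=0$ means $\mathrm{Hom}(x,d)=0$ for all $x\in\mathsf{X}$, and similarly for $\mathrm{Hom}(d,\mathsf{X})=0$. A collection of objects $\mathsf{S}$ is $w$-orthogonal if (1) $\dim\mathrm{Hom}(x,y)=\delta_{xy}$ for all $x,y\in\mathsf{S}$ (objects up to isomorphism), and (2) if $w\ge2$, $\mathrm{Hom}(\Sigma^k x,y)=0$ for $1\le k\le w-1$ and $x,y\in\mathsf{S}$. A Serre functor is an autoequivalence $\mathbb{S}$ of $\mathsf{D}$ with isomorphisms $\mathrm{Hom}(x,y)\simeq D\mathrm{Hom}(y,\mathbb{S}x)$ natural in $x,y$, where $D$ is vector space duality. With $\mathbb{S}_m:=\mathbb{S}\Sigma^{-m}$ for $m\in\mathbb{Z}$, $\mathsf{X}$ is an $\mathbb{S}_m$-subcategory if $\mathsf{X}=\mathbb{S}_m\mathsf{X}=\mathbb{S}_m^{-1}\mathsf{X}$; in particular $\mathbb{S}_{-w}=\mathbb{S}\Sigma^{w}$.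 A right $\mathsf{X}$-approximation of $d$ is a morphism $x\to d$ with $x\in\mathsf{X}$ through which every morphism from an object of $\mathsf{X}$ to $d$ factors; a morphism $f\colon x\to d$ is right minimal if every $g\colon x\to x$ with $fg=f$ is an automorphism. Left approximations and left minimality are dual. $\mathsf{X}$ is functorially finite if every object of $\mathsf{D}$ has a right and a left $\mathsf{X}$-approximation. Structure on $\mathsf{Z}$ (it is not that of a triangulated subcategory of $\mathsf{D}$). For each $x\in\mathsf{Z}$ fix a triangle $s_x\xrightarrow{\alpha_x}\Sigma x\xrightarrow{\beta_x}x\langle1\rangle\to\Sigma s_x$ in $\mathsf{D}$ with $\alpha_x$ a minimal right $\langle\mathsf{S}\rangle$-approximation; here $x\langle1\rangle\in\mathsf{Z}$. For $f\colon x\to x'$ in $\mathsf{Z}$, $f\langle1\rangle\colon x\langle1\rangle\to x'\langle1\rangle$ is the unique morphism with $f\langle1\rangle\,\beta_x=\beta_{x'}\,(\Sigma f)$. For $f\colon x\to y$ in $\mathsf{Z}$ take a triangle $x\xrightarrow{f}y\xrightarrow{g_1}c_f\xrightarrow{h_1}\Sigma x$ in $\mathsf{D}$ and a triangle $s_f\xrightarrow{\alpha_f}c_f\xrightarrow{\beta_f}z_f\to\Sigma s_f$ in $\mathsf{D}$ with $\alpha_f$ a minimal right $\langle\mathsf{S}\rangle$-approximation; here $z_f\in\mathsf{Z}$. Put $g=\beta_fg_1$ and let $h\colon z_f\to x\langle1\rangle$ be the unique morphism with $h\beta_f=\beta_xh_1$. The diagrams $x\xrightarrow{f}y\xrightarrow{g}z_f\xrightarrow{h}x\langle1\rangle$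 are the standard triangles of $\mathsf{Z}$, and $\Delta$ is the class of all diagrams $x\to y\to z\to x\langle1\rangle$ in $\mathsf{Z}$ isomorphic to a standard triangle. *)

theory Defs
  imports "HOL-Computational_Algebra.Polynomial" "HOL-Library.FuncSet"
begin

section \<open>Linear categories\<close>

text \<open>
  All Hom-spaces are subspaces of one ambient vector space (the type \<open>'m\<close> with scalar
  multiplication \<open>scl C\<close>). Different Hom-spaces may overlap, so a morphism is always considered
  together with its source and target. This is no loss of generality: the Hom-spaces
  of any linear category embed into their direct sum over all pairs of objects, and composition
  extends bilinearly (by zero on non-composable pairs).
\<close>

record ('k, 'o, 'm) lin_cat =
  Ob :: "'o set"
  Hom :: "'o \<Rightarrow> 'o \<Rightarrow> 'm set"
  cmp :: "'m \<Rightarrow> 'm \<Rightarrow> 'm" (infixl \<open>\<cdot>\<index>\<close> 70)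
  ident :: "'o \<Rightarrow> 'm"
  scl :: "'k \<Rightarrow> 'm \<Rightarrow> 'm"

locale linear_category =
  fixes C :: "('k::field, 'o, 'm::ab_group_add, 'z) lin_cat_scheme" (structure)
  assumes vector_space: "vector_space (scl C)"
    and subspace_Hom: "\<lbrakk>x \<in> Ob C; y \<in> Ob C\<rbrakk> \<Longrightarrow> module.subspace (scl C) (Hom C x y)"
    and ident_in_Hom: "x \<in> Ob C \<Longrightarrow> ident C x \<in> Hom C x x"
    and cmp_in_Hom:
      "\<lbrakk>x \<in> Ob C; y \<in> Ob C; z \<in> Ob C; f \<in> Hom C x y; g \<in> Hom C y z\<rbrakk> \<Longrightarrow> g \<cdot> f \<in> Hom C x z"
    and cmp_ident_right:
      "\<lbrakk>x \<in> Ob C; y \<in> Ob C; f \<in> Hom C x y\<rbrakk> \<Longrightarrow> f \<cdot> ident C x = f"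
    and cmp_ident_left:
      "\<lbrakk>x \<in> Ob C; y \<in> Ob C; f \<in> Hom C x y\<rbrakk> \<Longrightarrow> ident C y \<cdot> f = f"
    and cmp_assoc:
      "\<lbrakk>x \<in> Ob C; y \<in> Ob C; z \<in> Ob C; t \<in> Ob C;
        f \<in> Hom C x y; g \<in> Hom C y z; h \<in> Hom C z t\<rbrakk> \<Longrightarrow> (h \<cdot> g) \<cdot> f = h \<cdot> (g \<cdot> f)"
    and cmp_add_left:
      "\<lbrakk>x \<in> Ob C; y \<in> Ob C; z \<in> Ob C; f \<in> Hom C x y; g \<in> Hom C y z; g' \<in> Hom C y z\<rbrakk>
        \<Longrightarrow> (g + g') \<cdot> f = g \<cdot> f + g' \<cdot> f"
    and cmp_add_right:
      "\<lbrakk>x \<in> Ob C; y \<in> Ob C; z \<in> Ob C; f \<in> Hom C x y; f' \<in> Hom C x y; g \<in> Hom C y z\<rbrakk>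
        \<Longrightarrow> g \<cdot> (f + f') = g \<cdot> f + g \<cdot> f'"
    and cmp_scl_left:
      "\<lbrakk>x \<in> Ob C; y \<in> Ob C; z \<in> Ob C; f \<in> Hom C x y; g \<in> Hom C y z\<rbrakk>
        \<Longrightarrow> scl C a g \<cdot> f = scl C a (g \<cdot> f)"
    and cmp_scl_right:
      "\<lbrakk>x \<in> Ob C; y \<in> Ob C; z \<in> Ob C; f \<in> Hom C x y; g \<in> Hom C y z\<rbrakk>
        \<Longrightarrow> g \<cdot> scl C a f = scl C a (g \<cdot> f)"

definition is_iso ::
  "('k, 'o, 'm, 'z) lin_cat_scheme \<Rightarrow> 'o \<Rightarrow> 'o \<Rightarrow> 'm \<Rightarrow> bool" where
  "is_iso C x y f \<longleftrightarrow>
     f \<in> Hom C x y \<and> (\<exists>g\<in>Hom C y x. g \<cdot>\<^bsub>C\<^esub> f = ident C x \<and> f \<cdot>\<^bsub>C\<^esub> g = ident C y)"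

definition isomorphic :: "('k, 'o, 'm, 'z) lin_cat_scheme \<Rightarrow> 'o \<Rightarrow> 'o \<Rightarrow> bool" where
  "isomorphic C x y \<longleftrightarrow> x \<in> Ob C \<and> y \<in> Ob C \<and> (\<exists>f. is_iso C x y f)"

definition zero_object ::
  "('k, 'o, 'm::zero, 'z) lin_cat_scheme \<Rightarrow> 'o \<Rightarrow> bool" where
  "zero_object C z \<longleftrightarrow> z \<in> Ob C \<and> (\<forall>x\<in>Ob C. Hom C z x = {0} \<and> Hom C x z = {0})"

definition direct_sum ::
  "('k, 'o, 'm::ab_group_add, 'z) lin_cat_scheme \<Rightarrow> 'o \<Rightarrow> nat \<Rightarrow> (nat \<Rightarrow> 'o)
    \<Rightarrow> (nat \<Rightarrow> 'm) \<Rightarrow> (nat \<Rightarrow> 'm) \<Rightarrow> bool" where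
  "direct_sum C d n x \<iota> \<pi> \<longleftrightarrow> d \<in> Ob C \<and>
     (\<forall>i<n. x i \<in> Ob C \<and> \<iota> i \<in> Hom C (x i) d \<and> \<pi> i \<in> Hom C d (x i)) \<and>
     (\<forall>i<n. \<forall>j<n. \<pi> j \<cdot>\<^bsub>C\<^esub> \<iota> i = (if i = j then ident C (x i) else 0)) \<and>
     (\<Sum>i<n. \<iota> i \<cdot>\<^bsub>C\<^esub> \<pi> i) = ident C d"

locale additive_linear_category = linear_category C
  for C :: "('k::field, 'o, 'm::ab_group_add, 'z) lin_cat_scheme" (structure) +
  assumes ex_direct_sum:
    "(\<And>i. i < n \<Longrightarrow> x i \<in> Ob C) \<Longrightarrow> \<exists>d \<iota> \<pi>. direct_sum C d n x \<iota> \<pi>"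

definition hom_finite ::
  "('k::field, 'o, 'm::ab_group_add, 'z) lin_cat_scheme \<Rightarrow> bool" where
  "hom_finite C \<longleftrightarrow>
     (\<forall>x\<in>Ob C. \<forall>y\<in>Ob C. \<exists>B. finite B \<and> B \<subseteq> Hom C x y \<and> module.span (scl C) B = Hom C x y)"

definition local_endomorphism_ring ::
  "('k, 'o, 'm::ab_group_add, 'z) lin_cat_scheme \<Rightarrow> 'o \<Rightarrow> bool" where
  "local_endomorphism_ring C x \<longleftrightarrow> ident C x \<noteq> 0 \<and>
     (\<forall>f\<in>Hom C x x. \<forall>g\<in>Hom C x x.
        \<not> is_iso C x x f \<longrightarrow> \<not> is_iso C x x g \<longrightarrow> \<not> is_iso C x x (f + g))"

definition krull_schmidt ::
  "('k, 'o, 'm::ab_group_add, 'z) lin_cat_scheme \<Rightarrow> bool" where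
  "krull_schmidt C \<longleftrightarrow>
     (\<forall>d\<in>Ob C. \<exists>n x \<iota> \<pi>. direct_sum C d n x \<iota> \<pi> \<and> (\<forall>i<n. local_endomorphism_ring C (x i)))"


section \<open>Linear functors and Serre functors\<close>

text \<open>
  A functor is given by its action \<open>Fo\<close> on objects and its action \<open>Fm x y\<close> on each \<open>Hom C x y\<close>.
\<close>

definition linear_functor ::
  "('k, 'o, 'm::ab_group_add, 'z) lin_cat_scheme
    \<Rightarrow> ('o \<Rightarrow> 'o) \<Rightarrow> ('o \<Rightarrow> 'o \<Rightarrow> 'm \<Rightarrow> 'm) \<Rightarrow> bool" where
  "linear_functor C Fo Fm \<longleftrightarrow>
     (\<forall>x\<in>Ob C. Fo x \<in> Ob C \<and> Fm x x (ident C x) = ident C (Fo x)) \<and>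
     (\<forall>x\<in>Ob C. \<forall>y\<in>Ob C. \<forall>f\<in>Hom C x y. Fm x y f \<in> Hom C (Fo x) (Fo y) \<and>
        (\<forall>g\<in>Hom C x y. Fm x y (f + g) = Fm x y f + Fm x y g) \<and>
        (\<forall>a. Fm x y (scl C a f) = scl C a (Fm x y f))) \<and>
     (\<forall>x\<in>Ob C. \<forall>y\<in>Ob C. \<forall>z\<in>Ob C. \<forall>f\<in>Hom C x y. \<forall>g\<in>Hom C y z.
        Fm x z (g \<cdot>\<^bsub>C\<^esub> f) = Fm y z g \<cdot>\<^bsub>C\<^esub> Fm x y f)"

definition naturally_isomorphic ::
  "('k, 'o, 'm, 'z) lin_cat_scheme \<Rightarrow> ('o \<Rightarrow> 'o) \<Rightarrow> ('o \<Rightarrow> 'o \<Rightarrow> 'm \<Rightarrow> 'm)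
    \<Rightarrow> ('o \<Rightarrow> 'o) \<Rightarrow> ('o \<Rightarrow> 'o \<Rightarrow> 'm \<Rightarrow> 'm) \<Rightarrow> bool" where
  "naturally_isomorphic C Fo Fm Go Gm \<longleftrightarrow>
     (\<exists>\<theta>. (\<forall>x\<in>Ob C. is_iso C (Fo x) (Go x) (\<theta> x)) \<and>
       (\<forall>x\<in>Ob C. \<forall>y\<in>Ob C. \<forall>f\<in>Hom C x y. \<theta> y \<cdot>\<^bsub>C\<^esub> Fm x y f = Gm x y f \<cdot>\<^bsub>C\<^esub> \<theta> x))"

definition autoequivalence ::
  "('k, 'o, 'm::ab_group_add, 'z) lin_cat_scheme
    \<Rightarrow> ('o \<Rightarrow> 'o) \<Rightarrow> ('o \<Rightarrow> 'o \<Rightarrow> 'm \<Rightarrow> 'm) \<Rightarrow> bool" where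
  "autoequivalence C Fo Fm \<longleftrightarrow> linear_functor C Fo Fm \<and>
     (\<exists>Go Gm. linear_functor C Go Gm \<and>
        naturally_isomorphic C (\<lambda>x. Go (Fo x)) (\<lambda>x y f. Gm (Fo x) (Fo y) (Fm x y f))
          (\<lambda>x. x) (\<lambda>x y f. f) \<and>
        naturally_isomorphic C (\<lambda>x. Fo (Go x)) (\<lambda>x y f. Fm (Go x) (Go y) (Gm x y f))
          (\<lambda>x. x) (\<lambda>x y f. f))"

definition dual_space ::
  "('k::field, 'o, 'm::ab_group_add, 'z) lin_cat_scheme \<Rightarrow> 'm set \<Rightarrow> ('m \<Rightarrow> 'k) set" where
  "dual_space C V = {\<phi> \<in> extensional V.
     (\<forall>u\<in>V. \<forall>v\<in>V. \<phi> (u + v) = \<phi> u + \<phi> v) \<and> (\<forall>a. \<forall>u\<in>V. \<phi> (scl C a u) = a * \<phi> u)}"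

text \<open>
  The map \<open>\<eta> x y\<close> is the isomorphism from \<open>Hom C x y\<close> to the dual of \<open>Hom C y (So x)\<close>; the last
  two conditions are its naturality in \<open>y\<close> and in \<open>x\<close>.
\<close>

definition serre_functor ::
  "('k::field, 'o, 'm::ab_group_add, 'z) lin_cat_scheme
    \<Rightarrow> ('o \<Rightarrow> 'o) \<Rightarrow> ('o \<Rightarrow> 'o \<Rightarrow> 'm \<Rightarrow> 'm) \<Rightarrow> bool" where
  "serre_functor C So Sm \<longleftrightarrow> autoequivalence C So Sm \<and>
     (\<exists>\<eta> :: 'o \<Rightarrow> 'o \<Rightarrow> 'm \<Rightarrow> 'm \<Rightarrow> 'k.
        (\<forall>x\<in>Ob C. \<forall>y\<in>Ob C.
           bij_betw (\<eta> x y) (Hom C x y) (dual_space C (Hom C y (So x))) \<and>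
           (\<forall>f\<in>Hom C x y. \<forall>g\<in>Hom C x y. \<forall>u\<in>Hom C y (So x).
              \<eta> x y (f + g) u = \<eta> x y f u + \<eta> x y g u) \<and>
           (\<forall>a. \<forall>f\<in>Hom C x y. \<forall>u\<in>Hom C y (So x). \<eta> x y (scl C a f) u = a * \<eta> x y f u)) \<and>
        (\<forall>x\<in>Ob C. \<forall>y\<in>Ob C. \<forall>y'\<in>Ob C.
           \<forall>f\<in>Hom C x y. \<forall>b\<in>Hom C y y'. \<forall>u\<in>Hom C y' (So x).
             \<eta> x y' (b \<cdot>\<^bsub>C\<^esub> f) u = \<eta> x y f (u \<cdot>\<^bsub>C\<^esub> b)) \<and>
        (\<forall>x\<in>Ob C. \<forall>x'\<in>Ob C. \<forall>y\<in>Ob C.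
           \<forall>f\<in>Hom C x y. \<forall>a\<in>Hom C x' x. \<forall>u\<in>Hom C y (So x').
             \<eta> x' y (f \<cdot>\<^bsub>C\<^esub> a) u = \<eta> x y f (Sm x' x a \<cdot>\<^bsub>C\<^esub> u)))"


section \<open>Triangulated categories\<close>

record ('k, 'o, 'm) shift_cat = "('k, 'o, 'm) lin_cat" +
  shift :: "'o \<Rightarrow> 'o"
  shiftm :: "'o \<Rightarrow> 'o \<Rightarrow> 'm \<Rightarrow> 'm"

record ('k, 'o, 'm) tri_cat = "('k, 'o, 'm) shift_cat" +
  tri :: "'o \<Rightarrow> 'o \<Rightarrow> 'o \<Rightarrow> 'm \<Rightarrow> 'm \<Rightarrow> 'm \<Rightarrow> bool"

definition diagram ::
  "('k, 'o, 'm, 'z) shift_cat_scheme \<Rightarrow> 'o \<Rightarrow> 'o \<Rightarrow> 'o \<Rightarrow> 'm \<Rightarrow> 'm \<Rightarrow> 'm \<Rightarrow> bool" where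
  "diagram C x y z f g h \<longleftrightarrow> x \<in> Ob C \<and> y \<in> Ob C \<and> z \<in> Ob C \<and>
     f \<in> Hom C x y \<and> g \<in> Hom C y z \<and> h \<in> Hom C z (shift C x)"

definition diagrams_isomorphic ::
  "('k, 'o, 'm, 'z) shift_cat_scheme \<Rightarrow> 'o \<Rightarrow> 'o \<Rightarrow> 'o \<Rightarrow> 'm \<Rightarrow> 'm \<Rightarrow> 'm
    \<Rightarrow> 'o \<Rightarrow> 'o \<Rightarrow> 'o \<Rightarrow> 'm \<Rightarrow> 'm \<Rightarrow> 'm \<Rightarrow> bool" where
  "diagrams_isomorphic C x y z f g h x' y' z' f' g' h' \<longleftrightarrow>
     (\<exists>a b c. is_iso C x x' a \<and> is_iso C y y' b \<and> is_iso C z z' c \<and>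
        b \<cdot>\<^bsub>C\<^esub> f = f' \<cdot>\<^bsub>C\<^esub> a \<and> c \<cdot>\<^bsub>C\<^esub> g = g' \<cdot>\<^bsub>C\<^esub> b \<and> shiftm C x x' a \<cdot>\<^bsub>C\<^esub> h = h' \<cdot>\<^bsub>C\<^esub> c)"

text \<open>
  The shift is only required to be an autoequivalence, not an automorphism; accordingly the
  rotation axiom is stated as an equivalence.
\<close>

locale triangulated_category = additive_linear_category D
  for D :: "('k::field, 'o, 'm::ab_group_add, 'z) tri_cat_scheme" (structure) +
  assumes shift_autoequivalence: "autoequivalence D (shift D) (shiftm D)"
    and tri_diagram: "tri D x y z f g h \<Longrightarrow> diagram D x y z f g h"
    and tri_isomorphic:
      "\<lbrakk>tri D x y z f g h; diagram D x' y' z' f' g' h';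
        diagrams_isomorphic D x y z f g h x' y' z' f' g' h'\<rbrakk> \<Longrightarrow> tri D x' y' z' f' g' h'"
    and tri_ident: "\<lbrakk>x \<in> Ob D; zero_object D z\<rbrakk> \<Longrightarrow> tri D x x z (ident D x) 0 0"
    and ex_tri: "\<lbrakk>x \<in> Ob D; y \<in> Ob D; f \<in> Hom D x y\<rbrakk> \<Longrightarrow> \<exists>z g h. tri D x y z f g h"
    and tri_rotate:
      "diagram D x y z f g h \<Longrightarrow>
        tri D x y z f g h \<longleftrightarrow> tri D y z (shift D x) g h (- shiftm D x y f)"
    and tri_morphism:
      "\<lbrakk>tri D x y z f g h; tri D x' y' z' f' g' h'; a \<in> Hom D x x'; b \<in> Hom D y y';
        b \<cdot> f = f' \<cdot> a\<rbrakk> \<Longrightarrow> \<exists>c\<in>Hom D z z'. c \<cdot> g = g' \<cdot> b \<and> shiftm D x x' a \<cdot> h = h' \<cdot> c"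
    and octahedral:
      "\<lbrakk>tri D x y z' f j k; tri D y z x' g n p; tri D x z y' (g \<cdot> f) l m\<rbrakk> \<Longrightarrow>
        \<exists>a b. tri D z' y' x' a b (shiftm D y z' j \<cdot> p) \<and>
          a \<cdot> j = l \<cdot> g \<and> m \<cdot> a = k \<and> b \<cdot> l = n \<and> p \<cdot> b = shiftm D x y f \<cdot> m"


section \<open>Subcategories\<close>

text \<open>
  Full subcategories are identified with their sets of objects. Images and preimages under
  functors are closed under isomorphism, so that \<open>functor_preimage\<close> is the image under a
  quasi-inverse.
\<close>

definition iso_closure :: "('k, 'o, 'm, 'z) lin_cat_scheme \<Rightarrow> 'o set \<Rightarrow> 'o set" where
  "iso_closure C X = {y. \<exists>x\<in>X. isomorphic C y x}"

definition functor_image ::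
  "('k, 'o, 'm, 'z) lin_cat_scheme \<Rightarrow> ('o \<Rightarrow> 'o) \<Rightarrow> 'o set \<Rightarrow> 'o set" where
  "functor_image C Fo X = {y. \<exists>x\<in>X. isomorphic C y (Fo x)}"

definition functor_preimage ::
  "('k, 'o, 'm, 'z) lin_cat_scheme \<Rightarrow> ('o \<Rightarrow> 'o) \<Rightarrow> 'o set \<Rightarrow> 'o set" where
  "functor_preimage C Fo X = {y \<in> Ob C. \<exists>x\<in>X. isomorphic C (Fo y) x}"

definition shift_subcat ::
  "('k, 'o, 'm, 'z) shift_cat_scheme \<Rightarrow> int \<Rightarrow> 'o set \<Rightarrow> 'o set" where
  "shift_subcat C n X =
     (if 0 \<le> n then functor_image C (shift C ^^ nat n) X
      else functor_preimage C (shift C ^^ nat (- n)) X)"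

definition serre_shift_subcategory ::
  "('k, 'o, 'm, 'z) shift_cat_scheme \<Rightarrow> ('o \<Rightarrow> 'o) \<Rightarrow> int \<Rightarrow> 'o set \<Rightarrow> bool" where
  \<comment> \<open>stability under \<open>\<S>\<^sub>m = \<S> \<Sigma>\<^sup>-\<^sup>m\<close> and its inverse \<open>\<Sigma>\<^sup>m \<S>\<^sup>-\<^sup>1\<close>\<close>
  "serre_shift_subcategory C So m X \<longleftrightarrow>
     iso_closure C X = functor_image C So (shift_subcat C (- m) X) \<and>
     iso_closure C X = shift_subcat C m (functor_preimage C So X)"

definition hom_vanish ::
  "('k, 'o, 'm::zero, 'z) lin_cat_scheme \<Rightarrow> 'o set \<Rightarrow> 'o set \<Rightarrow> bool" where
  "hom_vanish C X Y \<longleftrightarrow> (\<forall>x\<in>X. \<forall>y\<in>Y. Hom C x y = {0})"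

definition w_orthogonal ::
  "('k::field, 'o, 'm::ab_group_add, 'z) shift_cat_scheme \<Rightarrow> nat \<Rightarrow> 'o set \<Rightarrow> bool" where
  "w_orthogonal C w S \<longleftrightarrow> S \<subseteq> Ob C \<and>
     (\<forall>x\<in>S. \<forall>y\<in>S. vector_space.dim (scl C) (Hom C x y) = (if isomorphic C x y then 1 else 0)) \<and>
     (2 \<le> w \<longrightarrow> (\<forall>k\<in>{1..w - 1}. \<forall>x\<in>S. \<forall>y\<in>S. Hom C ((shift C ^^ k) x) y = {0}))"

definition ext_prod ::
  "('k, 'o, 'm, 'z) tri_cat_scheme \<Rightarrow> 'o set \<Rightarrow> 'o set \<Rightarrow> 'o set" where
  "ext_prod D X Y = {d. \<exists>x\<in>X. \<exists>y\<in>Y. \<exists>f g h. tri D x d y f g h}"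

text \<open>
  Subcategories are understood to contain the zero objects, so that \<open>X \<subseteq> ext_prod D X X\<close> is
  automatic and \<open>ext_closure D X\<close> is the smallest extension-closed subcategory containing \<open>X\<close>.
\<close>

definition extension_closed ::
  "('k, 'o, 'm::zero, 'z) tri_cat_scheme \<Rightarrow> 'o set \<Rightarrow> bool" where
  "extension_closed D X \<longleftrightarrow> X \<subseteq> Ob D \<and> iso_closure D X = X \<and>
     (\<forall>z. zero_object D z \<longrightarrow> z \<in> X) \<and> ext_prod D X X = X"

definition ext_closure ::
  "('k, 'o, 'm::zero, 'z) tri_cat_scheme \<Rightarrow> 'o set \<Rightarrow> 'o set" where
  "ext_closure D X = \<Inter>{Y. extension_closed D Y \<and> X \<subseteq> Y}"

definition right_approximation ::
  "('k, 'o, 'm, 'z) lin_cat_scheme \<Rightarrow> 'o set \<Rightarrow> 'o \<Rightarrow> 'o \<Rightarrow> 'm \<Rightarrow> bool" where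
  "right_approximation C X x d f \<longleftrightarrow> x \<in> X \<and> f \<in> Hom C x d \<and>
     (\<forall>x'\<in>X. \<forall>f'\<in>Hom C x' d. \<exists>g\<in>Hom C x' x. f' = f \<cdot>\<^bsub>C\<^esub> g)"

definition left_approximation ::
  "('k, 'o, 'm, 'z) lin_cat_scheme \<Rightarrow> 'o set \<Rightarrow> 'o \<Rightarrow> 'o \<Rightarrow> 'm \<Rightarrow> bool" where
  "left_approximation C X d x f \<longleftrightarrow> x \<in> X \<and> f \<in> Hom C d x \<and>
     (\<forall>x'\<in>X. \<forall>f'\<in>Hom C d x'. \<exists>g\<in>Hom C x x'. f' = g \<cdot>\<^bsub>C\<^esub> f)"

definition functorially_finite ::
  "('k, 'o, 'm, 'z) lin_cat_scheme \<Rightarrow> 'o set \<Rightarrow> bool" where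
  "functorially_finite C X \<longleftrightarrow>
     (\<forall>d\<in>Ob C. (\<exists>x f. right_approximation C X x d f) \<and> (\<exists>x f. left_approximation C X d x f))"

definition right_minimal ::
  "('k, 'o, 'm, 'z) lin_cat_scheme \<Rightarrow> 'o \<Rightarrow> 'm \<Rightarrow> bool" where
  "right_minimal C x f \<longleftrightarrow> (\<forall>g\<in>Hom C x x. f \<cdot>\<^bsub>C\<^esub> g = f \<longrightarrow> is_iso C x x g)"


section \<open>The reduced category\<close>

definition reduction_objects ::
  "('k, 'o, 'm::zero, 'z) shift_cat_scheme \<Rightarrow> nat \<Rightarrow> 'o set \<Rightarrow> 'o set" where
  "reduction_objects D w S =
     {d \<in> Ob D. \<forall>i<w. hom_vanish D (shift_subcat D (int i) S) {d} \<and>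
                      hom_vanish D {d} (shift_subcat D (- int i) S)}"

definition approximation_triangle ::
  "('k, 'o, 'm, 'z) tri_cat_scheme \<Rightarrow> 'o set \<Rightarrow> 'o \<Rightarrow> 'o \<Rightarrow> 'o \<Rightarrow> 'm \<Rightarrow> 'm \<Rightarrow> 'm \<Rightarrow> bool" where
  "approximation_triangle D X s c z \<alpha> \<beta> \<gamma> \<longleftrightarrow>
     tri D s c z \<alpha> \<beta> \<gamma> \<and> right_approximation D X s c \<alpha> \<and> right_minimal D s \<alpha>"

text \<open>
  In the following, \<open>sh x\<close> is the object \<open>x\<langle>1\<rangle>\<close> and \<open>\<beta> x\<close> the morphism from the shift of \<open>x\<close>
  to \<open>x\<langle>1\<rangle>\<close> in the fixed approximation triangle.
\<close>

definition reduction_shiftm ::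
  "('k, 'o, 'm, 'z) shift_cat_scheme \<Rightarrow> ('o \<Rightarrow> 'o) \<Rightarrow> ('o \<Rightarrow> 'm) \<Rightarrow> 'o \<Rightarrow> 'o \<Rightarrow> 'm \<Rightarrow> 'm" where
  "reduction_shiftm D sh \<beta> x x' f =
     (THE g. g \<in> Hom D (sh x) (sh x') \<and> g \<cdot>\<^bsub>D\<^esub> \<beta> x = \<beta> x' \<cdot>\<^bsub>D\<^esub> shiftm D x x' f)"

definition standard_triangle ::
  "('k, 'o, 'm::zero, 'z) tri_cat_scheme \<Rightarrow> nat \<Rightarrow> 'o set \<Rightarrow> ('o \<Rightarrow> 'o) \<Rightarrow> ('o \<Rightarrow> 'm)
    \<Rightarrow> 'o \<Rightarrow> 'o \<Rightarrow> 'o \<Rightarrow> 'm \<Rightarrow> 'm \<Rightarrow> 'm \<Rightarrow> bool" where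
  "standard_triangle D w S sh \<beta> x y z f g h \<longleftrightarrow>
     x \<in> reduction_objects D w S \<and> y \<in> reduction_objects D w S \<and> f \<in> Hom D x y \<and>
     (\<exists>c g1 h1 s a b d. tri D x y c f g1 h1 \<and>
        approximation_triangle D (ext_closure D S) s c z a b d \<and>
        g = b \<cdot>\<^bsub>D\<^esub> g1 \<and>
        h = (THE h. h \<in> Hom D z (sh x) \<and> h \<cdot>\<^bsub>D\<^esub> b = \<beta> x \<cdot>\<^bsub>D\<^esub> h1))"

definition reduction_shift_cat ::
  "('k, 'o, 'm::zero, 'z) tri_cat_scheme \<Rightarrow> nat \<Rightarrow> 'o set \<Rightarrow> ('o \<Rightarrow> 'o) \<Rightarrow> ('o \<Rightarrow> 'm)
    \<Rightarrow> ('k, 'o, 'm) shift_cat" where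
  "reduction_shift_cat D w S sh \<beta> =
     \<lparr>Ob = reduction_objects D w S, Hom = Hom D, cmp = cmp D, ident = ident D, scl = scl D,
      shift = sh, shiftm = reduction_shiftm D sh \<beta>\<rparr>"

definition reduction_triangle ::
  "('k, 'o, 'm::zero, 'z) tri_cat_scheme \<Rightarrow> nat \<Rightarrow> 'o set \<Rightarrow> ('o \<Rightarrow> 'o) \<Rightarrow> ('o \<Rightarrow> 'm)
    \<Rightarrow> 'o \<Rightarrow> 'o \<Rightarrow> 'o \<Rightarrow> 'm \<Rightarrow> 'm \<Rightarrow> 'm \<Rightarrow> bool" where
  "reduction_triangle D w S sh \<beta> x y z f g h \<longleftrightarrow>
     diagram (reduction_shift_cat D w S sh \<beta>) x y z f g h \<and>
     (\<exists>x' y' z' f' g' h'. standard_triangle D w S sh \<beta> x' y' z' f' g' h' \<and>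
        diagrams_isomorphic (reduction_shift_cat D w S sh \<beta>) x y z f g h x' y' z' f' g' h')"

definition reduction_tri_cat ::
  "('k, 'o, 'm::zero, 'z) tri_cat_scheme \<Rightarrow> nat \<Rightarrow> 'o set \<Rightarrow> ('o \<Rightarrow> 'o) \<Rightarrow> ('o \<Rightarrow> 'm)
    \<Rightarrow> ('k, 'o, 'm) tri_cat" where
  "reduction_tri_cat D w S sh \<beta> =
     \<lparr>Ob = reduction_objects D w S, Hom = Hom D, cmp = cmp D, ident = ident D, scl = scl D,
      shift = sh, shiftm = reduction_shiftm D sh \<beta>, tri = reduction_triangle D w S sh \<beta>\<rparr>"

end

theory Submission
  imports Defs
begin

text \<open>
  Write \<open>F\<close> for the extension closure of \<open>S\<close> and \<open>\<Sigma>\<close> for the shift of \<open>D\<close>. The subcategory \<open>Z\<close> need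
  not be closed under \<open>\<Sigma>\<close> or under cones, but the objects that leave it can be reflected back.

  Serre duality, together with the stability of \<open>S\<close> under \<open>\<S>\<Sigma>\<^sup>w\<close>, turns maps into \<open>\<Sigma>\<^sup>-\<^sup>iS\<close> into maps
  out of \<open>\<Sigma>\<^sup>w\<^sup>-\<^sup>iS\<close>. So \<open>d \<in> Z\<close> amounts to \<open>Hom(\<Sigma>\<^sup>iS, d) = 0\<close> for \<open>0 \<le> i \<le> w\<close>, and equally to
  \<open>Hom(\<Sigma>\<^sup>id, S) = 0\<close> for \<open>0 \<le> i \<le> w\<close> (lemma \<open>reduction_objects_onesided\<close>). The object \<open>\<Sigma>x\<close> for \<open>x \<in> Z\<close>
  and the cone of a morphism of \<open>Z\<close> satisfy the first list of conditions except at \<open>i = 0\<close>. Let \<open>c\<close> be such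
  an object and complete a minimal right \<open>F\<close>-approximation to a triangle \<open>s \<rightarrow> c \<rightarrow> z\<close>. Wakamatsu's lemma
  gives \<open>Hom(S, z) = 0\<close>. Minimality makes \<open>Hom(S, s) \<rightarrow> Hom(S, c)\<close> injective, which keeps the condition at
  \<open>i = 1\<close>, and the orthogonality of \<open>S\<close> keeps the others, so that \<open>z \<in> Z\<close> (\<open>approximation_reflection\<close>). As
  there are no maps from \<open>s\<close> or \<open>\<Sigma>s\<close> to \<open>Z\<close>, the morphism \<open>c \<rightarrow> z\<close> is universal among the morphisms from
  \<open>c\<close> to \<open>Z\<close>. Hence \<open>\<langle>1\<rangle>\<close> is \<open>\<Sigma>\<close> followed by reflection, and \<open>\<Delta>\<close> consists of the triangles of \<open>D\<close> starting
  in \<open>Z\<close>, with the cone reflected; any reflection of the cone gives the same triangle up to isomorphism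
  (\<open>reduction_triangle_red_tri\<close>).

  The functor \<open>\<langle>1\<rangle>\<close> is fully faithful because \<open>Hom(\<Sigma>x, s) = 0 = Hom(\<Sigma>x, \<Sigma>s)\<close> for \<open>x \<in> Z\<close> and \<open>s \<in> F\<close>. It is
  dense by the dual construction: if \<open>z \<cong> \<Sigma>u\<close>, the cocone \<open>y\<close> of a minimal left \<open>F\<close>-approximation of \<open>u\<close>
  lies in \<open>Z\<close>, and \<open>\<Sigma>y \<rightarrow> \<Sigma>u\<close> is a reflection (\<open>sh_dense\<close>). Minimal approximations exist because objects of
  \<open>F\<close> have finite filtrations with factors in \<open>S\<close>, and a nonzero morphism to or from an object of \<open>S\<close> shortens
  the filtration (\<open>cone_of_simple\<close>, \<open>cocone_of_simple\<close>): an approximation of least length is minimal.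

  The triangle axioms are obtained by reflecting those of \<open>D\<close>. Rotation works because the cone of \<open>y \<rightarrow> z\<close>
  differs from \<open>\<Sigma>x\<close> only by an object of \<open>\<Sigma>F\<close> and so has the same reflection (\<open>red_tri_rot\<close>). The delicate
  axiom is the octahedral one. Reflecting an octahedron of \<open>D\<close> yields \<open>z' \<rightarrow> y' \<rightarrow> x'\<close>, which has to be
  compared with the reduced triangle \<open>z' \<rightarrow> y' \<rightarrow> x''\<close> on its first morphism. The reflections commute with
  cones only up to maps out of \<open>\<Sigma>\<^sup>2F\<close>, and for \<open>w = 1\<close> the conditions on \<open>Z\<close> do not
  make these vanish. The exactness that would
  compare \<open>x'\<close> with \<open>x''\<close> is instead extracted from the three given reduced triangles
  (\<open>red_tri_octahedral\<close>).
\<close>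

section \<open>Morphisms in a linear category\<close>

context linear_category
begin

text \<open>
  Different Hom-spaces may share elements, so every statement about a morphism carries its source and
  target.
\<close>
definition arr :: "'o \<Rightarrow> 'o \<Rightarrow> 'm \<Rightarrow> bool" where
  "arr x y f \<longleftrightarrow> x \<in> Ob C \<and> y \<in> Ob C \<and> f \<in> Hom C x y"

text \<open>
  In a composite the intermediate objects do not occur. The predicates \<open>into\<close> and \<open>chain\<close> hide the source
  of a composite, so that in the rules \<open>paths\<close> below each intermediate object is determined by matching
  the leftmost factor with a typing among the premises. Simplification with \<open>paths\<close>, given the typings of
  all factors, thereby brings every composite to right-associated form, and \<open>comp_reduce\<close> applies an
  equation to two adjacent factors of it.
\<close>
definition into :: "'o \<Rightarrow> 'm \<Rightarrow> bool" where
  "into y f \<longleftrightarrow> (\<exists>x. arr x y f)"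

definition chain :: "'o \<Rightarrow> 'm \<Rightarrow> 'm \<Rightarrow> bool" where
  "chain z g f \<longleftrightarrow> (\<exists>y. arr y z g \<and> into y f)"

lemma arrI: "x \<in> Ob C \<Longrightarrow> y \<in> Ob C \<Longrightarrow> f \<in> Hom C x y \<Longrightarrow> arr x y f"
  by (simp add: arr_def)

lemma arrD: "arr x y f \<Longrightarrow> x \<in> Ob C" "arr x y f \<Longrightarrow> y \<in> Ob C" "arr x y f \<Longrightarrow> f \<in> Hom C x y"
  by (simp_all add: arr_def)

lemma arr_comp: "arr y z g \<Longrightarrow> arr x y f \<Longrightarrow> arr x z (g \<cdot> f)"
  using cmp_in_Hom by (auto simp: arr_def)

lemma into_arr: "arr x y f \<Longrightarrow> into y f"
  by (auto simp: into_def)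

lemma into_comp: "arr y z g \<Longrightarrow> into y f \<Longrightarrow> into z (g \<cdot> f)"
  by (auto simp: into_def intro: arr_comp)

lemma chain_arr: "arr y z g \<Longrightarrow> into y f \<Longrightarrow> chain z g f"
  by (auto simp: chain_def)

lemma chain_comp: "arr y z g \<Longrightarrow> chain y g' f \<Longrightarrow> chain z (g \<cdot> g') f"
  by (auto simp: chain_def intro: arr_comp)

lemma comp_assoc: "arr z t h \<Longrightarrow> chain z g f \<Longrightarrow> (h \<cdot> g) \<cdot> f = h \<cdot> (g \<cdot> f)"
  unfolding chain_def into_def arr_def using cmp_assoc by blast

lemma comp_reduce:
  "g \<cdot> f = k \<Longrightarrow> arr y z g \<Longrightarrow> arr x y f \<Longrightarrow> into x e \<Longrightarrow> g \<cdot> (f \<cdot> e) = k \<cdot> e"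
  by (metis comp_assoc chain_arr into_arr into_comp)

lemma arr_ident: "x \<in> Ob C \<Longrightarrow> arr x x (ident C x)"
  by (simp add: arr_def ident_in_Hom)

lemma comp_ident_right: "arr x y f \<Longrightarrow> f \<cdot> ident C x = f"
  using cmp_ident_right by (auto simp: arr_def)

lemma comp_ident_left: "arr x y f \<Longrightarrow> ident C y \<cdot> f = f"
  using cmp_ident_left by (auto simp: arr_def)

lemma ident_comp: "into y f \<Longrightarrow> ident C y \<cdot> f = f"
  by (auto simp: into_def comp_ident_left)

lemma comp_comp_ident: "arr y z g \<Longrightarrow> arr x y f \<Longrightarrow> (g \<cdot> f) \<cdot> ident C x = g \<cdot> f"
  by (rule comp_ident_right[OF arr_comp])

lemmas paths = comp_assoc chain_arr chain_comp into_comp into_arr arr_comp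
  arr_ident comp_ident_right comp_comp_ident ident_comp

lemma module_scl: "module (scl C)"
  using vector_space by (simp add: module_iff_vector_space)

lemma arr_zero: "x \<in> Ob C \<Longrightarrow> y \<in> Ob C \<Longrightarrow> arr x y 0"
  using module.subspace_0[OF module_scl subspace_Hom] by (simp add: arr_def)

lemma arr_add: "arr x y f \<Longrightarrow> arr x y g \<Longrightarrow> arr x y (f + g)"
  using module.subspace_add[OF module_scl subspace_Hom] by (simp add: arr_def)

lemma arr_scl: "arr x y f \<Longrightarrow> arr x y (scl C a f)"
  using module.subspace_scale[OF module_scl subspace_Hom] by (simp add: arr_def)

lemma arr_minus: "arr x y f \<Longrightarrow> arr x y (- f)"
  using module.subspace_neg[OF module_scl subspace_Hom] by (simp add: arr_def)

lemma arr_diff: "arr x y f \<Longrightarrow> arr x y g \<Longrightarrow> arr x y (f - g)"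
  using module.subspace_diff[OF module_scl subspace_Hom] by (simp add: arr_def)

lemma comp_add_left: "arr x y f \<Longrightarrow> arr y z g \<Longrightarrow> arr y z g' \<Longrightarrow> (g + g') \<cdot> f = g \<cdot> f + g' \<cdot> f"
  using cmp_add_left by (auto simp: arr_def)

lemma comp_add_right: "arr x y f \<Longrightarrow> arr x y f' \<Longrightarrow> arr y z g \<Longrightarrow> g \<cdot> (f + f') = g \<cdot> f + g \<cdot> f'"
  using cmp_add_right by (auto simp: arr_def)

lemma comp_zero_left: "arr x y f \<Longrightarrow> z \<in> Ob C \<Longrightarrow> 0 \<cdot> f = 0"
  using comp_add_left[of x y f z 0 0] by (simp add: arr_zero arrD)

lemma comp_zero_right: "arr y z g \<Longrightarrow> x \<in> Ob C \<Longrightarrow> g \<cdot> 0 = 0"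
  using comp_add_right[of x y 0 0 z g] by (simp add: arr_zero arrD)

lemma comp_minus_left: "arr x y f \<Longrightarrow> arr y z g \<Longrightarrow> (- g) \<cdot> f = - (g \<cdot> f)"
  using comp_add_left[of x y f z g "- g"] comp_zero_left[of x y f z]
  by (metis add_eq_0_iff arr_minus arrD(2) right_minus)

lemma comp_minus_right: "arr x y f \<Longrightarrow> arr y z g \<Longrightarrow> g \<cdot> (- f) = - (g \<cdot> f)"
  using comp_add_right[of x y f "- f" z g] comp_zero_right[of y z g x]
  by (metis add_eq_0_iff arr_minus arrD(1) right_minus)

lemma comp_diff_left: "arr x y f \<Longrightarrow> arr y z g \<Longrightarrow> arr y z g' \<Longrightarrow> (g - g') \<cdot> f = g \<cdot> f - g' \<cdot> f"
  using comp_add_left[of x y f z g "- g'"] comp_minus_left[of x y f z g'] by (simp add: arr_minus)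

lemma comp_diff_right: "arr x y f \<Longrightarrow> arr x y f' \<Longrightarrow> arr y z g \<Longrightarrow> g \<cdot> (f - f') = g \<cdot> f - g \<cdot> f'"
  using comp_add_right[of x y f "- f'" z g] comp_minus_right[of x y f' z g] by (simp add: arr_minus)

lemma comp_scl_left: "arr x y f \<Longrightarrow> arr y z g \<Longrightarrow> scl C a g \<cdot> f = scl C a (g \<cdot> f)"
  using cmp_scl_left by (auto simp: arr_def)

lemma comp_scl_right: "arr x y f \<Longrightarrow> arr y z g \<Longrightarrow> g \<cdot> scl C a f = scl C a (g \<cdot> f)"
  using cmp_scl_right by (auto simp: arr_def)

lemma comp_sum_left:
  assumes f: "arr x y f" and g: "\<And>i. i < n \<Longrightarrow> arr y z (g i)" and z: "z \<in> Ob C"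
  shows "arr y z (\<Sum>i<n. g i) \<and> (\<Sum>i<n. g i) \<cdot> f = (\<Sum>i<(n::nat). g i \<cdot> f)"
  using g
proof (induction n)
  case 0 then show ?case using comp_zero_left[OF f z] arr_zero[OF arrD(2)[OF f] z] by simp
next
  case (Suc n)
  then have "arr y z (\<Sum>i<n. g i)" "arr y z (g n)" "(\<Sum>i<n. g i) \<cdot> f = (\<Sum>i<n. g i \<cdot> f)" by simp_all
  then show ?case using comp_add_left[OF f] arr_add by simp
qed

lemma is_isoI:
  "arr x y f \<Longrightarrow> arr y x g \<Longrightarrow> g \<cdot> f = ident C x \<Longrightarrow> f \<cdot> g = ident C y \<Longrightarrow> is_iso C x y f"
  by (auto simp: is_iso_def arr_def)

lemma is_isoE:
  assumes "is_iso C x y f" "x \<in> Ob C" "y \<in> Ob C"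
  obtains g where "arr x y f" "arr y x g" "g \<cdot> f = ident C x" "f \<cdot> g = ident C y" "is_iso C y x g"
  using assms by (auto simp: is_iso_def arr_def)

lemma is_iso_ident: "x \<in> Ob C \<Longrightarrow> is_iso C x x (ident C x)"
  by (rule is_isoI[of _ _ _ "ident C x"]) (auto simp: arr_ident comp_ident_left[OF arr_ident])

lemma is_iso_comp:
  assumes f: "is_iso C x y f" and g: "is_iso C y z g" and ob: "x \<in> Ob C" "y \<in> Ob C" "z \<in> Ob C"
  shows "is_iso C x z (g \<cdot> f)"
proof -
  obtain f' where f': "arr x y f" "arr y x f'" "f' \<cdot> f = ident C x" "f \<cdot> f' = ident C y"
    using is_isoE[OF f ob(1,2)] .
  obtain g' where g': "arr y z g" "arr z y g'" "g' \<cdot> g = ident C y" "g \<cdot> g' = ident C z"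
    using is_isoE[OF g ob(2,3)] .
  note T = f'(1,2) g'(1,2)
  note R = comp_reduce[OF f'(3) f'(2,1)] comp_reduce[OF f'(4) f'(1,2)]
    comp_reduce[OF g'(3) g'(2,1)] comp_reduce[OF g'(4) g'(1,2)]
  show ?thesis
  proof (rule is_isoI[of _ _ _ "f' \<cdot> g'"])
    show "f' \<cdot> g' \<cdot> (g \<cdot> f) = ident C x" using T
      by (simp add: paths R comp_ident_left f'(3))
    show "g \<cdot> f \<cdot> (f' \<cdot> g') = ident C z" using T
      by (simp add: paths R comp_ident_left g'(4))
  qed (use T in \<open>auto simp: paths\<close>)
qed

lemma isomorphic_refl: "x \<in> Ob C \<Longrightarrow> isomorphic C x x"
  unfolding isomorphic_def using is_iso_ident by blast

lemma isomorphic_sym: "isomorphic C x y \<Longrightarrow> isomorphic C y x"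
  unfolding isomorphic_def by (metis is_isoE)

lemma isomorphic_trans: "isomorphic C x y \<Longrightarrow> isomorphic C y z \<Longrightarrow> isomorphic C x z"
  unfolding isomorphic_def by (metis is_iso_comp)

lemma is_iso_if_inverses:
  assumes T: "arr x y f" "arr y x g" "arr x y h" and e: "f \<cdot> g = ident C y" "g \<cdot> h = ident C x"
  shows "is_iso C x y f"
proof -
  have "f = f \<cdot> (g \<cdot> h)" using T(1) e(2) by (simp add: comp_ident_right)
  also have "\<dots> = h" using T e(1) by (simp add: paths comp_reduce[OF e(1)] comp_ident_left)
  finally have "f = h" .
  with T e show ?thesis by (auto intro: is_isoI)
qed

definition nohom :: "'o \<Rightarrow> 'o \<Rightarrow> bool" where
  "nohom x y \<longleftrightarrow> (\<forall>f. arr x y f \<longrightarrow> f = 0)"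

lemma nohom_iff: "x \<in> Ob C \<Longrightarrow> y \<in> Ob C \<Longrightarrow> nohom x y \<longleftrightarrow> Hom C x y = {0}"
  using arr_zero[of x y] by (auto simp: nohom_def arr_def)

lemma nohomD: "nohom x y \<Longrightarrow> arr x y f \<Longrightarrow> f = 0"
  by (simp add: nohom_def)

lemma nohom_iso_left:
  assumes "isomorphic C x x'" "nohom x y" shows "nohom x' y"
  unfolding nohom_def
proof (intro allI impI)
  fix f assume f: "arr x' y f"
  obtain a where a: "is_iso C x x' a" "x \<in> Ob C" "x' \<in> Ob C" using assms(1) by (auto simp: isomorphic_def)
  obtain b where b: "arr x x' a" "arr x' x b" "a \<cdot> b = ident C x'" using is_isoE[OF a] by metis
  have "f = (f \<cdot> a) \<cdot> b" using f b by (simp add: paths comp_ident_right)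
  also have "f \<cdot> a = 0" using nohomD[OF assms(2)] f b(1) by (simp add: paths)
  also have "0 \<cdot> b = 0" by (rule comp_zero_left[OF b(2) arrD(2)[OF f]])
  finally show "f = 0" .
qed

lemma nohom_iso_right:
  assumes "isomorphic C y y'" "nohom x y" shows "nohom x y'"
  unfolding nohom_def
proof (intro allI impI)
  fix f assume f: "arr x y' f"
  obtain a where a: "is_iso C y y' a" "y \<in> Ob C" "y' \<in> Ob C" using assms(1) by (auto simp: isomorphic_def)
  obtain b where b: "arr y y' a" "arr y' y b" "a \<cdot> b = ident C y'" using is_isoE[OF a] by metis
  have "f = a \<cdot> (b \<cdot> f)" using f b by (simp add: paths comp_ident_left comp_reduce[OF b(3)])
  also have "b \<cdot> f = 0" using nohomD[OF assms(2)] f b(2) by (simp add: paths)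
  also have "a \<cdot> 0 = 0" by (rule comp_zero_right[OF b(1) arrD(1)[OF f]])
  finally show "f = 0" .
qed

lemma zero_object_iff: "zero_object C z \<longleftrightarrow> z \<in> Ob C \<and> ident C z = 0"
proof
  assume "zero_object C z" then show "z \<in> Ob C \<and> ident C z = 0"
    using ident_in_Hom by (auto simp: zero_object_def)
next
  assume z: "z \<in> Ob C \<and> ident C z = 0"
  have "Hom C z x = {0} \<and> Hom C x z = {0}" if x: "x \<in> Ob C" for x
  proof -
    have "f = 0" if "arr z x f" for f
      using comp_ident_right[OF that] comp_zero_right[OF that, of z] z by simp
    moreover have "f = 0" if "arr x z f" for f
      using comp_ident_left[OF that] comp_zero_left[OF that, of z] z by simp
    ultimately show ?thesis using x z by (auto simp flip: nohom_iff simp: nohom_def)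
  qed
  with z show "zero_object C z" by (simp add: zero_object_def)
qed

lemma zero_object_Ob: "zero_object C z \<Longrightarrow> z \<in> Ob C"
  by (simp add: zero_object_def)

lemma arr_zero_object: "zero_object C z \<Longrightarrow> arr z x f \<Longrightarrow> f = 0" "zero_object C z \<Longrightarrow> arr x z f \<Longrightarrow> f = 0"
  by (auto simp: zero_object_def arr_def)

section \<open>Equivalences\<close>

lemma linear_functor_arr:
  "linear_functor C Fo Fm \<Longrightarrow> arr x y f \<Longrightarrow> arr (Fo x) (Fo y) (Fm x y f)"
  unfolding linear_functor_def arr_def by blast

lemma linear_functor_comp:
  "linear_functor C Fo Fm \<Longrightarrow> arr y z g \<Longrightarrow> arr x y f \<Longrightarrow> Fm x z (g \<cdot> f) = Fm y z g \<cdot> Fm x y f"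
  unfolding linear_functor_def arr_def by blast

lemma linear_functor_ident: "linear_functor C Fo Fm \<Longrightarrow> x \<in> Ob C \<Longrightarrow> Fm x x (ident C x) = ident C (Fo x)"
  unfolding linear_functor_def by blast

lemma linear_functor_Ob: "linear_functor C Fo Fm \<Longrightarrow> x \<in> Ob C \<Longrightarrow> Fo x \<in> Ob C"
  unfolding linear_functor_def by blast

lemma autoequivalence_quasi_inverse:
  assumes "autoequivalence C Fo Fm"
  obtains Go Gm where "autoequivalence C Go Gm" "\<And>x. x \<in> Ob C \<Longrightarrow> isomorphic C (Fo (Go x)) x"
    "\<And>x. x \<in> Ob C \<Longrightarrow> isomorphic C (Go (Fo x)) x"
proof -
  obtain Go Gm where G: "linear_functor C Go Gm" "linear_functor C Fo Fm" and
    n: "naturally_isomorphic C (\<lambda>x. Go (Fo x)) (\<lambda>x y f. Gm (Fo x) (Fo y) (Fm x y f))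
          (\<lambda>x. x) (\<lambda>x y f. f)"
        "naturally_isomorphic C (\<lambda>x. Fo (Go x)) (\<lambda>x y f. Fm (Go x) (Go y) (Gm x y f))
          (\<lambda>x. x) (\<lambda>x y f. f)"
    using assms unfolding autoequivalence_def by blast
  have "autoequivalence C Go Gm" unfolding autoequivalence_def
    by (rule conjI[OF G(1)], rule exI[of _ Fo], rule exI[of _ Fm], intro conjI G(2) n)
  moreover have "isomorphic C (Fo (Go x)) x" if "x \<in> Ob C" for x
    using n(2) that linear_functor_Ob[OF G(1)] linear_functor_Ob[OF G(2)]
    unfolding naturally_isomorphic_def isomorphic_def by blast
  moreover have "isomorphic C (Go (Fo x)) x" if "x \<in> Ob C" for x
    using n(1) that linear_functor_Ob[OF G(1)] linear_functor_Ob[OF G(2)]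
    unfolding naturally_isomorphic_def isomorphic_def by blast
  ultimately show ?thesis using that by blast
qed

lemma autoequivalence_linear: "autoequivalence C Fo Fm \<Longrightarrow> linear_functor C Fo Fm"
  by (simp add: autoequivalence_def)

text \<open>
  An equivalence is handled through the three properties that characterise it: it is faithful,
  full and essentially surjective.
\<close>
lemma autoequivalence_faithful:
  assumes F: "autoequivalence C Fo Fm" and fg: "arr x y f" "arr x y g" and eq: "Fm x y f = Fm x y g"
  shows "f = g"
proof -
  obtain Go Gm \<theta> where th: "\<And>x. x \<in> Ob C \<Longrightarrow> is_iso C (Go (Fo x)) x (\<theta> x)"
    and nat: "\<And>x y f. x \<in> Ob C \<Longrightarrow> y \<in> Ob C \<Longrightarrow> f \<in> Hom C x y \<Longrightarrow>
      \<theta> y \<cdot> Gm (Fo x) (Fo y) (Fm x y f) = f \<cdot> \<theta> x"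
    and G: "linear_functor C Go Gm" and F': "linear_functor C Fo Fm"
    using F unfolding autoequivalence_def naturally_isomorphic_def by blast
  have ob: "x \<in> Ob C" "y \<in> Ob C" using fg by (auto simp: arr_def)
  have gx: "Go (Fo x) \<in> Ob C" using linear_functor_Ob[OF G] linear_functor_Ob[OF F'] ob by blast
  obtain t where t: "arr (Go (Fo x)) x (\<theta> x)" "arr x (Go (Fo x)) t" "\<theta> x \<cdot> t = ident C x"
    using is_isoE[OF th[OF ob(1)] gx ob(1)] by metis
  have "f \<cdot> \<theta> x = g \<cdot> \<theta> x" using nat[of x y f] nat[of x y g] eq fg by (simp add: arr_def)
  then have "f \<cdot> \<theta> x \<cdot> t = g \<cdot> \<theta> x \<cdot> t" by simp
  then show ?thesis using t fg by (simp add: paths comp_ident_right)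
qed

lemma linear_functor_add:
  "linear_functor C Fo Fm \<Longrightarrow> arr x y f \<Longrightarrow> arr x y g \<Longrightarrow> Fm x y (f + g) = Fm x y f + Fm x y g"
  unfolding linear_functor_def arr_def by blast

lemma linear_functor_zero:
  "linear_functor C Fo Fm \<Longrightarrow> x \<in> Ob C \<Longrightarrow> y \<in> Ob C \<Longrightarrow> Fm x y 0 = 0"
  using linear_functor_add[of Fo Fm x y 0 0] by (simp add: arr_zero)

lemma linear_functor_iso:
  assumes F: "linear_functor C Fo Fm" and f: "is_iso C x y f" and ob: "x \<in> Ob C" "y \<in> Ob C"
  shows "is_iso C (Fo x) (Fo y) (Fm x y f)"
proof -
  obtain g where g: "arr x y f" "arr y x g" "g \<cdot> f = ident C x" "f \<cdot> g = ident C y"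
    using is_isoE[OF f ob] .
  show ?thesis
    by (rule is_isoI[of _ _ _ "Fm y x g"])
      (use g ob in \<open>auto simp: linear_functor_arr[OF F] linear_functor_ident[OF F]
         simp flip: linear_functor_comp[OF F]\<close>)
qed

lemma linear_functor_isomorphic:
  "linear_functor C Fo Fm \<Longrightarrow> isomorphic C x y \<Longrightarrow> isomorphic C (Fo x) (Fo y)"
  unfolding isomorphic_def using linear_functor_iso linear_functor_Ob by blast

lemma autoequivalence_full:
  assumes F: "autoequivalence C Fo Fm" and ob: "x \<in> Ob C" "y \<in> Ob C" and g: "arr (Fo x) (Fo y) g"
  obtains f where "arr x y f" "Fm x y f = g"
proof -
  obtain Go Gm where G: "linear_functor C Go Gm" and F': "linear_functor C Fo Fm"
    and n1: "naturally_isomorphic C (\<lambda>x. Go (Fo x)) (\<lambda>x y f. Gm (Fo x) (Fo y) (Fm x y f))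
          (\<lambda>x. x) (\<lambda>x y f. f)"
    and n: "naturally_isomorphic C (\<lambda>x. Fo (Go x)) (\<lambda>x y f. Fm (Go x) (Go y) (Gm x y f))
          (\<lambda>x. x) (\<lambda>x y f. f)"
    using F unfolding autoequivalence_def by blast
  obtain \<theta> where th: "\<And>x. x \<in> Ob C \<Longrightarrow> is_iso C (Go (Fo x)) x (\<theta> x)"
    and nat: "\<And>x y f. x \<in> Ob C \<Longrightarrow> y \<in> Ob C \<Longrightarrow> f \<in> Hom C x y \<Longrightarrow>
      \<theta> y \<cdot> Gm (Fo x) (Fo y) (Fm x y f) = f \<cdot> \<theta> x"
    using n1 unfolding naturally_isomorphic_def by blast
  have G': "autoequivalence C Go Gm" unfolding autoequivalence_def
    by (rule conjI[OF G], rule exI[of _ Fo], rule exI[of _ Fm], intro conjI F' n n1)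
  have gob: "Go (Fo x) \<in> Ob C" "Go (Fo y) \<in> Ob C" "Fo x \<in> Ob C" "Fo y \<in> Ob C"
    using linear_functor_Ob[OF G] linear_functor_Ob[OF F'] ob by blast+
  obtain t where t: "arr (Go (Fo x)) x (\<theta> x)" "arr x (Go (Fo x)) t" "t \<cdot> \<theta> x = ident C (Go (Fo x))"
    using is_isoE[OF th[OF ob(1)] gob(1) ob(1)] by metis
  obtain u where u: "arr (Go (Fo y)) y (\<theta> y)" "arr y (Go (Fo y)) u" "u \<cdot> \<theta> y = ident C (Go (Fo y))"
    using is_isoE[OF th[OF ob(2)] gob(2) ob(2)] by metis
  define f where "f = \<theta> y \<cdot> (Gm (Fo x) (Fo y) g \<cdot> t)"
  have Gg: "arr (Go (Fo x)) (Go (Fo y)) (Gm (Fo x) (Fo y) g)" using linear_functor_arr[OF G g] .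
  have f: "arr x y f" unfolding f_def using Gg t u by (simp add: paths)
  have Ff: "arr (Fo x) (Fo y) (Fm x y f)" using linear_functor_arr[OF F' f] .
  have GF: "arr (Go (Fo x)) (Go (Fo y)) (Gm (Fo x) (Fo y) (Fm x y f))"
    using linear_functor_arr[OF G Ff] .
  have "\<theta> y \<cdot> Gm (Fo x) (Fo y) (Fm x y f) = \<theta> y \<cdot> (Gm (Fo x) (Fo y) g)"
    using nat[OF ob, of f] f t u Gg by (simp add: arrD) (simp add: f_def paths comp_ident_right)
  then have "u \<cdot> (\<theta> y \<cdot> Gm (Fo x) (Fo y) (Fm x y f)) = u \<cdot> (\<theta> y \<cdot> (Gm (Fo x) (Fo y) g))" by simp
  then have "Gm (Fo x) (Fo y) (Fm x y f) = Gm (Fo x) (Fo y) g"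
    using u Gg GF by (simp add: paths comp_reduce[OF u(3)] comp_ident_left)
  then have "Fm x y f = g" by (rule autoequivalence_faithful[OF G' Ff g])
  with f show ?thesis using that by blast
qed

lemma autoequivalence_nohom:
  assumes F: "autoequivalence C Fo Fm" and ob: "x \<in> Ob C" "y \<in> Ob C"
  shows "nohom (Fo x) (Fo y) \<longleftrightarrow> nohom x y"
proof -
  have F': "linear_functor C Fo Fm" using F by (simp add: autoequivalence_def)
  show ?thesis
  proof
    assume n: "nohom (Fo x) (Fo y)"
    show "nohom x y" unfolding nohom_def
    proof (intro allI impI)
      fix f assume f: "arr x y f"
      have "Fm x y f = 0" using nohomD[OF n linear_functor_arr[OF F' f]] .
      then show "f = 0" using autoequivalence_faithful[OF F f arr_zero[OF ob]] linear_functor_zero[OF F' ob] by simp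
    qed
  next
    assume n: "nohom x y"
    show "nohom (Fo x) (Fo y)" unfolding nohom_def
      by (metis autoequivalence_full[OF F ob] nohomD[OF n] linear_functor_zero[OF F' ob])
  qed
qed

lemma autoequivalence_iff_isomorphic:
  assumes F: "autoequivalence C Fo Fm" and ob: "x \<in> Ob C" "y \<in> Ob C"
    and i: "isomorphic C (Fo x) (Fo y)"
  shows "isomorphic C x y"
proof -
  obtain Go Gm where G: "autoequivalence C Go Gm" "\<And>x. x \<in> Ob C \<Longrightarrow> isomorphic C (Go (Fo x)) x"
    using autoequivalence_quasi_inverse[OF F] by metis
  have "isomorphic C (Go (Fo x)) (Go (Fo y))"
    by (rule linear_functor_isomorphic[OF autoequivalence_linear[OF G(1)] i])
  then have "isomorphic C x (Go (Fo y))"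
    using isomorphic_trans[OF isomorphic_sym[OF G(2)[OF ob(1)]]] by blast
  then show ?thesis using isomorphic_trans[OF _ G(2)[OF ob(2)]] by blast
qed

text \<open>
  The quasi-inverse is chosen object by object by density. On morphisms it is the unique preimage of a
  conjugate, so functoriality and naturality are equations that can be checked after applying the functor.
\<close>
lemma autoequivalenceI:
  assumes F: "linear_functor C Fo Fm"
    and faithful: "\<And>x y f. arr x y f \<Longrightarrow> Fm x y f = 0 \<Longrightarrow> f = 0"
    and full: "\<And>x y g. x \<in> Ob C \<Longrightarrow> y \<in> Ob C \<Longrightarrow> arr (Fo x) (Fo y) g \<Longrightarrow> \<exists>f. arr x y f \<and> Fm x y f = g"
    and dense: "\<And>x. x \<in> Ob C \<Longrightarrow> \<exists>y\<in>Ob C. isomorphic C (Fo y) x"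
  shows "autoequivalence C Fo Fm"
proof -
  have inj: "f = g" if "arr x y f" "arr x y g" "Fm x y f = Fm x y g" for x y f g
    using faithful[of x y "f - g"] linear_functor_add[OF F, of x y "f - g" g] that
    by (simp add: arr_diff)
  have "\<exists>y e e'. y \<in> Ob C \<and> arr (Fo y) x e \<and> arr x (Fo y) e' \<and> e' \<cdot> e = ident C (Fo y) \<and> e \<cdot> e' = ident C x"
    if "x \<in> Ob C" for x
    using dense[OF that] unfolding isomorphic_def by (metis is_isoE)
  then obtain Go e e' where G: "\<And>x. x \<in> Ob C \<Longrightarrow> Go x \<in> Ob C"
    and e: "\<And>x. x \<in> Ob C \<Longrightarrow> arr (Fo (Go x)) x (e x)" "\<And>x. x \<in> Ob C \<Longrightarrow> arr x (Fo (Go x)) (e' x)"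
    and ee: "\<And>x. x \<in> Ob C \<Longrightarrow> e' x \<cdot> e x = ident C (Fo (Go x))"
        "\<And>x. x \<in> Ob C \<Longrightarrow> e x \<cdot> e' x = ident C x" by metis
  have "\<exists>f'. arr (Go x) (Go y) f' \<and> Fm (Go x) (Go y) f' = e' y \<cdot> (f \<cdot> e x)" if f: "arr x y f" for x y f
    using full[of "Go x" "Go y"] G arrD[OF f] e[of x] e[of y] f by (simp add: paths)
  then obtain Gm where Gm: "\<And>x y f. arr x y f \<Longrightarrow> arr (Go x) (Go y) (Gm x y f)"
     "\<And>x y f. arr x y f \<Longrightarrow> Fm (Go x) (Go y) (Gm x y f) = e' y \<cdot> (f \<cdot> e x)" by metis
  have Gmu: "Gm x y f = h" if "arr x y f" "arr (Go x) (Go y) h" "Fm (Go x) (Go y) h = e' y \<cdot> (f \<cdot> e x)"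
    for x y f h
    using inj[of "Go x" "Go y" "Gm x y f" h] that Gm[of x y f] by simp
  have Glin: "linear_functor C Go Gm"
    unfolding linear_functor_def
  proof (intro conjI ballI allI)
    fix x assume x: "x \<in> Ob C"
    show "Go x \<in> Ob C" using G x by simp
    show "Gm x x (ident C x) = ident C (Go x)"
      by (rule Gmu) (use x G[OF x] e[OF x] in \<open>simp_all add: arr_ident linear_functor_ident[OF F] comp_ident_left ee\<close>)
  next
    fix x y f assume xy: "x \<in> Ob C" "y \<in> Ob C" and f: "f \<in> Hom C x y"
    have f': "arr x y f" using xy f by (simp add: arrI)
    show "Gm x y f \<in> Hom C (Go x) (Go y)" using Gm(1)[OF f'] by (simp add: arrD)
    { fix g assume "g \<in> Hom C x y"
      then have g': "arr x y g" using xy by (simp add: arrI)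
      have T: "arr y (Fo (Go y)) (e' y)" "arr x y (f + g)" "arr (Fo (Go x)) x (e x)"
         "arr (Fo (Go x)) y (f \<cdot> e x)" "arr (Fo (Go x)) y (g \<cdot> e x)"
        using e[OF xy(1)] e[OF xy(2)] f' g' by (simp_all add: arr_add arr_comp)
      show "Gm x y (f + g) = Gm x y f + Gm x y g"
        by (rule Gmu) (use T Gm[OF f'] Gm[OF g'] f' g' in
          \<open>simp_all add: arr_add linear_functor_add[OF F] comp_add_left comp_add_right\<close>) }
    { fix a
      have T: "arr y (Fo (Go y)) (e' y)" "arr x y (scl C a f)" "arr (Fo (Go x)) x (e x)"
         "arr (Fo (Go x)) y (f \<cdot> e x)"
        using e[OF xy(1)] e[OF xy(2)] f' by (simp_all add: arr_scl arr_comp)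
      show "Gm x y (scl C a f) = scl C a (Gm x y f)"
        by (rule Gmu) (use T Gm[OF f'] F f' in
          \<open>auto simp: arr_scl comp_scl_left comp_scl_right linear_functor_def arrD\<close>) }
  next
    fix x y z f g assume xyz: "x \<in> Ob C" "y \<in> Ob C" "z \<in> Ob C" and f: "f \<in> Hom C x y" and g: "g \<in> Hom C y z"
    have f': "arr x y f" and g': "arr y z g" using xyz f g by (simp_all add: arrI)
    note T = f' g' e[OF xyz(1)] e[OF xyz(2)] e[OF xyz(3)] Gm(1)[OF f'] Gm(1)[OF g']
    show "Gm x z (g \<cdot> f) = Gm y z g \<cdot> Gm x y f"
    proof (rule Gmu)
      show "Fm (Go x) (Go z) (Gm y z g \<cdot> Gm x y f) = e' z \<cdot> (g \<cdot> f \<cdot> e x)"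
        using T by (simp add: linear_functor_comp[OF F Gm(1)[OF g'] Gm(1)[OF f']] Gm(2)[OF f'] Gm(2)[OF g'] paths
            comp_reduce[OF ee(2)] xyz comp_ident_left)
    qed (use T in \<open>simp_all add: paths\<close>)
  qed
  have "\<forall>x. x \<in> Ob C \<longrightarrow> (\<exists>t. is_iso C (Go (Fo x)) x t \<and> Fm (Go (Fo x)) x t = e (Fo x))"
  proof (intro allI impI)
    fix x assume x: "x \<in> Ob C"
    have fx: "Fo x \<in> Ob C" "Go (Fo x) \<in> Ob C" using x F G linear_functor_Ob by blast+
    obtain t where t: "arr (Go (Fo x)) x t" "Fm (Go (Fo x)) x t = e (Fo x)"
      using full[OF fx(2) x e(1)[OF fx(1)]] by blast
    obtain t' where t': "arr x (Go (Fo x)) t'" "Fm x (Go (Fo x)) t' = e' (Fo x)"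
      using full[OF x fx(2) e(2)[OF fx(1)]] by blast
    have "is_iso C (Go (Fo x)) x t"
    proof (rule is_isoI[OF t(1) t'(1)])
      show "t' \<cdot> t = ident C (Go (Fo x))"
        by (rule inj[of "Go (Fo x)" "Go (Fo x)"]) (use t t' fx in \<open>simp_all add: paths arr_ident linear_functor_comp[OF F t'(1) t(1)]
             linear_functor_ident[OF F] ee\<close>)
      show "t \<cdot> t' = ident C x"
        by (rule inj[of x x]) (use t t' fx x in \<open>simp_all add: paths arr_ident linear_functor_comp[OF F t(1) t'(1)]
             linear_functor_ident[OF F] ee\<close>)
    qed
    then show "\<exists>t. is_iso C (Go (Fo x)) x t \<and> Fm (Go (Fo x)) x t = e (Fo x)" using t by blast
  qed
  then obtain \<theta> where th: "\<And>x. x \<in> Ob C \<Longrightarrow> is_iso C (Go (Fo x)) x (\<theta> x)"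
     "\<And>x. x \<in> Ob C \<Longrightarrow> Fm (Go (Fo x)) x (\<theta> x) = e (Fo x)" by metis
  have Fo: "Fo x \<in> Ob C" "Go (Fo x) \<in> Ob C" if "x \<in> Ob C" for x
    using that F G linear_functor_Ob by blast+
  have n1: "naturally_isomorphic C (\<lambda>x. Go (Fo x)) (\<lambda>x y f. Gm (Fo x) (Fo y) (Fm x y f)) (\<lambda>x. x) (\<lambda>x y f. f)"
    unfolding naturally_isomorphic_def
  proof (intro exI conjI ballI)
    fix x y f assume xy: "x \<in> Ob C" "y \<in> Ob C" and f: "f \<in> Hom C x y"
    have f': "arr x y f" using xy f by (simp add: arrI)
    have tx: "arr (Go (Fo x)) x (\<theta> x)" "arr (Go (Fo y)) y (\<theta> y)"
      using is_isoE[OF th(1)] Fo xy by metis+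
    have Ff: "arr (Fo x) (Fo y) (Fm x y f)" using linear_functor_arr[OF F f'] .
    note T = f' tx Ff Gm(1)[OF Ff] e[OF Fo(1)[OF xy(1)]] e[OF Fo(1)[OF xy(2)]]
    have "Fm (Go (Fo x)) y (\<theta> y \<cdot> Gm (Fo x) (Fo y) (Fm x y f)) = e (Fo y) \<cdot> (e' (Fo y) \<cdot> (Fm x y f \<cdot> e (Fo x)))"
      using T xy by (simp add: linear_functor_comp[OF F tx(2) Gm(1)[OF Ff]] th(2) Gm(2)[OF Ff])
    also have "\<dots> = Fm x y f \<cdot> e (Fo x)"
      using T xy Fo by (simp add: paths comp_reduce[OF ee(2)] comp_ident_left)
    also have "\<dots> = Fm (Go (Fo x)) y (f \<cdot> \<theta> x)"
      using T xy by (simp add: linear_functor_comp[OF F f' tx(1)] th(2))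
    finally show "\<theta> y \<cdot> Gm (Fo x) (Fo y) (Fm x y f) = f \<cdot> \<theta> x"
      by (rule inj[rotated 2]) (use T in \<open>simp_all add: paths\<close>)
  qed (use th in auto)
  have n2: "naturally_isomorphic C (\<lambda>x. Fo (Go x)) (\<lambda>x y f. Fm (Go x) (Go y) (Gm x y f)) (\<lambda>x. x) (\<lambda>x y f. f)"
    unfolding naturally_isomorphic_def
  proof (intro exI conjI ballI)
    fix x assume x: "x \<in> Ob C"
    show "is_iso C (Fo (Go x)) x (e x)" using is_isoI[OF e(1)[OF x] e(2)[OF x]] ee x by simp
  next
    fix x y f assume xy: "x \<in> Ob C" "y \<in> Ob C" and f: "f \<in> Hom C x y"
    have f': "arr x y f" using xy f by (simp add: arrI)
    show "e y \<cdot> Fm (Go x) (Go y) (Gm x y f) = f \<cdot> e x"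
      using f' e[OF xy(1)] e[OF xy(2)] xy by (simp add: Gm(2) paths comp_reduce[OF ee(2)] comp_ident_left)
  qed
  show ?thesis unfolding autoequivalence_def
    by (rule conjI[OF F], rule exI[of _ Go], rule exI[of _ Gm], intro conjI Glin n1 n2)
qed

end

section \<open>Exactness in triangulated categories\<close>

context additive_linear_category
begin

lemma ex_zero_object: "\<exists>z. zero_object C z"
proof -
  obtain d \<iota> \<pi> where "direct_sum C d 0 undefined \<iota> \<pi>" using ex_direct_sum[of 0 undefined] by auto
  then show ?thesis by (auto simp: direct_sum_def zero_object_iff)
qed

end

context triangulated_category
begin

abbreviation \<Sigma> :: "'o \<Rightarrow> 'o" where "\<Sigma> \<equiv> shift D"

abbreviation \<Sigma>m :: "'o \<Rightarrow> 'o \<Rightarrow> 'm \<Rightarrow> 'm" where "\<Sigma>m \<equiv> shiftm D"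

lemma diagram_arr:
  "diagram D x y z f g h \<longleftrightarrow> arr x y f \<and> arr y z g \<and> arr z (\<Sigma> x) h"
  using linear_functor_Ob[OF autoequivalence_linear[OF shift_autoequivalence]]
  by (auto simp: diagram_def arr_def)

lemma tri_arr:
  assumes "tri D x y z f g h"
  shows "arr x y f" "arr y z g" "arr z (\<Sigma> x) h"
  using tri_diagram[OF assms] by (simp_all add: diagram_arr)

lemmas shift_linear = autoequivalence_linear[OF shift_autoequivalence]
lemmas shift_Ob = linear_functor_Ob[OF shift_linear]
lemmas shift_arr = linear_functor_arr[OF shift_linear]
lemmas shift_comp = linear_functor_comp[OF shift_linear]
lemmas shift_ident = linear_functor_ident[OF shift_linear]
lemmas shift_zero = linear_functor_zero[OF shift_linear]
lemmas shift_isomorphic = linear_functor_isomorphic[OF shift_linear]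
lemmas shift_faithful = autoequivalence_faithful[OF shift_autoequivalence]
lemmas shift_full = autoequivalence_full[OF shift_autoequivalence]
lemmas shift_nohom = autoequivalence_nohom[OF shift_autoequivalence]
lemmas shift_reflects_isomorphic = autoequivalence_iff_isomorphic[OF shift_autoequivalence]

lemma shift_dense:
  assumes "x \<in> Ob D" obtains y where "y \<in> Ob D" "isomorphic D x (\<Sigma> y)"
proof -
  obtain Go Gm where "autoequivalence D Go Gm" "isomorphic D (\<Sigma> (Go x)) x"
    using autoequivalence_quasi_inverse[OF shift_autoequivalence] assms by metis
  then show ?thesis using that[of "Go x"] isomorphic_sym assms autoequivalence_linear linear_functor_Ob
    by blast
qed

lemma shift_zero_object: "zero_object D z \<Longrightarrow> zero_object D (\<Sigma> z)"
  by (metis zero_object_iff shift_Ob shift_ident shift_zero)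

lemma tri_rot:
  assumes "tri D x y z f g h" shows "tri D y z (\<Sigma> x) g h (- \<Sigma>m x y f)"
  using tri_rotate[OF tri_diagram[OF assms]] assms by simp

lemma tri_unrot:
  assumes "tri D y z (\<Sigma> x) g h (- \<Sigma>m x y f)" and "arr x y f"
  shows "tri D x y z f g h"
  using tri_rotate[of x y z f g h] assms tri_arr[OF assms(1)] by (simp add: diagram_arr)

lemma tri_iso:
  assumes t: "tri D x y z f g h" and a: "arr x' y' f'" "arr y' z' g'" "arr z' (\<Sigma> x') h'"
    and i: "is_iso D x x' a" "is_iso D y y' b" "is_iso D z z' c"
    and e: "b \<cdot> f = f' \<cdot> a" "c \<cdot> g = g' \<cdot> b" "\<Sigma>m x x' a \<cdot> h = h' \<cdot> c"
  shows "tri D x' y' z' f' g' h'"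
proof (rule tri_isomorphic[OF t])
  show "diagram D x' y' z' f' g' h'" using a by (simp add: diagram_arr)
  show "diagrams_isomorphic D x y z f g h x' y' z' f' g' h'"
    unfolding diagrams_isomorphic_def using i e by blast
qed

lemma tri_comp_zero:
  assumes t: "tri D x y z f g h"
  shows "g \<cdot> f = 0" "h \<cdot> g = 0" "\<Sigma>m x y f \<cdot> h = 0"
proof -
  have *: "g \<cdot> f = 0" if t: "tri D x y z f g h" for x y z f g h
  proof -
    obtain o' where o': "zero_object D o'" using ex_zero_object by blast
    note T = tri_arr[OF t]
    have "tri D x x o' (ident D x) 0 0" using tri_ident o' arrD[OF T(1)] by blast
    from tri_morphism[OF this t, of "ident D x" f] obtain c where "c \<in> Hom D o' z" "c \<cdot> 0 = g \<cdot> f"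
      using T arrD[OF T(1)] ident_in_Hom by auto
    then show ?thesis
      using comp_zero_right[of o' z c x] o' T by (simp add: arr_def zero_object_def)
  qed
  show "g \<cdot> f = 0" using *[OF t] .
  show "h \<cdot> g = 0" using *[OF tri_rot[OF t]] .
  have "- \<Sigma>m x y f \<cdot> h = 0" using *[OF tri_rot[OF tri_rot[OF t]]] .
  then show "\<Sigma>m x y f \<cdot> h = 0"
    using comp_minus_left[of z "\<Sigma> x" h "\<Sigma> y" "\<Sigma>m x y f"] tri_arr[OF t] shift_arr by simp
qed

lemma tri_zero_left: "zero_object D o' \<Longrightarrow> q \<in> Ob D \<Longrightarrow> tri D o' q q 0 (ident D q) 0"
proof -
  assume o': "zero_object D o'" and q: "q \<in> Ob D"
  have "tri D q q (\<Sigma> o') (ident D q) 0 0" using tri_ident q o' shift_zero_object by blast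
  then show ?thesis
    using tri_unrot[of q q o' "ident D q" 0 0] q o' by (simp add: shift_zero arr_zero zero_object_Ob)
qed

text \<open>
  A morphism \<open>u\<close> with \<open>u \<cdot> f = 0\<close> is the middle part of a morphism to the triangle \<open>0 \<rightarrow> q \<rightarrow> q \<rightarrow> 0\<close>; its
  third component is the factorisation.
\<close>
lemma weak_cokernel:
  assumes t: "tri D x y z f g h" and u: "arr y q u" "u \<cdot> f = 0"
  shows "\<exists>v. arr z q v \<and> u = v \<cdot> g"
proof -
  note T = tri_arr[OF t]
  obtain o' where o': "zero_object D o'" using ex_zero_object by blast
  have q: "q \<in> Ob D" "o' \<in> Ob D" using u o' by (auto simp: arr_def zero_object_def)
  have "tri D o' q q 0 (ident D q) 0" using tri_zero_left[OF o' q(1)] .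
  from tri_morphism[OF t this, of 0 u] obtain c where c: "c \<in> Hom D z q" "c \<cdot> g = ident D q \<cdot> u"
    using arr_zero[of x o'] T u q comp_zero_left[of x o' 0 q] by (auto simp: arr_def)
  then show ?thesis using T q u by (auto simp: arr_def cmp_ident_left)
qed

lemma weak_cokernel2:
  assumes t: "tri D x y z f g h" and u: "arr z q u" "u \<cdot> g = 0"
  shows "\<exists>v. arr (\<Sigma> x) q v \<and> u = v \<cdot> h"
  by (rule weak_cokernel[OF tri_rot[OF t] u])

lemma weak_cokernel3:
  assumes t: "tri D x y z f g h" and u: "arr (\<Sigma> x) q u" "u \<cdot> h = 0"
  shows "\<exists>v. arr (\<Sigma> y) q v \<and> u = v \<cdot> \<Sigma>m x y f"
proof -
  obtain v where v: "arr (\<Sigma> y) q v" "u = v \<cdot> (- \<Sigma>m x y f)"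
    using weak_cokernel[OF tri_rot[OF tri_rot[OF t]] u] by blast
  have F: "arr (\<Sigma> x) (\<Sigma> y) (\<Sigma>m x y f)" using tri_arr[OF t] shift_arr by blast
  have "u = (- v) \<cdot> \<Sigma>m x y f" using v comp_minus_right[OF F v(1)] comp_minus_left[OF F v(1)] by simp
  then show ?thesis using arr_minus[OF v(1)] by blast
qed

text \<open>
  Dually \<open>u\<close> gives a morphism from \<open>q \<rightarrow> 0 \<rightarrow> \<Sigma>q\<close> to the rotated triangle. Its third component has the form
  \<open>\<Sigma>v\<close> because the shift is full, and \<open>u = f \<cdot> v\<close> because it is faithful.
\<close>
lemma weak_kernel:
  assumes t: "tri D x y z f g h" and u: "arr q y u" "g \<cdot> u = 0"
  shows "\<exists>v. arr q x v \<and> u = f \<cdot> v"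
proof -
  note T = tri_arr[OF t]
  obtain o' where o': "zero_object D o'" using ex_zero_object by blast
  have q: "q \<in> Ob D" "o' \<in> Ob D" using u o' by (auto simp: arr_def zero_object_def)
  have "tri D q q o' (ident D q) 0 0" using tri_ident q o' by blast
  from tri_rot[OF this] have 1: "tri D q o' (\<Sigma> q) 0 0 (- ident D (\<Sigma> q))" using q by (simp add: shift_ident)
  have "0 \<cdot> 0 = g \<cdot> u" using u comp_zero_left[OF arr_zero[of q o'], of z] q T by (simp add: arr_def)
  with tri_morphism[OF 1 tri_rot[OF t], of u 0] obtain c where c: "c \<in> Hom D (\<Sigma> q) (\<Sigma> x)"
    "\<Sigma>m q y u \<cdot> (- ident D (\<Sigma> q)) = (- \<Sigma>m x y f) \<cdot> c"
    using arr_zero[of o' z] T u q by (auto simp: arr_def)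
  have c': "arr (\<Sigma> q) (\<Sigma> x) c" using c q T shift_Ob by (auto simp: arr_def)
  obtain v where v: "arr q x v" "\<Sigma>m q x v = c" using shift_full[OF _ _ c'] q T by (auto simp: arr_def)
  have "\<Sigma>m q y u = \<Sigma>m x y f \<cdot> c"
    using c(2) comp_minus_right[OF arr_ident[OF shift_Ob[OF q(1)]] shift_arr[OF u(1)]]
      comp_minus_left[OF c' shift_arr[OF T(1)]] comp_ident_right[OF shift_arr[OF u(1)]] by simp
  also have "\<dots> = \<Sigma>m q y (f \<cdot> v)" using shift_comp[OF T(1) v(1)] v by simp
  finally have "u = f \<cdot> v" using shift_faithful u v arr_comp T by blast
  with v show ?thesis by blast
qed

lemma weak_kernel2:
  assumes t: "tri D x y z f g h" and u: "arr q z u" "h \<cdot> u = 0"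
  shows "\<exists>v. arr q y v \<and> u = g \<cdot> v"
  by (rule weak_kernel[OF tri_rot[OF t] u])

lemma tri_zero_third:
  assumes t: "tri D x y z f g h" and z: "zero_object D z"
  shows "is_iso D x y f"
proof -
  note T = tri_arr[OF t]
  have i: "arr y y (ident D y)" using T(1) arr_ident arrD(2) by blast
  have "g \<cdot> ident D y = 0" by (rule arr_zero_object(2)[OF z arr_comp[OF T(2) i]])
  then obtain v where v: "arr y x v" "ident D y = f \<cdot> v"
    using weak_kernel[OF t i] by blast
  have x: "x \<in> Ob D" using T by (simp add: arr_def)
  have "h = 0" using arr_zero_object(1)[OF z T(3)] .
  then have "ident D (\<Sigma> x) \<cdot> h = 0" using comp_ident_left[OF T(3)] by simp
  from weak_cokernel3[OF t arr_ident[OF shift_Ob[OF x]] this]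
  obtain w where w: "arr (\<Sigma> y) (\<Sigma> x) w" "ident D (\<Sigma> x) = w \<cdot> \<Sigma>m x y f" by blast
  obtain w' where w': "arr y x w'" "\<Sigma>m y x w' = w" using shift_full[OF _ _ w(1)] T(1) by (auto simp: arr_def)
  have "\<Sigma>m x x (w' \<cdot> f) = \<Sigma>m x x (ident D x)" using w w' shift_comp[OF w'(1) T(1)] shift_ident[OF x] by simp
  then have wf: "w' \<cdot> f = ident D x" using shift_faithful arr_comp[OF w'(1) T(1)] arr_ident[OF x] by blast
  have "w' \<cdot> (f \<cdot> v) = v" using w'(1) T(1) v(1) by (simp add: comp_reduce[OF wf] paths)
  then have "w' = v" using w'(1) by (simp flip: v(2) add: paths)
  then show ?thesis using is_isoI[OF T(1) v(1)] v wf by simp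
qed

lemma tri_zero_first:
  assumes t: "tri D x y z f g h" and z: "zero_object D x"
  shows "is_iso D y z g"
  by (rule tri_zero_third[OF tri_rot[OF t] shift_zero_object[OF z]])

text \<open>
  The cone of \<open>h\<close> is isomorphic to some \<open>\<Sigma>y\<close> because the shift is dense; fullness of the shift then allows
  the triangle to be rotated back twice.
\<close>
lemma ex_tri_third:
  assumes h: "arr z (\<Sigma> x) h" and x: "x \<in> Ob D"
  shows "\<exists>y f g. tri D x y z f g h"
proof -
  obtain Q m n where Q: "tri D z (\<Sigma> x) Q h m n" using ex_tri[OF arrD[OF h]] by blast
  note T = tri_arr[OF Q]
  have z: "z \<in> Ob D" using h by (simp add: arr_def)
  obtain y where y: "y \<in> Ob D" "isomorphic D Q (\<Sigma> y)" using shift_dense T by (auto simp: arr_def)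
  then obtain t where t: "is_iso D Q (\<Sigma> y) t" "Q \<in> Ob D" "\<Sigma> y \<in> Ob D" by (auto simp: isomorphic_def)
  obtain t' where t': "arr Q (\<Sigma> y) t" "arr (\<Sigma> y) Q t'" "t' \<cdot> t = ident D Q"
    using is_isoE[OF t] by metis
  note A = T t'(1,2)
  have tm: "arr (\<Sigma> x) (\<Sigma> y) (- (t \<cdot> m))" and nt: "arr (\<Sigma> y) (\<Sigma> z) (- (n \<cdot> t'))"
    using A by (simp_all add: paths arr_minus)
  obtain f where f: "arr x y f" "\<Sigma>m x y f = - (t \<cdot> m)" using shift_full[OF x y(1) tm] by blast
  obtain g where g: "arr y z g" "\<Sigma>m y z g = - (n \<cdot> t')" using shift_full[OF y(1) z nt] by blast
  have "tri D z (\<Sigma> x) (\<Sigma> y) h (t \<cdot> m) (n \<cdot> t')"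
  proof (rule tri_iso[OF Q])
    show "is_iso D z z (ident D z)" "is_iso D (\<Sigma> x) (\<Sigma> x) (ident D (\<Sigma> x))"
      using is_iso_ident z x shift_Ob by auto
    show "is_iso D Q (\<Sigma> y) t" by (rule t)
    show "\<Sigma>m z z (ident D z) \<cdot> n = n \<cdot> t' \<cdot> t" using A z t'(3) by (simp add: paths shift_ident)
  qed (use A in \<open>auto simp: paths\<close>)
  then have "tri D z (\<Sigma> x) (\<Sigma> y) h (- \<Sigma>m x y f) (- \<Sigma>m y z g)" using f g by simp
  then have "tri D y z (\<Sigma> x) g h (- \<Sigma>m x y f)" by (rule tri_unrot[OF _ g(1)])
  then have "tri D x y z f g h" by (rule tri_unrot[OF _ f(1)])
  then show ?thesis by blast
qed

text \<open>The third axiom for the outer terms of two triangles, obtained by rotating both twice.\<close>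
lemma tri_morphism_outer:
  assumes t: "tri D x y z f g h" and t': "tri D x' y' z' f' g' h'"
    and a: "arr x x' a" and c: "arr z z' c" and e: "h' \<cdot> c = \<Sigma>m x x' a \<cdot> h"
  shows "\<exists>b. arr y y' b \<and> b \<cdot> f = f' \<cdot> a \<and> g' \<cdot> b = c \<cdot> g"
proof -
  note T = tri_arr[OF t] tri_arr[OF t'] a c
  have y: "y \<in> Ob D" "y' \<in> Ob D" using T by (auto simp: arr_def)
  from tri_morphism[OF tri_rot[OF tri_rot[OF t]] tri_rot[OF tri_rot[OF t']], of c "\<Sigma>m x x' a"] e c shift_arr[OF a]
  obtain b where b: "b \<in> Hom D (\<Sigma> y) (\<Sigma> y')" "b \<cdot> - \<Sigma>m x y f = - \<Sigma>m x' y' f' \<cdot> \<Sigma>m x x' a"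
    "\<Sigma>m z z' c \<cdot> - \<Sigma>m y z g = - \<Sigma>m y' z' g' \<cdot> b" by (auto simp: arr_def)
  have b': "arr (\<Sigma> y) (\<Sigma> y') b" using b y shift_Ob by (simp add: arr_def)
  obtain b0 where b0: "arr y y' b0" "\<Sigma>m y y' b0 = b" using shift_full[OF y b'] by blast
  note S = shift_arr[OF T(1)] shift_arr[OF T(2)] shift_arr[OF T(4)] shift_arr[OF T(5)] shift_arr[OF a] shift_arr[OF c]
  have "b \<cdot> \<Sigma>m x y f = \<Sigma>m x' y' f' \<cdot> \<Sigma>m x x' a"
    using b(2) comp_minus_right[OF S(1) b'] comp_minus_left[OF S(5) S(3)] by simp
  then have "\<Sigma>m x y' (b0 \<cdot> f) = \<Sigma>m x y' (f' \<cdot> a)"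
    using shift_comp[OF b0(1) T(1)] shift_comp[OF T(4) a] b0 by simp
  then have 1: "b0 \<cdot> f = f' \<cdot> a" using shift_faithful arr_comp[OF b0(1) T(1)] arr_comp[OF T(4) a] by blast
  have "\<Sigma>m z z' c \<cdot> \<Sigma>m y z g = \<Sigma>m y' z' g' \<cdot> b"
    using b(3) comp_minus_right[OF S(2) S(6)] comp_minus_left[OF b' S(4)] by simp
  then have "\<Sigma>m y z' (g' \<cdot> b0) = \<Sigma>m y z' (c \<cdot> g)"
    using shift_comp[OF c T(2)] shift_comp[OF T(5) b0(1)] b0 by simp
  then have "g' \<cdot> b0 = c \<cdot> g" using shift_faithful arr_comp[OF c T(2)] arr_comp[OF T(5) b0(1)] by blast
  with 1 b0 show ?thesis by blast
qed

lemma tri_shift: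
  assumes t: "tri D x y z f g h"
  shows "tri D (\<Sigma> x) (\<Sigma> y) (\<Sigma> z) (- \<Sigma>m x y f) (- \<Sigma>m y z g) (- \<Sigma>m z (\<Sigma> x) h)"
  by (intro tri_rot t)

lemma tri_unshift:
  assumes t: "tri D (\<Sigma> x) (\<Sigma> y) (\<Sigma> z) F G H" and ob: "x \<in> Ob D" "y \<in> Ob D" "z \<in> Ob D"
  shows "\<exists>f g h. tri D x y z f g h"
proof -
  note T = arr_minus[OF tri_arr(1)[OF t]] arr_minus[OF tri_arr(2)[OF t]] arr_minus[OF tri_arr(3)[OF t]]
  obtain f where f: "arr x y f" "\<Sigma>m x y f = - F" using shift_full[OF ob(1,2) T(1)] by blast
  obtain g where g: "arr y z g" "\<Sigma>m y z g = - G" using shift_full[OF ob(2,3) T(2)] by blast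
  obtain h where h: "arr z (\<Sigma> x) h" "\<Sigma>m z (\<Sigma> x) h = - H" using shift_full[OF ob(3) shift_Ob[OF ob(1)] T(3)] by blast
  have "tri D (\<Sigma> x) (\<Sigma> y) (\<Sigma> z) (- \<Sigma>m x y f) (- \<Sigma>m y z g) (- \<Sigma>m z (\<Sigma> x) h)"
    using t f g h by simp
  then show ?thesis using tri_unrot f g h by blast
qed

text \<open>
  A triangle whose last term is a shift has, up to sign, the shift of a morphism as its last
  morphism, hence can be rotated back.
\<close>
lemma tri_unrot_ex:
  assumes t: "tri D y z (\<Sigma> x) g h k" and x: "x \<in> Ob D"
  shows "\<exists>f. arr x y f \<and> k = - \<Sigma>m x y f \<and> tri D x y z f g h"
proof -
  note T = tri_arr[OF t]
  have y: "y \<in> Ob D" using T by (simp add: arr_def)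
  obtain f where f: "arr x y f" "\<Sigma>m x y f = - k" using shift_full[OF x y arr_minus[OF T(3)]] by blast
  then show ?thesis using tri_unrot[of y z x g h f] t by auto
qed

lemma nohom_middle_right:
  assumes t: "tri D x y z f g h" and n: "nohom q x" "nohom q z"
  shows "nohom q y"
  unfolding nohom_def
proof (intro allI impI)
  fix u assume u: "arr q y u"
  have "g \<cdot> u = 0" using nohomD[OF n(2)] arr_comp[OF tri_arr(2)[OF t] u] by blast
  then obtain v where v: "arr q x v" "u = f \<cdot> v" using weak_kernel[OF t u] by blast
  then show "u = 0" using nohomD[OF n(1) v(1)] comp_zero_right[OF tri_arr(1)[OF t]] u arrD by metis
qed

lemma nohom_middle_left:
  assumes t: "tri D x y z f g h" and n: "nohom x q" "nohom z q"
  shows "nohom y q"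
  unfolding nohom_def
proof (intro allI impI)
  fix u assume u: "arr y q u"
  have "u \<cdot> f = 0" using nohomD[OF n(1)] arr_comp[OF u tri_arr(1)[OF t]] by blast
  then obtain v where v: "arr z q v" "u = v \<cdot> g" using weak_cokernel[OF t u] by blast
  then show "u = 0" using nohomD[OF n(2) v(1)] comp_zero_left[OF tri_arr(2)[OF t]] u arrD by metis
qed

end

section \<open>Reflections onto a subcategory\<close>

context triangulated_category
begin

text \<open>
  Objects that may be discarded when passing to \<open>Z\<close>. The two conditions on maps out of \<open>n\<close> make a morphism
  with cocone \<open>n\<close> universal for maps to \<open>Z\<close>; the two conditions on maps to \<open>n\<close> make the reflected shift fully
  faithful.
\<close>
definition orth :: "'o set \<Rightarrow> 'o \<Rightarrow> bool" where
  "orth Z n \<longleftrightarrow> n \<in> Ob D \<and>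
     (\<forall>q\<in>Z. nohom n q \<and> nohom (\<Sigma> n) q \<and> nohom q n \<and> nohom (\<Sigma> q) n)"

text \<open>
  The cocone is kept in the definition, besides the universal property that follows from it, because
  rotation and full faithfulness refer to it.
\<close>
definition reflection :: "'o set \<Rightarrow> 'o \<Rightarrow> 'o \<Rightarrow> 'm \<Rightarrow> bool" where
  "reflection Z c z r \<longleftrightarrow> z \<in> Z \<and> (\<exists>s a d. orth Z s \<and> tri D s c z a r d)"

lemma reflection_arr: "reflection Z c z r \<Longrightarrow> arr c z r"
  by (auto simp: reflection_def dest: tri_arr)

lemma reflection_in: "reflection Z c z r \<Longrightarrow> z \<in> Z"
  by (simp add: reflection_def)

lemma reflection_ex:
  assumes "reflection Z c z r" and u: "arr c q u" and q: "q \<in> Z"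
  shows "\<exists>v. arr z q v \<and> v \<cdot> r = u"
proof -
  obtain s a d where s: "orth Z s" and t: "tri D s c z a r d" using assms(1) by (auto simp: reflection_def)
  have "u \<cdot> a = 0" using s q nohomD arr_comp[OF u tri_arr(1)[OF t]] unfolding orth_def by blast
  then show ?thesis using weak_cokernel[OF t u] by metis
qed

lemma reflection_zero:
  assumes "reflection Z c z r" and v: "arr z q v" and q: "q \<in> Z" and e: "v \<cdot> r = 0"
  shows "v = 0"
proof -
  obtain s a d where s: "orth Z s" and t: "tri D s c z a r d" using assms(1) by (auto simp: reflection_def)
  obtain u where u: "arr (\<Sigma> s) q u" "v = u \<cdot> d" using weak_cokernel2[OF t v e] by blast
  have "u = 0" using s q nohomD[OF _ u(1)] unfolding orth_def by blast
  then show ?thesis using u comp_zero_left[OF tri_arr(3)[OF t] arrD(2)[OF v]] by simp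
qed

lemma reflection_eq:
  assumes r: "reflection Z c z r" and v: "arr z q v" "arr z q v'" and q: "q \<in> Z" and e: "v \<cdot> r = v' \<cdot> r"
  shows "v = v'"
  using reflection_zero[OF r arr_diff[OF v] q] comp_diff_left[OF reflection_arr[OF r] v] e by simp

lemma reflection_iso:
  assumes r: "reflection Z c z r" and i: "is_iso D z z' t" and z': "z' \<in> Z" "z' \<in> Ob D"
  shows "reflection Z c z' (t \<cdot> r)"
proof -
  obtain s a d where s: "orth Z s" and tr: "tri D s c z a r d" using r by (auto simp: reflection_def)
  note T = tri_arr[OF tr]
  have ob: "z \<in> Ob D" "s \<in> Ob D" "c \<in> Ob D" using T by (auto simp: arr_def)
  obtain t' where t: "arr z z' t" "arr z' z t'" "t' \<cdot> t = ident D z" using is_isoE[OF i ob(1) z'(2)] by metis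
  have "tri D s c z' a (t \<cdot> r) (d \<cdot> t')"
    by (rule tri_iso[OF tr _ _ _ is_iso_ident[OF ob(2)] is_iso_ident[OF ob(3)] i])
      (use T t ob in \<open>auto simp: paths shift_ident shift_Ob t(3)\<close>)
  then show ?thesis using s z' by (auto simp: reflection_def)
qed

lemma reflection_unique:
  assumes r: "reflection Z c z r" and r': "reflection Z c z' r'"
  shows "\<exists>t. is_iso D z z' t \<and> t \<cdot> r = r'"
proof -
  note Z = reflection_in[OF r] reflection_in[OF r'] and A = reflection_arr[OF r] reflection_arr[OF r']
  have ob: "z \<in> Ob D" "z' \<in> Ob D" using A by (auto simp: arr_def)
  obtain t where t: "arr z z' t" "t \<cdot> r = r'" using reflection_ex[OF r A(2) Z(2)] by blast
  obtain u where u: "arr z' z u" "u \<cdot> r' = r" using reflection_ex[OF r' A(1) Z(1)] by blast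
  have "u \<cdot> t = ident D z"
    by (rule reflection_eq[OF r _ _ Z(1)]) (use t u A ob in \<open>simp_all add: paths\<close>)
  moreover have "t \<cdot> u = ident D z'"
    by (rule reflection_eq[OF r' _ _ Z(2)]) (use t u A ob in \<open>simp_all add: paths\<close>)
  ultimately show ?thesis using is_isoI[OF t(1) u(1)] t(2) by blast
qed

end

text \<open>
  The situation in which the reflected structure is triangulated. The last hypothesis is the density of the
  reflected shift, stated for arbitrary reflections.
\<close>
locale triangulated_reduction = triangulated_category D
  for D :: "('k::field, 'o, 'm::ab_group_add, 'z) tri_cat_scheme" (structure) +
  fixes Z :: "'o set" and sh :: "'o \<Rightarrow> 'o" and \<beta> :: "'o \<Rightarrow> 'm"
  assumes Z_Ob: "x \<in> Z \<Longrightarrow> x \<in> Ob D"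
    and Z_sum: "(\<And>i. i < n \<Longrightarrow> xs i \<in> Z) \<Longrightarrow> direct_sum D d n xs \<iota> \<pi> \<Longrightarrow> d \<in> Z"
    and reflection_shift: "x \<in> Z \<Longrightarrow> reflection Z (\<Sigma> x) (sh x) (\<beta> x)"
    and reflection_cone: "x \<in> Z \<Longrightarrow> y \<in> Z \<Longrightarrow> tri D x y c f g h \<Longrightarrow> \<exists>z r. reflection Z c z r"
    and reflection_dense: "z \<in> Z \<Longrightarrow> \<exists>x\<in>Z. \<exists>r. reflection Z (\<Sigma> x) z r"
begin

abbreviation shm :: "'o \<Rightarrow> 'o \<Rightarrow> 'm \<Rightarrow> 'm" where "shm \<equiv> reduction_shiftm D sh \<beta>"

lemma sh_in: "x \<in> Z \<Longrightarrow> sh x \<in> Z"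
  using reflection_shift reflection_in by blast

lemma beta_arr: "x \<in> Z \<Longrightarrow> arr (\<Sigma> x) (sh x) (\<beta> x)"
  using reflection_shift reflection_arr by blast

text \<open>
  The universal property of \<open>\<beta> x\<close> makes the description defining \<open>x\<langle>1\<rangle> \<rightarrow> y\<langle>1\<rangle>\<close> unambiguous.
\<close>
lemma shm:
  assumes x: "x \<in> Z" and y: "y \<in> Z" and f: "arr x y f"
  shows "arr (sh x) (sh y) (shm x y f)" "shm x y f \<cdot> \<beta> x = \<beta> y \<cdot> \<Sigma>m x y f"
proof -
  have "\<exists>!g. g \<in> Hom D (sh x) (sh y) \<and> g \<cdot> \<beta> x = \<beta> y \<cdot> \<Sigma>m x y f"
  proof (rule ex_ex1I)
    show "\<exists>g. g \<in> Hom D (sh x) (sh y) \<and> g \<cdot> \<beta> x = \<beta> y \<cdot> \<Sigma>m x y f"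
      using reflection_ex[OF reflection_shift[OF x] arr_comp[OF beta_arr[OF y] shift_arr[OF f]] sh_in[OF y]]
      by (auto dest: arrD)
    show "g = g'" if "g \<in> Hom D (sh x) (sh y) \<and> g \<cdot> \<beta> x = \<beta> y \<cdot> \<Sigma>m x y f"
      "g' \<in> Hom D (sh x) (sh y) \<and> g' \<cdot> \<beta> x = \<beta> y \<cdot> \<Sigma>m x y f" for g g'
      by (rule reflection_eq[OF reflection_shift[OF x] _ _ sh_in[OF y]])
        (use that sh_in[OF x] sh_in[OF y] Z_Ob in \<open>auto simp: arr_def\<close>)
  qed
  from theI'[OF this] show "arr (sh x) (sh y) (shm x y f)" "shm x y f \<cdot> \<beta> x = \<beta> y \<cdot> \<Sigma>m x y f"
    using sh_in[OF x] sh_in[OF y] Z_Ob unfolding reduction_shiftm_def by (auto simp: arr_def)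
qed

lemma shm_eq:
  assumes "x \<in> Z" "y \<in> Z" "arr x y f" "arr (sh x) (sh y) g" "g \<cdot> \<beta> x = \<beta> y \<cdot> \<Sigma>m x y f"
  shows "shm x y f = g"
  using reflection_eq[OF reflection_shift[OF assms(1)] _ assms(4) sh_in[OF assms(2)]] shm[OF assms(1-3)] assms(5)
  by simp

lemma shm_comp:
  assumes Z: "x \<in> Z" "y \<in> Z" "z \<in> Z" and f: "arr x y f" and g: "arr y z g"
  shows "shm x z (g \<cdot> f) = shm y z g \<cdot> shm x y f"
proof (rule shm_eq[OF Z(1,3) arr_comp[OF g f]])
  note T = shm(1)[OF Z(1,2) f] shm(1)[OF Z(2,3) g] shift_arr[OF f] shift_arr[OF g] beta_arr[OF Z(1)]
    beta_arr[OF Z(2)] beta_arr[OF Z(3)]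
  show "shm y z g \<cdot> shm x y f \<cdot> \<beta> x = \<beta> z \<cdot> \<Sigma>m x z (g \<cdot> f)"
    using T by (simp add: paths shm(2)[OF Z(1,2) f] shift_comp[OF g f]
        comp_reduce[OF shm(2)[OF Z(2,3) g] T(2,6)])
  show "arr (sh x) (sh z) (shm y z g \<cdot> shm x y f)" using T by (simp add: paths)
qed

lemma shm_ident: "x \<in> Z \<Longrightarrow> shm x x (ident D x) = ident D (sh x)"
  by (rule shm_eq) (use beta_arr[of x] sh_in Z_Ob shift_Ob in \<open>auto simp: paths shift_ident\<close>)

lemma shm_add:
  assumes Z: "x \<in> Z" "y \<in> Z" and f: "arr x y f" and g: "arr x y g"
  shows "shm x y (f + g) = shm x y f + shm x y g"
proof (rule shm_eq[OF Z arr_add[OF f g]])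
  note T = shm(1)[OF Z f] shm(1)[OF Z g] beta_arr[OF Z(1)] beta_arr[OF Z(2)] shift_arr[OF f] shift_arr[OF g]
  show "(shm x y f + shm x y g) \<cdot> \<beta> x = \<beta> y \<cdot> \<Sigma>m x y (f + g)"
    by (simp add: comp_add_left[OF T(3,1,2)] comp_add_right[OF T(5,6,4)] linear_functor_add[OF shift_linear f g]
       shm(2)[OF Z f] shm(2)[OF Z g])
  show "arr (sh x) (sh y) (shm x y f + shm x y g)" using T by (simp add: arr_add)
qed

lemma shm_scl:
  assumes Z: "x \<in> Z" "y \<in> Z" and f: "arr x y f"
  shows "shm x y (scl D a f) = scl D a (shm x y f)"
proof (rule shm_eq[OF Z arr_scl[OF f]])
  note T = shm(1)[OF Z f] beta_arr[OF Z(1)] beta_arr[OF Z(2)] shift_arr[OF f]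
  have s: "\<Sigma>m x y (scl D a f) = scl D a (\<Sigma>m x y f)"
    using shift_linear f unfolding linear_functor_def arr_def by blast
  show "scl D a (shm x y f) \<cdot> \<beta> x = \<beta> y \<cdot> \<Sigma>m x y (scl D a f)"
    by (simp add: s comp_scl_left[OF T(2,1)] comp_scl_right[OF T(4,3)] shm(2)[OF Z f])
  show "arr (sh x) (sh y) (scl D a (shm x y f))" using T by (simp add: arr_scl)
qed

lemma shm_zero: "x \<in> Z \<Longrightarrow> y \<in> Z \<Longrightarrow> shm x y 0 = 0"
  using shm_add[of x y 0 0] by (simp add: arr_zero Z_Ob)

text \<open>
  If \<open>f\<langle>1\<rangle> = 0\<close>, then \<open>\<Sigma>f\<close> factors through the cocone of \<open>\<beta> y\<close>, and there are no maps from \<open>\<Sigma>x\<close> to it.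
\<close>
lemma shm_faithful:
  assumes Z: "x \<in> Z" "y \<in> Z" and f: "arr x y f" and e: "shm x y f = 0"
  shows "f = 0"
proof -
  obtain s a d where s: "orth Z s" and t: "tri D s (\<Sigma> y) (sh y) a (\<beta> y) d"
    using reflection_shift[OF Z(2)] by (auto simp: reflection_def)
  have "\<beta> y \<cdot> \<Sigma>m x y f = 0"
    using shm(2)[OF Z f] e comp_zero_left[OF beta_arr[OF Z(1)] Z_Ob[OF sh_in[OF Z(2)]]] by simp
  then obtain v where v: "arr (\<Sigma> x) s v" "\<Sigma>m x y f = a \<cdot> v" using weak_kernel[OF t shift_arr[OF f]] by blast
  have "v = 0" using s Z(1) nohomD[OF _ v(1)] unfolding orth_def by blast
  then have "\<Sigma>m x y f = \<Sigma>m x y 0"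
    using v comp_zero_right[OF tri_arr(1)[OF t], of "\<Sigma> x"] arrD[OF f] shift_Ob shift_zero by simp
  then show ?thesis using shift_faithful[OF f arr_zero] arrD[OF f] by blast
qed

lemma shm_inj:
  assumes Z: "x \<in> Z" "y \<in> Z" and f: "arr x y f" "arr x y g" and e: "shm x y f = shm x y g"
  shows "f = g"
  using shm_faithful[OF Z arr_diff[OF f]] shm_add[OF Z arr_diff[OF f] f(2)] e by simp

text \<open>
  The obstruction to lifting \<open>\<Sigma>x \<rightarrow> x\<langle>1\<rangle> \<rightarrow> y\<langle>1\<rangle>\<close> along \<open>\<beta> y\<close> is a map from \<open>\<Sigma>x\<close> to the shift of the
  cocone of \<open>\<beta> y\<close>.
\<close>
lemma shm_full:
  assumes Z: "x \<in> Z" "y \<in> Z" and g: "arr (sh x) (sh y) g"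
  shows "\<exists>f. arr x y f \<and> shm x y f = g"
proof -
  obtain s a d where s: "orth Z s" and t: "tri D s (\<Sigma> y) (sh y) a (\<beta> y) d"
    using reflection_shift[OF Z(2)] by (auto simp: reflection_def)
  have gb: "arr (\<Sigma> x) (sh y) (g \<cdot> \<beta> x)" using arr_comp[OF g beta_arr[OF Z(1)]] .
  have ob: "s \<in> Ob D" using s by (simp add: orth_def)
  have "nohom (\<Sigma> x) (\<Sigma> s)" using s Z shift_nohom[OF Z_Ob[OF Z(1)] ob] unfolding orth_def by blast
  then have "d \<cdot> (g \<cdot> \<beta> x) = 0" using nohomD arr_comp[OF tri_arr(3)[OF t] gb] by blast
  then obtain v where v: "arr (\<Sigma> x) (\<Sigma> y) v" "g \<cdot> \<beta> x = \<beta> y \<cdot> v" using weak_kernel2[OF t gb] by blast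
  obtain f where f: "arr x y f" "\<Sigma>m x y f = v" using shift_full[OF _ _ v(1)] Z Z_Ob by blast
  have "shm x y f = g" by (rule shm_eq[OF Z f(1) g]) (use v f in simp)
  with f show ?thesis by blast
qed

section \<open>Triangles of the reduced category\<close>

text \<open>
  Any reflection of the cone is admitted, in place of the one by a minimal approximation. This makes the
  class closed under isomorphism, and each axiom can use the reflection at hand.
\<close>
definition red_tri :: "'o \<Rightarrow> 'o \<Rightarrow> 'o \<Rightarrow> 'm \<Rightarrow> 'm \<Rightarrow> 'm \<Rightarrow> bool" where
  "red_tri x y z f g h \<longleftrightarrow> x \<in> Z \<and> y \<in> Z \<and> arr z (sh x) h \<and>
     (\<exists>c g1 h1 r. tri D x y c f g1 h1 \<and> reflection Z c z r \<and> g = r \<cdot> g1 \<and> h \<cdot> r = \<beta> x \<cdot> h1)"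

lemma red_tri_in:
  assumes "red_tri x y z f g h" shows "x \<in> Z" "y \<in> Z" "z \<in> Z"
  using assms reflection_in by (auto simp: red_tri_def)

lemma red_tri_arr:
  assumes "red_tri x y z f g h" shows "arr x y f" "arr y z g" "arr z (sh x) h"
  using assms by (auto simp: red_tri_def intro: tri_arr arr_comp[OF reflection_arr])

lemma reflection_ident:
  assumes z: "z \<in> Z" shows "reflection Z z z (ident D z)"
proof -
  obtain o' where o': "zero_object D o'" using ex_zero_object by blast
  have s: "zero_object D (\<Sigma> o')" using shift_zero_object[OF o'] .
  have "orth Z o'" unfolding orth_def nohom_def
    using arr_zero_object[OF o'] arr_zero_object[OF s] zero_object_Ob[OF o'] by blast
  then show ?thesis using tri_zero_left[OF o' Z_Ob[OF z]] z unfolding reflection_def by blast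
qed

lemma zero_in: assumes "zero_object D z" shows "z \<in> Z"
proof -
  have "direct_sum D z 0 undefined undefined undefined"
    using assms by (simp add: direct_sum_def zero_object_iff)
  from Z_sum[OF _ this] show ?thesis by simp
qed

lemma red_tri_ident:
  assumes x: "x \<in> Z" and z: "zero_object D z"
  shows "red_tri x x z (ident D x) 0 0"
proof -
  have ob: "x \<in> Ob D" "z \<in> Ob D" "sh x \<in> Ob D" using x z Z_Ob sh_in zero_object_Ob by auto
  have "0 = ident D z \<cdot> 0" "0 \<cdot> ident D z = \<beta> x \<cdot> 0"
    using comp_zero_right[OF arr_ident[OF ob(2)] ob(1)] comp_zero_left[OF arr_ident[OF ob(2)] ob(3)]
      comp_zero_right[OF beta_arr[OF x] ob(2)] by simp_all
  then show ?thesis unfolding red_tri_def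
    using x tri_ident[OF ob(1) z] reflection_ident[OF zero_in[OF z]] arr_zero[OF ob(2,3)] by blast
qed

lemma red_tri_ex:
  assumes Z: "x \<in> Z" "y \<in> Z" and f: "arr x y f"
  shows "\<exists>z g h. red_tri x y z f g h"
proof -
  obtain c g1 h1 where t: "tri D x y c f g1 h1" using ex_tri[OF arrD[OF f]] by blast
  obtain z r where r: "reflection Z c z r" using reflection_cone[OF Z t] by blast
  obtain h where "arr z (sh x) h" "h \<cdot> r = \<beta> x \<cdot> h1"
    using reflection_ex[OF r arr_comp[OF beta_arr[OF Z(1)] tri_arr(3)[OF t]] sh_in[OF Z(1)]] by blast
  then show ?thesis unfolding red_tri_def using Z t r by blast
qed

lemma red_tri_iso:
  assumes t: "red_tri x y z f g h" and Z: "x' \<in> Z" "y' \<in> Z" "z' \<in> Z"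
    and A: "arr x' y' f'" "arr y' z' g'" "arr z' (sh x') h'"
    and i: "is_iso D x x' a" "is_iso D y y' b" "is_iso D z z' c"
    and e: "b \<cdot> f = f' \<cdot> a" "c \<cdot> g = g' \<cdot> b" "shm x x' a \<cdot> h = h' \<cdot> c"
  shows "red_tri x' y' z' f' g' h'"
proof -
  obtain C g1 h1 r where t1: "tri D x y C f g1 h1" and r: "reflection Z C z r" and g: "g = r \<cdot> g1"
    and h: "h \<cdot> r = \<beta> x \<cdot> h1" using t by (auto simp: red_tri_def)
  note Z1 = red_tri_in[OF t] and A1 = red_tri_arr[OF t]
  obtain b' where b: "arr y y' b" "arr y' y b'" "b' \<cdot> b = ident D y" "b \<cdot> b' = ident D y'"
    using is_isoE[OF i(2) Z_Ob[OF Z1(2)] Z_Ob[OF Z(2)]] by metis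
  have a: "arr x x' a" using is_isoE[OF i(1) Z_Ob[OF Z1(1)] Z_Ob[OF Z(1)]] by metis
  have c: "arr z z' c" using is_isoE[OF i(3) Z_Ob[OF Z1(3)] Z_Ob[OF Z(3)]] by metis
  have C: "C \<in> Ob D" using tri_arr[OF t1] by (simp add: arr_def)
  note T = tri_arr[OF t1] b(1,2) a c A shift_arr[OF a] reflection_arr[OF r] shm(1)[OF Z1(1) Z(1) a]
    beta_arr[OF Z1(1)] beta_arr[OF Z(1)] A1(3)
  have "tri D x' y' C f' (g1 \<cdot> b') (\<Sigma>m x x' a \<cdot> h1)"
    by (rule tri_iso[OF t1 _ _ _ i(1,2) is_iso_ident[OF C]])
      (use T C e(1) in \<open>auto simp: paths b(3)\<close>)
  moreover have "reflection Z C z' (c \<cdot> r)" by (rule reflection_iso[OF r i(3) Z(3) Z_Ob[OF Z(3)]])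
  moreover have "g' = c \<cdot> r \<cdot> (g1 \<cdot> b')"
  proof -
    have "g' = (g' \<cdot> b) \<cdot> b'" using T by (simp add: paths b(4))
    also have "\<dots> = c \<cdot> r \<cdot> (g1 \<cdot> b')" using T unfolding e(2)[symmetric] g by (simp add: paths)
    finally show ?thesis .
  qed
  moreover have "h' \<cdot> (c \<cdot> r) = \<beta> x' \<cdot> (\<Sigma>m x x' a \<cdot> h1)"
  proof -
    have "h' \<cdot> (c \<cdot> r) = (h' \<cdot> c) \<cdot> r" using T by (simp add: paths)
    also have "\<dots> = shm x x' a \<cdot> (\<beta> x \<cdot> h1)" unfolding e(3)[symmetric] using T by (simp add: paths h)
    also have "\<dots> = \<beta> x' \<cdot> (\<Sigma>m x x' a \<cdot> h1)"
      using T by (simp add: comp_reduce[OF shm(2)[OF Z1(1) Z(1) a]] paths)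
    finally show ?thesis .
  qed
  ultimately show ?thesis unfolding red_tri_def using Z A by blast
qed

lemma red_tri_morphism:
  assumes t: "red_tri x y z f g h" and t': "red_tri x' y' z' f' g' h'"
    and a: "arr x x' a" and b: "arr y y' b" and e: "b \<cdot> f = f' \<cdot> a"
  shows "\<exists>c. arr z z' c \<and> c \<cdot> g = g' \<cdot> b \<and> shm x x' a \<cdot> h = h' \<cdot> c"
proof -
  obtain C g1 h1 r where t1: "tri D x y C f g1 h1" and r: "reflection Z C z r" and g: "g = r \<cdot> g1"
    and h: "h \<cdot> r = \<beta> x \<cdot> h1" using t by (auto simp: red_tri_def)
  obtain C' g1' h1' r' where t1': "tri D x' y' C' f' g1' h1'" and r': "reflection Z C' z' r'" and g': "g' = r' \<cdot> g1'"
    and h': "h' \<cdot> r' = \<beta> x' \<cdot> h1'" using t' by (auto simp: red_tri_def)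
  note Z = red_tri_in[OF t] red_tri_in[OF t']
  obtain k where k: "k \<in> Hom D C C'" "k \<cdot> g1 = g1' \<cdot> b" "\<Sigma>m x x' a \<cdot> h1 = h1' \<cdot> k"
    using tri_morphism[OF t1 t1' arrD(3)[OF a] arrD(3)[OF b] e] by blast
  note T0 = tri_arr[OF t1] tri_arr[OF t1'] reflection_arr[OF r] reflection_arr[OF r']
  have k': "arr C C' k" using k(1) T0 by (auto simp: arr_def)
  obtain c where c: "arr z z' c" "c \<cdot> r = r' \<cdot> k"
    using reflection_ex[OF r arr_comp[OF T0(8) k'] Z(6)] by blast
  note T = T0 k' c(1) a b shift_arr[OF a] shm(1)[OF Z(1,4) a] beta_arr[OF Z(1)] beta_arr[OF Z(4)]
    red_tri_arr(3)[OF t] red_tri_arr(3)[OF t']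
  have "c \<cdot> g = g' \<cdot> b" unfolding g g' using T k(2) by (simp add: paths comp_reduce[OF c(2)])
  moreover have "shm x x' a \<cdot> h = h' \<cdot> c"
  proof (rule reflection_eq[OF r _ _ sh_in[OF Z(4)]])
    show "shm x x' a \<cdot> h \<cdot> r = h' \<cdot> c \<cdot> r"
      using T k(3) by (simp add: paths h c(2) comp_reduce[OF h'] comp_reduce[OF shm(2)[OF Z(1,4) a]])
  qed (use T in \<open>simp_all add: paths\<close>)
  ultimately show ?thesis using c by blast
qed

lemma red_tri_comp_zero: assumes t: "red_tri x y z f g h" shows "g \<cdot> f = 0"
proof -
  obtain C g1 h1 r where t1: "tri D x y C f g1 h1" and r: "reflection Z C z r" and g: "g = r \<cdot> g1"
    using t by (auto simp: red_tri_def)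
  note T = tri_arr[OF t1] reflection_arr[OF r]
  show ?thesis using T comp_zero_right[OF T(4) arrD(1)[OF T(1)]] tri_comp_zero(1)[OF t1] by (simp add: g paths)
qed

lemma red_tri_coker:
  assumes t: "red_tri x y z f g h" and u: "arr y q u" "u \<cdot> f = 0" and q: "q \<in> Z"
  shows "\<exists>v. arr z q v \<and> u = v \<cdot> g"
proof -
  obtain C g1 h1 r where t1: "tri D x y C f g1 h1" and r: "reflection Z C z r" and g: "g = r \<cdot> g1"
    using t by (auto simp: red_tri_def)
  obtain v where v: "arr C q v" "u = v \<cdot> g1" using weak_cokernel[OF t1 u] by blast
  obtain w where w: "arr z q w" "w \<cdot> r = v" using reflection_ex[OF r v(1) q] by blast
  note T = tri_arr[OF t1] reflection_arr[OF r] w(1) v(1)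
  have "u = w \<cdot> g" using T by (simp add: v(2) g paths flip: w(2))
  with w show ?thesis by blast
qed

text \<open>
  Let \<open>r\<close> be the reflection of the cone of \<open>f\<close> that is used in the given triangle, with cocone \<open>s\<close>. By the
  octahedral axiom the cone \<open>c\<close> of \<open>g\<close> lies in a triangle \<open>\<Sigma>x \<rightarrow> c \<rightarrow> \<Sigma>s\<close>. Since there are no maps from \<open>s\<close> or
  \<open>\<Sigma>s\<close> to \<open>Z\<close>, a map from \<open>c\<close> to \<open>Z\<close> is the same as a map from \<open>\<Sigma>x\<close> to \<open>Z\<close>, and so the reflection
  of \<open>c\<close> is \<open>x\<langle>1\<rangle>\<close>.
\<close>
lemma red_tri_rot:
  assumes t: "red_tri x y z f g h"
  shows "red_tri y z (sh x) g h (- shm x y f)"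
proof -
  obtain C g1 h1 r where t1: "tri D x y C f g1 h1" and r: "reflection Z C z r" and g: "g = r \<cdot> g1"
    and h: "h \<cdot> r = \<beta> x \<cdot> h1" using t by (auto simp: red_tri_def)
  note Z = red_tri_in[OF t]
  have ob: "x \<in> Ob D" "y \<in> Ob D" "z \<in> Ob D" using Z Z_Ob by auto
  obtain s a d where s: "orth Z s" and ts: "tri D s C z a r d" using r by (auto simp: reflection_def)
  have sob: "s \<in> Ob D" using s by (simp add: orth_def)
  obtain c l m where tc: "tri D y z c g l m" using ex_tri[OF arrD[OF red_tri_arr(2)[OF t]]] by blast
  obtain A B where AB: "tri D (\<Sigma> x) c (\<Sigma> s) A B (\<Sigma>m C (\<Sigma> x) h1 \<cdot> - \<Sigma>m s C a)"
    "A \<cdot> h1 = l \<cdot> r" "m \<cdot> A = - \<Sigma>m x y f"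
    using octahedral[OF tri_rot[OF t1] tri_rot[OF ts] tc[unfolded g]] by blast
  note T = tri_arr[OF t1] tri_arr[OF tc] tri_arr(1,2)[OF AB(1)] reflection_arr[OF r] beta_arr[OF Z(1)]
    beta_arr[OF Z(2)] red_tri_arr[OF t] shm(1)[OF Z(1,2) red_tri_arr(1)[OF t]] shift_arr[OF red_tri_arr(1)[OF t]]
  \<comment> \<open>a map killed by \<open>A\<close> factors through \<open>\<Sigma>s\<close>, which has no nonzero maps to \<open>Z\<close>\<close>
  have Aepi: "u = 0" if u: "arr c q u" "u \<cdot> A = 0" "q \<in> Z" for u q
  proof -
    obtain v where v: "arr (\<Sigma> s) q v" "u = v \<cdot> B" using weak_cokernel[OF AB(1) u(1,2)] by blast
    have "v = 0" using s u(3) nohomD[OF _ v(1)] unfolding orth_def by blast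
    then show ?thesis using v comp_zero_left[OF T(8) arrD(2)[OF v(1)]] by simp
  qed
  obtain e where e: "arr s (\<Sigma> x) e" "tri D s (\<Sigma> x) c e A B" using tri_unrot_ex[OF AB(1) sob] by blast
  have "\<beta> x \<cdot> e = 0"
    using s sh_in[OF Z(1)] nohomD arr_comp[OF T(10) e(1)] unfolding orth_def by blast
  then obtain v where v: "arr c (sh x) v" "v \<cdot> A = \<beta> x" using weak_cokernel[OF e(2) T(10)] by metis
  obtain z' r' where r': "reflection Z c z' r'" using reflection_cone[OF Z(2,3) tc] by blast
  note r'a = reflection_arr[OF r'] and Z' = reflection_in[OF r']
  obtain p where p: "arr z' (sh x) p" "p \<cdot> r' = v" using reflection_ex[OF r' v(1) sh_in[OF Z(1)]] by blast
  obtain p' where p': "arr (sh x) z' p'" "p' \<cdot> \<beta> x = r' \<cdot> A"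
    using reflection_ex[OF reflection_shift[OF Z(1)] arr_comp[OF r'a T(7)] Z'] by blast
  have "is_iso D z' (sh x) p"
  proof (rule is_isoI[OF p(1) p'(1)])
    show "p \<cdot> p' = ident D (sh x)"
      by (rule reflection_eq[OF reflection_shift[OF Z(1)] _ _ sh_in[OF Z(1)]])
        (use T p(1) p'(1) r'a Z_Ob sh_in Z v(2) in \<open>auto simp: paths p'(2) comp_reduce[OF p(2)]\<close>)
    have rv: "p' \<cdot> v = r'"
    proof -
      have "r' - p' \<cdot> v = 0"
      proof (rule Aepi[OF _ _ Z'])
        show 1: "arr c z' (r' - p' \<cdot> v)" using T r'a p'(1) v(1) by (simp add: paths arr_diff)
        show "(r' - p' \<cdot> v) \<cdot> A = 0"
          using T comp_diff_left[OF T(7) r'a arr_comp[OF p'(1) v(1)]] p'(1) v(1) by (simp add: paths v(2) p'(2))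
      qed
      then show ?thesis by simp
    qed
    show "p' \<cdot> p = ident D z'"
      by (rule reflection_eq[OF r' _ _ Z']) (use p(1) p'(1) r'a Z_Ob[OF Z'] in \<open>simp_all add: paths p(2) rv\<close>)
  qed
  from reflection_iso[OF r' this sh_in[OF Z(1)] Z_Ob[OF sh_in[OF Z(1)]]]
  have rv: "reflection Z c (sh x) v" by (simp add: p(2))
  have "h = v \<cdot> l"
    by (rule reflection_eq[OF r _ _ sh_in[OF Z(1)]])
      (use T v(1) in \<open>simp_all add: paths h AB(2)[symmetric] comp_reduce[OF v(2)]\<close>)
  moreover have "- shm x y f \<cdot> v = \<beta> y \<cdot> m"
  proof -
    have 1: "arr c (sh y) (- shm x y f \<cdot> v)" "arr c (sh y) (\<beta> y \<cdot> m)"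
      using T v(1) arr_minus[OF T(15)] by (simp_all add: paths)
    have "- shm x y f \<cdot> v - \<beta> y \<cdot> m = 0"
    proof (rule Aepi[OF arr_diff[OF 1] _ sh_in[OF Z(2)]])
      have "(- shm x y f \<cdot> v) \<cdot> A = - shm x y f \<cdot> \<beta> x"
        using T v arr_minus[OF T(15)] by (simp add: paths)
      also have "\<dots> = - (\<beta> y \<cdot> \<Sigma>m x y f)"
        using comp_minus_left[OF T(10,15)] shm(2)[OF Z(1,2) T(12)] by simp
      also have "\<dots> = (\<beta> y \<cdot> m) \<cdot> A" using comp_minus_right[OF T(16,11)] T AB(3) by (simp add: paths)
      finally show "(- shm x y f \<cdot> v - \<beta> y \<cdot> m) \<cdot> A = 0" using comp_diff_left[OF T(7) 1] by simp
    qed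
    then show ?thesis by simp
  qed
  ultimately show ?thesis unfolding red_tri_def using Z arr_minus[OF T(15)] tc rv by blast
qed

end

section \<open>Rotation backwards and the octahedral axiom\<close>

context triangulated_reduction
begin

lemma factor_minus: "arr x y f \<Longrightarrow> arr y z v \<Longrightarrow> v \<cdot> (- f) = (- v) \<cdot> f"
  using comp_minus_left comp_minus_right by metis

text \<open>
  Rotation moves the exactness of \<open>red_tri_coker\<close> along the triangle; the signs of rotated morphisms are
  absorbed into the factorisation.
\<close>
lemma red_tri_coker2:
  assumes "red_tri x y z f g h" "arr z q u" "u \<cdot> g = 0" "q \<in> Z"
  shows "\<exists>v. arr (sh x) q v \<and> u = v \<cdot> h"
  by (rule red_tri_coker[OF red_tri_rot[OF assms(1)] assms(2-4)])

lemma red_tri_coker3: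
  assumes t: "red_tri x y z f g h" and u: "arr (sh x) q u" "u \<cdot> h = 0" "q \<in> Z"
  shows "\<exists>v. arr (sh y) q v \<and> u = v \<cdot> shm x y f"
  using red_tri_coker2[OF red_tri_rot[OF t] u] factor_minus[OF shm(1)[OF red_tri_in(1,2)[OF t] red_tri_arr(1)[OF t]]] arr_minus
  by metis

lemma red_tri_coker4:
  assumes t: "red_tri x y z f g h" and u: "arr (sh y) q u" "u \<cdot> shm x y f = 0" "q \<in> Z"
  shows "\<exists>v. arr (sh z) q v \<and> u = v \<cdot> shm y z g"
proof -
  have "u \<cdot> (- shm x y f) = 0"
    using comp_minus_right[OF shm(1)[OF red_tri_in(1,2)[OF t] red_tri_arr(1)[OF t]] u(1)] u(2) by simp
  from red_tri_coker3[OF red_tri_rot[OF t] u(1) this u(3)] show ?thesis .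
qed

lemma red_tri_coker5:
  assumes t: "red_tri x y z f g h" and u: "arr (sh z) q u" "u \<cdot> shm y z g = 0" "q \<in> Z"
  shows "\<exists>v. arr (sh (sh x)) q v \<and> u = v \<cdot> shm z (sh x) h"
  by (rule red_tri_coker4[OF red_tri_rot[OF t] u])

lemma red_tri_comp_zero2: "red_tri x y z f g h \<Longrightarrow> h \<cdot> g = 0"
  using red_tri_comp_zero[OF red_tri_rot] .

lemma red_tri_comp_zero3: assumes t: "red_tri x y z f g h" shows "shm x y f \<cdot> h = 0"
  using red_tri_comp_zero2[OF red_tri_rot[OF t]]
    comp_minus_left[OF red_tri_arr(3)[OF t] shm(1)[OF red_tri_in(1,2)[OF t] red_tri_arr(1)[OF t]]] by simp

text \<open>
  Complete \<open>f\<close> to a reduced triangle \<open>x \<rightarrow> y \<rightarrow> z'\<close>. When both triangles are rotated until they start with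
  \<open>- f\<langle>1\<rangle>\<close>, the identities extend to a morphism \<open>z\<langle>1\<rangle> \<rightarrow> z'\<langle>1\<rangle>\<close>, which descends to \<open>p: z \<rightarrow> z'\<close>
  because \<open>\<langle>1\<rangle>\<close> is fully faithful. Contravariant exactness supplies a left inverse \<open>j\<close> of \<open>p\<close> and shows that
  it is also a right inverse.
\<close>
lemma red_tri_unrot:
  assumes t: "red_tri y z (sh x) g h (- shm x y f)" and x: "x \<in> Z" and f: "arr x y f"
  shows "red_tri x y z f g h"
proof -
  note Z = x red_tri_in(1,2)[OF t]
  have gh: "arr y z g" "arr z (sh x) h" using red_tri_arr[OF t] by auto
  obtain z' g' h' where t': "red_tri x y z' f g' h'" using red_tri_ex[OF Z(1,2) f] by blast
  note Z' = red_tri_in(3)[OF t'] and gh' = red_tri_arr(2,3)[OF t']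
  note shZ = sh_in[OF Z(1)] sh_in[OF Z(2)] sh_in[OF Z(3)] sh_in[OF Z']
  have ob: "x \<in> Ob D" "y \<in> Ob D" "z \<in> Ob D" "z' \<in> Ob D" "sh x \<in> Ob D" "sh y \<in> Ob D"
    using Z Z' shZ Z_Ob by auto
  note F = shm(1)[OF Z(1,2) f] and G = shm(1)[OF Z(2,3) gh(1)] and G' = shm(1)[OF Z(2) Z' gh'(1)]
    and H = shm(1)[OF Z(3) shZ(1) gh(2)] and H' = shm(1)[OF Z' shZ(1) gh'(2)]
  from red_tri_morphism[OF red_tri_rot[OF red_tri_rot[OF t]] red_tri_rot[OF red_tri_rot[OF red_tri_rot[OF t']]],
      of "ident D (sh x)" "ident D (sh y)"]
  obtain c where c: "arr (sh z) (sh z') c" "c \<cdot> - shm y z g = - shm y z' g' \<cdot> ident D (sh y)"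
    "shm (sh x) (sh x) (ident D (sh x)) \<cdot> - shm z (sh x) h = - shm z' (sh x) h' \<cdot> c"
    using ob arr_minus[OF F] comp_ident_left[OF arr_minus[OF F]] comp_ident_right[OF arr_minus[OF F]]
      arr_ident by auto
  obtain p where p: "arr z z' p" "shm z z' p = c" using shm_full[OF Z(3) Z' c(1)] by blast
  have pg: "p \<cdot> g = g'"
  proof (rule shm_inj[OF Z(2) Z' arr_comp[OF p(1) gh(1)] gh'(1)])
    have "c \<cdot> shm y z g = shm y z' g'"
      using c(2) comp_minus_right[OF G c(1)] comp_ident_right[OF arr_minus[OF G']] by simp
    then show "shm y z' (p \<cdot> g) = shm y z' g'" by (simp add: shm_comp[OF Z(2,3) Z' gh(1) p(1)] p(2))
  qed
  have hp: "h' \<cdot> p = h"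
  proof (rule shm_inj[OF Z(3) shZ(1) arr_comp[OF gh'(2) p(1)] gh(2)])
    have "shm z' (sh x) h' \<cdot> c = shm z (sh x) h"
      using c(3) comp_minus_left[OF c(1) H'] comp_ident_left[OF arr_minus[OF H]] by (simp add: shm_ident[OF shZ(1)])
    then show "shm z (sh x) (h' \<cdot> p) = shm z (sh x) h"
      by (simp add: shm_comp[OF Z(3) Z' shZ(1) p(1) gh'(2)] p(2))
  qed
  have gf: "g \<cdot> f = 0"
  proof (rule shm_faithful[OF Z(1,3) arr_comp[OF gh(1) f]])
    have "- shm y z g \<cdot> - shm x y f = 0" using red_tri_comp_zero[OF red_tri_rot[OF red_tri_rot[OF t]]] .
    then show "shm x z (g \<cdot> f) = 0"
      using shm_comp[OF Z(1-3) f gh(1)] comp_minus_left[OF arr_minus[OF F] G] comp_minus_right[OF F G] by simp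
  qed
  obtain k where k: "arr z' z k" "g = k \<cdot> g'" using red_tri_coker[OF t' gh(1) gf Z(3)] by blast
  have kp: "arr z z (ident D z - k \<cdot> p)" "arr z z (ident D z)" "arr z z (k \<cdot> p)"
    using k(1) p(1) ob by (simp_all add: paths arr_diff)
  have "(ident D z - k \<cdot> p) \<cdot> g = 0"
    using comp_diff_left[OF gh(1) kp(2,3)] k(1) p(1) gh by (simp add: paths pg flip: k(2))
  then obtain v where v: "arr (sh x) z v" "ident D z - k \<cdot> p = v \<cdot> h"
    using red_tri_coker[OF t kp(1) _ Z(3)] by blast
  define j where "j = k + v \<cdot> h'"
  have vh: "arr z' z (v \<cdot> h')" using v(1) gh'(2) by (simp add: paths)
  have j: "arr z' z j" unfolding j_def by (rule arr_add[OF k(1) vh])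
  have jp: "j \<cdot> p = ident D z"
    using comp_add_left[OF p(1) k(1) vh] v(1) gh' p(1) by (simp add: j_def paths hp flip: v(2))
  have jg: "j \<cdot> g' = g" using j p(1) gh(1) ob by (simp add: paths comp_reduce[OF jp] flip: pg)
  have pj: "arr z' z' (p \<cdot> j)" "arr z' z' (ident D z')" "arr z' z' (p \<cdot> j - ident D z')"
    using p(1) j ob by (simp_all add: paths arr_diff)
  have "(p \<cdot> j - ident D z') \<cdot> g' = 0"
    using comp_diff_left[OF gh'(1) pj(1,2)] p(1) j gh' by (simp add: paths jg pg)
  then obtain w where w: "arr (sh x) z' w" "p \<cdot> j - ident D z' = w \<cdot> h'"
    using red_tri_coker2[OF t' pj(3) _ Z'] by blast
  have "(p \<cdot> j - ident D z') \<cdot> p = 0"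
    using comp_diff_left[OF p(1) pj(1,2)] p(1) j by (simp add: paths jp)
  then have "w \<cdot> h = 0" using w(1) gh'(2) p(1) by (simp add: w(2) paths hp)
  then obtain u where u: "arr (sh y) z' u" "w = u \<cdot> - shm x y f"
    using red_tri_coker[OF red_tri_rot[OF t] w(1) _ Z'] by blast
  have "w \<cdot> h' = u \<cdot> (- (shm x y f \<cdot> h'))"
    using u arr_minus[OF F] gh'(2) by (simp add: paths comp_minus_left[OF gh'(2) F])
  also have "\<dots> = 0" using red_tri_comp_zero3[OF t'] comp_zero_right[OF u(1) ob(4)] by simp
  finally have pj1: "p \<cdot> j = ident D z'" using w(2) by simp
  have i: "is_iso D z' z j" by (rule is_isoI[OF j p(1) pj1 jp])
  show ?thesis
  proof (rule red_tri_iso[OF t' Z f gh is_iso_ident[OF ob(1)] is_iso_ident[OF ob(2)] i])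
    show "ident D y \<cdot> f = f \<cdot> ident D x" using f by (simp add: paths)
    show "j \<cdot> g' = g \<cdot> ident D y" using jg gh by (simp add: paths)
    have "h' = h' \<cdot> (p \<cdot> j)" using gh' by (simp add: pj1 paths)
    also have "\<dots> = h \<cdot> j" using gh' p(1) j by (simp add: comp_reduce[OF hp] paths)
    finally show "shm x x (ident D x) \<cdot> h' = h \<cdot> j" using gh' by (simp add: shm_ident[OF x] paths)
  qed
qed

text \<open>
  The morphisms \<open>a\<close> and \<open>b\<close> are the reflections of the morphisms of cones in an octahedron of \<open>D\<close>. The third
  triangle of that octahedron maps to the triangle on \<open>a\<close>, and the reflection \<open>s: x' \<rightarrow> x2\<close> of this map
  has to be inverted, where \<open>z' \<rightarrow> y' \<rightarrow> x2\<close> is the reduced triangle on \<open>a\<close>.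

  For this it suffices that \<open>z' \<rightarrow> y' \<rightarrow> x' \<rightarrow> z'\<langle>1\<rangle> \<rightarrow> y'\<langle>1\<rangle>\<close> becomes exact at \<open>x'\<close> and \<open>z'\<langle>1\<rangle>\<close> under
  \<open>Hom(-, q)\<close> for \<open>q \<in> Z\<close> (facts \<open>bker\<close> and \<open>jker\<close>). Both follow by a diagram chase through the three
  given triangles, correcting a factorisation through one of them by a map that another one provides.
\<close>
lemma red_tri_octahedral:
  assumes t1: "red_tri x y z' f j k" and t2: "red_tri y z x' g n p" and t3: "red_tri x z y' (g \<cdot> f) l m"
  shows "\<exists>a b. red_tri z' y' x' a b (shm y z' j \<cdot> p) \<and>
    a \<cdot> j = l \<cdot> g \<and> m \<cdot> a = k \<and> b \<cdot> l = n \<and> p \<cdot> b = shm x y f \<cdot> m"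
proof -
  note Z = red_tri_in(1,2)[OF t1] red_tri_in(2,3)[OF t2] red_tri_in(3)[OF t3] red_tri_in(3)[OF t1]
    \<comment> \<open>in the order x, y, z, x', y', z'\<close>
  note A0 = red_tri_arr[OF t1] red_tri_arr[OF t2] red_tri_arr(2,3)[OF t3]
  note sZ = sh_in[OF Z(1)] sh_in[OF Z(2)] sh_in[OF Z(3)] sh_in[OF Z(6)]
  obtain c1 j1 k1 r1 where T1: "tri D x y c1 f j1 k1" and r1: "reflection Z c1 z' r1" and j: "j = r1 \<cdot> j1"
    and k: "k \<cdot> r1 = \<beta> x \<cdot> k1" using t1 by (auto simp: red_tri_def)
  obtain c2 n2 p2 r2 where T2: "tri D y z c2 g n2 p2" and r2: "reflection Z c2 x' r2" and n: "n = r2 \<cdot> n2"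
    and p: "p \<cdot> r2 = \<beta> y \<cdot> p2" using t2 by (auto simp: red_tri_def)
  obtain c3 l3 m3 r3 where T3: "tri D x z c3 (g \<cdot> f) l3 m3" and r3: "reflection Z c3 y' r3" and l: "l = r3 \<cdot> l3"
    and m: "m \<cdot> r3 = \<beta> x \<cdot> m3" using t3 by (auto simp: red_tri_def)
  obtain A B where AB: "tri D c1 c3 c2 A B (\<Sigma>m y c1 j1 \<cdot> p2)" "A \<cdot> j1 = l3 \<cdot> g" "m3 \<cdot> A = k1"
    "B \<cdot> l3 = n2" "p2 \<cdot> B = \<Sigma>m x y f \<cdot> m3" using octahedral[OF T1 T2 T3] by blast
  note A1 = tri_arr[OF T1] tri_arr(2,3)[OF T2] tri_arr(2,3)[OF T3] tri_arr(1,2)[OF AB(1)]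
    reflection_arr[OF r1] reflection_arr[OF r2] reflection_arr[OF r3]
  obtain a where a: "arr z' y' a" "a \<cdot> r1 = r3 \<cdot> A"
    using reflection_ex[OF r1 arr_comp[OF A1(12) A1(8)] Z(5)] by blast
  obtain b where b: "arr y' x' b" "b \<cdot> r3 = r2 \<cdot> B"
    using reflection_ex[OF r3 arr_comp[OF A1(11) A1(9)] Z(4)] by blast
  note S = shift_arr[OF A0(1)] shift_arr[OF A1(2)] shift_arr[OF A1(10)] shift_arr[OF A0(2)]
    beta_arr[OF Z(1)] beta_arr[OF Z(2)] beta_arr[OF Z(6)]
    shm(1)[OF Z(1,2) A0(1)] shm(1)[OF Z(2,6) A0(2)] shm(1)[OF Z(2,3) A0(4)]
  note shf = shm(2)[OF Z(1,2) A0(1)] and shj = shm(2)[OF Z(2,6) A0(2)]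
  note T = A0 A1 a(1) b(1) S
  have aj: "a \<cdot> j = l \<cdot> g"
    using T by (simp add: j l paths comp_reduce[OF a(2)] AB(2))
  have ma: "m \<cdot> a = k"
    by (rule reflection_eq[OF r1 _ _ sZ(1)]) (use T in \<open>simp_all add: paths a(2) k comp_reduce[OF m] AB(3)\<close>)
  have bl: "b \<cdot> l = n" using T by (simp add: n l paths comp_reduce[OF b(2)] AB(4))
  have pb: "p \<cdot> b = shm x y f \<cdot> m"
    by (rule reflection_eq[OF r3 _ _ sZ(2)])
      (use T in \<open>simp_all add: paths b(2) m comp_reduce[OF p] AB(5) comp_reduce[OF shf]\<close>)
  \<comment> \<open>the reduced triangle on \<open>a\<close>, with third object \<open>x2\<close>, and the comparison \<open>s\<close> of \<open>x'\<close> with \<open>x2\<close>\<close>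
  obtain E e1 e2 where tE: "tri D z' y' E a e1 e2" using ex_tri[OF arrD[OF a(1)]] by blast
  obtain x2 rE where rE: "reflection Z E x2 rE" using reflection_cone[OF Z(6,5) tE] by blast
  note Ea = tri_arr[OF tE] reflection_arr[OF rE] and Zx2 = reflection_in[OF rE]
  obtain k2 where k2: "arr x2 (sh z') k2" "k2 \<cdot> rE = \<beta> z' \<cdot> e2"
    using reflection_ex[OF rE arr_comp[OF S(7) Ea(3)] sZ(4)] by blast
  define e where "e = rE \<cdot> e1"
  have t4: "red_tri z' y' x2 a e k2" unfolding red_tri_def e_def using Z k2 tE rE by blast
  have ea: "arr y' x2 e" unfolding e_def using Ea by (simp add: paths)
  obtain q where q: "q \<in> Hom D c2 E" "q \<cdot> B = e1 \<cdot> r3" "\<Sigma>m c1 z' r1 \<cdot> (\<Sigma>m y c1 j1 \<cdot> p2) = e2 \<cdot> q"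
    using tri_morphism[OF AB(1) tE arrD(3)[OF A1(10)] arrD(3)[OF A1(12)]] a(2) by metis
  have qa: "arr c2 E q" using q(1) A1(11) Ea(3) by (auto simp: arr_def)
  obtain s where s: "arr x' x2 s" "s \<cdot> r2 = rE \<cdot> q" using reflection_ex[OF r2 arr_comp[OF Ea(4) qa] Zx2] by blast
  have sb: "s \<cdot> b = e"
    by (rule reflection_eq[OF r3 _ _ Zx2])
      (use T Ea qa s(1) ea in \<open>simp_all add: paths b(2) comp_reduce[OF s(2)] q(2), simp add: e_def paths\<close>)
  have ks: "k2 \<cdot> s = shm y z' j \<cdot> p"
  proof (rule reflection_eq[OF r2 _ _ sZ(4)])
    have 1: "\<Sigma>m c1 z' r1 \<cdot> \<Sigma>m y c1 j1 = \<Sigma>m y z' j" by (simp add: j shift_comp[OF A1(10,2)])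
    show "k2 \<cdot> s \<cdot> r2 = shm y z' j \<cdot> p \<cdot> r2"
      using T Ea qa s(1) k2(1) by (simp add: paths s(2) comp_reduce[OF k2(2)] p comp_reduce[OF shj] comp_reduce[OF 1]
         q(3)[symmetric])
  qed (use T s(1) k2(1) in \<open>simp_all add: paths\<close>)
  have ob: "x' \<in> Ob D" "x2 \<in> Ob D" "z' \<in> Ob D" "y' \<in> Ob D" using Z Zx2 Z_Ob by auto
  have jf: "shm y z' j \<cdot> shm x y f = 0"
    using shm_comp[OF Z(1,2,6) A0(1,2)] red_tri_comp_zero[OF t1] shm_zero[OF Z(1,6)] by simp
  have bker: "\<exists>t. arr (sh z') w t \<and> v = t \<cdot> (shm y z' j \<cdot> p)" if v: "arr x' w v" "v \<cdot> b = 0" and w: "w \<in> Z" for v w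
  proof -
    have wob: "w \<in> Ob D" using w Z_Ob by blast
    have "v \<cdot> n = (v \<cdot> b) \<cdot> l" using v(1) T by (simp add: paths flip: bl)
    then have "v \<cdot> n = 0" using v(2) comp_zero_left[OF A0(7) wob] by simp
    then obtain t where t: "arr (sh y) w t" "v = t \<cdot> p" using red_tri_coker2[OF t2 v(1) _ w] by blast
    have tf: "arr (sh x) w (t \<cdot> shm x y f)" using t(1) T by (simp add: paths)
    have "t \<cdot> shm x y f \<cdot> m = v \<cdot> b" using t(1) T by (simp add: paths pb t(2))
    from red_tri_coker3[OF t3 tf this[unfolded v(2)] w]
    obtain u where u: "arr (sh z) w u" "t \<cdot> shm x y f = u \<cdot> shm x z (g \<cdot> f)" by blast
    have ug: "arr (sh y) w (u \<cdot> shm y z g)" "arr (sh y) w (t - u \<cdot> shm y z g)"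
      using u(1) t(1) T by (simp_all add: paths arr_diff)
    have "(t - u \<cdot> shm y z g) \<cdot> shm x y f = 0"
      using comp_diff_left[OF S(8) t(1) ug(1)] u T by (simp add: shm_comp[OF Z(1-3) A0(1,4)] paths)
    then obtain t' where t': "arr (sh z') w t'" "t - u \<cdot> shm y z g = t' \<cdot> shm y z' j"
      using red_tri_coker4[OF t1 ug(2) _ w] by blast
    have "v = (t - u \<cdot> shm y z g) \<cdot> p + u \<cdot> (shm y z g \<cdot> p)"
      using comp_diff_left[OF A0(6) t(1) ug(1)] u(1) T by (simp add: paths t(2))
    also have "\<dots> = t' \<cdot> (shm y z' j \<cdot> p)"
      using red_tri_comp_zero3[OF t2] comp_zero_right[OF u(1) ob(1)] t'(1) T by (simp add: t'(2) paths)
    finally show ?thesis using t' by blast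
  qed
  have jker: "\<exists>u. arr (sh y') w u \<and> t = u \<cdot> shm z' y' a"
    if t: "arr (sh z') w t" "t \<cdot> (shm y z' j \<cdot> p) = 0" and w: "w \<in> Z" for t w
  proof -
    have tj: "arr (sh y) w (t \<cdot> shm y z' j)" using t(1) T by (simp add: paths)
    have "t \<cdot> shm y z' j \<cdot> p = 0" using t T by (simp add: paths)
    from red_tri_coker3[OF t2 tj this w] obtain u where u: "arr (sh z) w u" "t \<cdot> shm y z' j = u \<cdot> shm y z g" by blast
    have "u \<cdot> shm x z (g \<cdot> f) = (t \<cdot> shm y z' j) \<cdot> shm x y f"
      using u T by (simp add: shm_comp[OF Z(1-3) A0(1,4)] paths)
    also have "\<dots> = 0" using t(1) T jf comp_zero_right[OF t(1) Z_Ob[OF sZ(1)]] by (simp add: paths)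
    finally obtain u' where u': "arr (sh y') w u'" "u = u' \<cdot> shm z y' l" using red_tri_coker4[OF t3 u(1) _ w] by blast
    note la = shm(1)[OF Z(3,5) A0(7)] and aa = shm(1)[OF Z(6,5) a(1)]
      and ma' = shm(1)[OF Z(5) sZ(1) A0(8)]
    have ua: "arr (sh z') w (u' \<cdot> shm z' y' a)" "arr (sh z') w (t - u' \<cdot> shm z' y' a)"
      using u'(1) t(1) aa by (simp_all add: paths arr_diff)
    have "t \<cdot> shm y z' j = u' \<cdot> (shm z y' l \<cdot> shm y z g)" using u(2) u'(1) T la by (simp add: u'(2) paths)
    also have "\<dots> = u' \<cdot> (shm z' y' a \<cdot> shm y z' j)"
      by (simp add: aj flip: shm_comp[OF Z(2,3,5) A0(4,7)] shm_comp[OF Z(2,6,5) A0(2) a(1)])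
    finally have "(t - u' \<cdot> shm z' y' a) \<cdot> shm y z' j = 0"
      using comp_diff_left[OF S(9) t(1) ua(1)] u'(1) aa T by (simp add: paths)
    from red_tri_coker5[OF t1 ua(2) this w] obtain v where v: "arr (sh (sh x)) w v"
      "t - u' \<cdot> shm z' y' a = v \<cdot> shm z' (sh x) k" by blast
    have "shm z' (sh x) k = shm y' (sh x) m \<cdot> shm z' y' a"
      using shm_comp[OF Z(6,5) sZ(1) a(1) A0(8)] ma by simp
    then have "t = (u' + v \<cdot> shm y' (sh x) m) \<cdot> shm z' y' a"
      using comp_add_left[OF aa u'(1) arr_comp[OF v(1) ma']] v aa ma' by (simp add: paths algebra_simps)
    then show ?thesis using arr_add[OF u'(1) arr_comp[OF v(1) ma']] by blast
  qed
  have "b \<cdot> a = 0"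
  proof (rule reflection_zero[OF r1 arr_comp[OF b(1) a(1)] Z(4)])
    have "b \<cdot> a \<cdot> r1 = r2 \<cdot> (B \<cdot> A)" using T by (simp add: paths a(2) comp_reduce[OF b(2)])
    also have "\<dots> = 0" using tri_comp_zero(1)[OF AB(1)] comp_zero_right[OF A1(11) arrD(1)[OF A1(8)]] by simp
    finally show "b \<cdot> a \<cdot> r1 = 0" .
  qed
  \<comment> \<open>the left inverse \<open>i\<close> of \<open>s\<close>: correct a factorisation of \<open>b\<close> through \<open>e\<close> by a multiple of \<open>k2\<close>\<close>
  from red_tri_coker[OF t4 b(1) this Z(4)] obtain u where u: "arr x2 x' u" "b = u \<cdot> e" by blast
  have us: "arr x' x' (ident D x' - u \<cdot> s)" "arr x' x' (u \<cdot> s)" "arr x' x' (ident D x')"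
    using u(1) s(1) ob by (simp_all add: paths arr_diff)
  have "(ident D x' - u \<cdot> s) \<cdot> b = 0"
    using comp_diff_left[OF b(1) us(3,2)] u(1) s(1) b(1) by (simp add: paths sb flip: u(2))
  from bker[OF us(1) this Z(4)] obtain t where t: "arr (sh z') x' t"
    "ident D x' - u \<cdot> s = t \<cdot> (shm y z' j \<cdot> p)" by blast
  define i where "i = u + t \<cdot> k2"
  have tk: "arr x2 x' (t \<cdot> k2)" using t(1) k2(1) by (simp add: paths)
  have i: "arr x2 x' i" unfolding i_def by (rule arr_add[OF u(1) tk])
  have i_s: "i \<cdot> s = ident D x'"
    using comp_add_left[OF s(1) u(1) tk] t(1) k2(1) s(1) by (simp add: i_def paths ks flip: t(2))
  have si: "arr x2 x2 (s \<cdot> i)" "arr x2 x2 (ident D x2)" "arr x2 x2 (s \<cdot> i - ident D x2)"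
    using i s(1) ob by (simp_all add: paths arr_diff)
  have sis: "(s \<cdot> i - ident D x2) \<cdot> s = 0"
    using comp_diff_left[OF s(1) si(1,2)] i s(1) by (simp add: paths i_s)
  have "(s \<cdot> i - ident D x2) \<cdot> e = ((s \<cdot> i - ident D x2) \<cdot> s) \<cdot> b" using si s(1) b(1) by (simp add: paths sb)
  also have "\<dots> = 0" using sis comp_zero_left[OF b(1) ob(2)] by simp
  finally obtain t' where t': "arr (sh z') x2 t'" "s \<cdot> i - ident D x2 = t' \<cdot> k2"
    using red_tri_coker2[OF t4 si(3) _ Zx2] by blast
  have "t' \<cdot> (shm y z' j \<cdot> p) = 0" using sis t' k2(1) s(1) by (simp add: paths ks)
  from jker[OF t'(1) this Zx2] obtain u' where u': "arr (sh y') x2 u'" "t' = u' \<cdot> shm z' y' a" by blast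
  have "t' \<cdot> k2 = u' \<cdot> (shm z' y' a \<cdot> k2)" using u' k2(1) shm(1)[OF Z(6,5) a(1)] by (simp add: paths)
  also have "\<dots> = 0" using red_tri_comp_zero3[OF t4] comp_zero_right[OF u'(1) ob(2)] by simp
  finally have si1: "s \<cdot> i = ident D x2" using t'(2) by simp
  have iso: "is_iso D x2 x' i" by (rule is_isoI[OF i s(1) si1 i_s])
  have jp: "arr x' (sh z') (shm y z' j \<cdot> p)" using T by (simp add: paths)
  have "red_tri z' y' x' a b (shm y z' j \<cdot> p)"
  proof (rule red_tri_iso[OF t4 Z(6,5,4) a(1) b(1) jp is_iso_ident[OF ob(3)] is_iso_ident[OF ob(4)] iso])
    show "ident D y' \<cdot> a = a \<cdot> ident D z'" using a by (simp add: paths)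
    show "i \<cdot> e = b \<cdot> ident D y'" using i s(1) b(1) ob by (simp add: paths comp_reduce[OF i_s] flip: sb)
    show "shm z' z' (ident D z') \<cdot> k2 = shm y z' j \<cdot> p \<cdot> i"
      using i s(1) k2(1) by (simp add: paths shm_ident[OF Z(6)] si1 flip: ks)
  qed
  then show ?thesis using aj ma bl pb by blast
qed

theorem reduced_triangulated:
  "triangulated_category
     \<lparr>Ob = Z, Hom = Hom D, cmp = cmp D, ident = ident D, scl = scl D,
      shift = sh, shiftm = shm, tri = red_tri\<rparr>" (is "triangulated_category ?Z")
proof -
  have iso: "is_iso ?Z = is_iso D" by (intro ext) (simp add: is_iso_def)
  have ds: "direct_sum ?Z d n xs \<iota> \<pi>" if "direct_sum D d n xs \<iota> \<pi>" "\<And>i. i < n \<Longrightarrow> xs i \<in> Z" for d n xs \<iota> \<pi>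
    using that Z_sum[OF that(2,1)] by (simp add: direct_sum_def)
  have lin: "linear_category ?Z"
    by (rule linear_category.intro; simp;
        blast intro: Z_Ob vector_space subspace_Hom ident_in_Hom cmp_in_Hom cmp_ident_right
          cmp_ident_left cmp_assoc cmp_add_left cmp_add_right cmp_scl_left cmp_scl_right)
  interpret L: linear_category ?Z by (rule lin)
  have arr: "L.arr x y f \<longleftrightarrow> x \<in> Z \<and> y \<in> Z \<and> arr x y f" for x y f
    using Z_Ob by (auto simp: L.arr_def arr_def)
  have zero: "zero_object ?Z z \<longleftrightarrow> z \<in> Z \<and> zero_object D z" for z
    using Z_Ob by (auto simp: L.zero_object_iff zero_object_iff)
  have sum: "\<exists>d \<iota> \<pi>. direct_sum ?Z d n xs \<iota> \<pi>" if xs: "\<And>i. i < n \<Longrightarrow> xs i \<in> Z" for n xs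
  proof -
    obtain d \<iota> \<pi> where "direct_sum D d n xs \<iota> \<pi>" using ex_direct_sum[of n xs] xs Z_Ob by blast
    from ds[OF this xs] show ?thesis by blast
  qed
  have diag: "diagram ?Z x y z f g h \<longleftrightarrow> x \<in> Z \<and> y \<in> Z \<and> z \<in> Z \<and> arr x y f \<and> arr y z g \<and> arr z (sh x) h"
    for x y z f g h using Z_Ob sh_in by (auto simp: diagram_def arr_def)
  have shl: "linear_functor ?Z sh shm"
    unfolding linear_functor_def using sh_in shm_ident shm(1) shm_add shm_scl shm_comp Z_Ob
    by (auto simp: arr_def)
  have shift: "autoequivalence ?Z sh shm"
  proof (rule L.autoequivalenceI[OF shl])
    show "f = 0" if "L.arr x y f" "shm x y f = 0" for x y f
      using that shm_faithful by (auto simp: arr)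
    show "\<exists>f. L.arr x y f \<and> shm x y f = g" if "x \<in> Ob ?Z" "y \<in> Ob ?Z" "L.arr (sh x) (sh y) g" for x y g
      using that shm_full[of x y g] by (auto simp: arr)
    show "\<exists>y\<in>Ob ?Z. isomorphic ?Z (sh y) x" if "x \<in> Ob ?Z" for x
    proof -
      have x: "x \<in> Z" using that by simp
      obtain y r where y: "y \<in> Z" "reflection Z (\<Sigma> y) x r" using reflection_dense[OF x] by blast
      obtain t where "is_iso D (sh y) x t" using reflection_unique[OF reflection_shift[OF y(1)] y(2)] by blast
      then have "isomorphic ?Z (sh y) x" using x sh_in[OF y(1)] by (auto simp: isomorphic_def iso)
      with y show ?thesis by auto
    qed
  qed
  show ?thesis
  proof (unfold_locales, goal_cases)
    case (1 n xs) then show ?case using sum[of n xs] by auto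
  next
    case 2 then show ?case using shift by simp
  next
    case (3 x y z f g h) then show ?case using red_tri_in[of x y z f g h] red_tri_arr[of x y z f g h] by (simp add: diag)
  next
    case (4 x y z f g h x' y' z' f' g' h') then show ?case
      using red_tri_iso[of x y z f g h x' y' z' f' g' h'] by (auto simp: diag diagrams_isomorphic_def iso)
  next
    case (5 x z) then show ?case using red_tri_ident[of x z] by (simp add: zero)
  next
    case (6 x y f) then show ?case using red_tri_ex[of x y f] Z_Ob by (simp add: arr_def)
  next
    case (7 x y z f g h) then show ?case using red_tri_rot[of x y z f g h] red_tri_unrot[of y z x g h f] by (auto simp: diag)
  next
    case (8 x y z f g h x' y' z' f' g' h' a b)
    then have t: "red_tri x y z f g h" "red_tri x' y' z' f' g' h'" by simp_all
    have "arr x x' a" "arr y y' b"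
      using 8 red_tri_in[OF t(1)] red_tri_in[OF t(2)] Z_Ob by (auto simp: arr_def)
    then show ?case using red_tri_morphism[OF t, of a b] 8 by (auto dest: arrD)
  next
    case (9 x y z' f j k z x' g n p y' l m) then show ?case
      using red_tri_octahedral[of x y z' f j k z x' g n p y' l m] by simp
  qed
qed

end

section \<open>Extension closures of orthogonal collections\<close>

context triangulated_category
begin

lemma ex_tri_second:
  assumes g: "arr y z g"
  shows "\<exists>x f h. tri D x y z f g h"
proof -
  obtain Q m n where Q: "tri D y z Q g m n" using ex_tri[OF arrD[OF g]] by blast
  note T = tri_arr[OF Q]
  obtain x where x: "x \<in> Ob D" "isomorphic D Q (\<Sigma> x)" using shift_dense[OF arrD(2)[OF T(2)]] .
  then obtain t where t: "is_iso D Q (\<Sigma> x) t" by (auto simp: isomorphic_def)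
  have ob: "y \<in> Ob D" "z \<in> Ob D" "Q \<in> Ob D" "\<Sigma> x \<in> Ob D" using T x(1) shift_Ob by (auto simp: arr_def)
  obtain t' where t': "arr Q (\<Sigma> x) t" "arr (\<Sigma> x) Q t'" "t' \<cdot> t = ident D Q"
    using is_isoE[OF t ob(3,4)] by metis
  have "tri D y z (\<Sigma> x) g (t \<cdot> m) (n \<cdot> t')"
    by (rule tri_iso[OF Q _ _ _ is_iso_ident[OF ob(1)] is_iso_ident[OF ob(2)] t])
      (use T t'(1,2) ob in \<open>auto simp: paths shift_ident t'(3)\<close>)
  then show ?thesis using tri_unrot_ex x(1) by blast
qed

lemma shift_power_Ob: "x \<in> Ob D \<Longrightarrow> (\<Sigma> ^^ i) x \<in> Ob D"
  by (induction i) (auto intro: shift_Ob)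

lemma shift_power_zero_object: "zero_object D x \<Longrightarrow> zero_object D ((\<Sigma> ^^ i) x)"
  by (induction i) (auto intro: shift_zero_object)

lemma shift_power_isomorphic: "isomorphic D x y \<Longrightarrow> isomorphic D ((\<Sigma> ^^ i) x) ((\<Sigma> ^^ i) y)"
  by (induction i) (auto intro: shift_isomorphic)

lemma tri_shift_power:
  "tri D x y z f g h \<Longrightarrow> \<exists>f' g' h'. tri D ((\<Sigma> ^^ i) x) ((\<Sigma> ^^ i) y) ((\<Sigma> ^^ i) z) f' g' h'"
  by (induction i) (use tri_shift in \<open>auto, blast\<close>)

lemma tri_replace_middle:
  assumes t: "tri D x y z f g h" and i: "isomorphic D y y'"
  shows "\<exists>f' g' h'. tri D x y' z f' g' h'"
proof -
  obtain e where e: "is_iso D y y' e" "y \<in> Ob D" "y' \<in> Ob D" using i by (auto simp: isomorphic_def)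
  obtain e' where e': "arr y y' e" "arr y' y e'" "e' \<cdot> e = ident D y" using is_isoE[OF e] by metis
  note T = tri_arr[OF t]
  have ob: "x \<in> Ob D" "z \<in> Ob D" using T by (auto simp: arr_def)
  have "tri D x y' z (e \<cdot> f) (g \<cdot> e') h"
    by (rule tri_iso[OF t _ _ _ is_iso_ident[OF ob(1)] e(1) is_iso_ident[OF ob(2)]])
      (use T e' ob in \<open>auto simp: paths shift_ident\<close>)
  then show ?thesis by blast
qed

lemma isomorphic_zero_object: "zero_object D z \<Longrightarrow> isomorphic D z z' \<Longrightarrow> zero_object D z'"
proof -
  assume z: "zero_object D z" and "isomorphic D z z'"
  then obtain a where a: "is_iso D z z' a" "z \<in> Ob D" "z' \<in> Ob D" by (auto simp: isomorphic_def)
  obtain b where b: "arr z z' a" "arr z' z b" "a \<cdot> b = ident D z'" using is_isoE[OF a] by metis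
  have "a = 0" using arr_zero_object(1)[OF z b(1)] .
  then show ?thesis using b(3) comp_zero_left[OF b(2) a(3)] a(3) by (simp add: zero_object_iff)
qed

end

locale orthogonal_collection = triangulated_category D
  for D :: "('k::field, 'o, 'm::ab_group_add, 'z) tri_cat_scheme" (structure) +
  fixes S :: "'o set"
  assumes S_Ob: "t \<in> S \<Longrightarrow> t \<in> Ob D"
    and S_iso: "\<lbrakk>t \<in> S; t' \<in> S; arr t t' f; f \<noteq> 0\<rbrakk> \<Longrightarrow> is_iso D t t' f"
begin

abbreviation F :: "'o set" where "F \<equiv> ext_closure D S"

text \<open>
  Filtrations with factors in \<open>S\<close> that split off the first factor: for this bracketing, closure under
  extensions is a direct application of the octahedral axiom.
\<close>
fun filt :: "nat \<Rightarrow> 'o set" where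
  "filt 0 = {z. zero_object D z}"
| "filt (Suc n) = ext_prod D S (filt n)"

lemma filt_SucE:
  assumes "s \<in> filt (Suc n)"
  obtains t s' i p q where "t \<in> S" "s' \<in> filt n" "tri D t s s' i p q"
  using assms by (auto simp: ext_prod_def)

lemma filt_SucI: "t \<in> S \<Longrightarrow> s' \<in> filt n \<Longrightarrow> tri D t s s' i p q \<Longrightarrow> s \<in> filt (Suc n)"
  unfolding filt.simps ext_prod_def by blast

lemma filt_iso: "s \<in> filt n \<Longrightarrow> isomorphic D s s' \<Longrightarrow> s' \<in> filt n"
proof (cases n)
  case 0 then show "s \<in> filt n \<Longrightarrow> isomorphic D s s' \<Longrightarrow> s' \<in> filt n"
    using isomorphic_zero_object by auto
next
  case (Suc m)
  assume s: "s \<in> filt n" "isomorphic D s s'"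
  obtain t r i p q where t: "t \<in> S" "r \<in> filt m" "tri D t s r i p q" using filt_SucE s(1) Suc by blast
  then show ?thesis using tri_replace_middle[OF t(3) s(2)] filt_SucI Suc by blast
qed

lemma filt_Ob: "s \<in> filt n \<Longrightarrow> s \<in> Ob D"
  by (cases n) (auto simp: zero_object_def ext_prod_def dest: tri_arr intro: arrD)

text \<open>
  If the first factor \<open>t\<close> of \<open>x\<close> is divided out of \<open>d\<close>, the octahedral axiom exhibits the quotient as an
  extension of the rest of \<open>x\<close> and \<open>y\<close>.
\<close>
lemma filt_ext: "x \<in> filt n \<Longrightarrow> y \<in> filt m \<Longrightarrow> tri D x d y f g h \<Longrightarrow> d \<in> filt (n + m)"
proof (induction n arbitrary: x d f g h)
  case 0
  have "is_iso D d y g" using tri_zero_first[OF 0(3)] 0(1) by simp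
  then have "isomorphic D d y" using tri_arr[OF 0(3)] by (auto simp: isomorphic_def arr_def)
  then show ?case using filt_iso[OF 0(2) isomorphic_sym] by simp
next
  case (Suc n)
  obtain t x' i p q where t: "t \<in> S" "x' \<in> filt n" "tri D t x x' i p q" using filt_SucE[OF Suc(2)] .
  have "arr t d (f \<cdot> i)" using arr_comp tri_arr[OF t(3)] tri_arr[OF Suc(4)] by blast
  then obtain c l m' where c: "tri D t d c (f \<cdot> i) l m'" using ex_tri arrD by blast
  obtain A B K where "tri D x' c y A B K" using octahedral[OF t(3) Suc(4) c] by blast
  then have "c \<in> filt (n + m)" using Suc.IH[OF t(2) Suc(3)] by blast
  then show ?case using filt_SucI[OF t(1) _ c] by simp
qed

lemma S_filt: assumes t: "t \<in> S" shows "t \<in> filt (Suc 0)"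
proof -
  obtain z where z: "zero_object D z" using ex_zero_object by blast
  show ?thesis by (rule filt_SucI[OF t _ tri_ident[OF S_Ob[OF t] z]]) (use z in simp)
qed

lemma filt_extension_closed: "extension_closed D (\<Union>n. filt n)"
proof -
  have "ext_prod D (\<Union>n. filt n) (\<Union>n. filt n) = (\<Union>n. filt n)"
  proof
    show "ext_prod D (\<Union>n. filt n) (\<Union>n. filt n) \<subseteq> (\<Union>n. filt n)"
      using filt_ext by (fastforce simp: ext_prod_def)
    show "(\<Union>n. filt n) \<subseteq> ext_prod D (\<Union>n. filt n) (\<Union>n. filt n)"
    proof
      fix d assume d: "d \<in> (\<Union>n. filt n)"
      obtain z where z: "zero_object D z" using ex_zero_object by blast
      then have "z \<in> filt 0" by simp
      moreover have "tri D d d z (ident D d) 0 0" using tri_ident z d filt_Ob by blast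
      ultimately show "d \<in> ext_prod D (\<Union>n. filt n) (\<Union>n. filt n)" using d unfolding ext_prod_def by blast
    qed
  qed
  moreover have "iso_closure D (\<Union>n. filt n) = (\<Union>n. filt n)"
    using filt_iso isomorphic_sym isomorphic_refl filt_Ob by (fastforce simp: iso_closure_def)
  moreover have "z \<in> (\<Union>n. filt n)" if "zero_object D z" for z
    using that by (intro UN_I[of 0]) auto
  ultimately show ?thesis using filt_Ob by (auto simp: extension_closed_def)
qed

lemma ext_closure_filt: "F = (\<Union>n. filt n)"
proof
  show "F \<subseteq> (\<Union>n. filt n)" unfolding ext_closure_def
    using filt_extension_closed S_filt by (intro Inter_lower) blast
  have "filt n \<subseteq> Y" if "extension_closed D Y" "S \<subseteq> Y" for n Y
  proof (induction n)
    case 0 then show ?case using that by (auto simp: extension_closed_def)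
  next
    case (Suc n)
    have "filt (Suc n) \<subseteq> ext_prod D Y Y" using Suc that(2) unfolding filt.simps ext_prod_def by blast
    then show ?case using that(1) by (simp add: extension_closed_def)
  qed
  then show "(\<Union>n. filt n) \<subseteq> F" unfolding ext_closure_def by blast
qed

lemma F_Ob: "x \<in> F \<Longrightarrow> x \<in> Ob D"
  using filt_Ob by (auto simp: ext_closure_filt)

lemma S_F: "t \<in> S \<Longrightarrow> t \<in> F"
  using S_filt unfolding ext_closure_filt by blast

lemma F_ext: "x \<in> F \<Longrightarrow> y \<in> F \<Longrightarrow> tri D x d y f g h \<Longrightarrow> d \<in> F"
  using filt_ext[of x _ y _ d f g h] by (auto simp: ext_closure_filt)

lemma F_nohom_left:
  assumes n: "\<And>t. t \<in> S \<Longrightarrow> nohom ((\<Sigma> ^^ i) t) q" and x: "x \<in> F"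
  shows "nohom ((\<Sigma> ^^ i) x) q"
proof -
  have "nohom ((\<Sigma> ^^ i) x) q" if "x \<in> filt n" for n x using that
  proof (induction n arbitrary: x)
    case 0
    then have "zero_object D ((\<Sigma> ^^ i) x)" using shift_power_zero_object by simp
    then show ?case using arr_zero_object(1) unfolding nohom_def by blast
  next
    case (Suc m)
    obtain t s f g h where t: "t \<in> S" "s \<in> filt m" "tri D t x s f g h" using filt_SucE[OF Suc(2)] .
    show ?case using tri_shift_power[OF t(3)] nohom_middle_left n[OF t(1)] Suc.IH[OF t(2)] by blast
  qed
  then show ?thesis using x by (auto simp: ext_closure_filt)
qed

lemma F_nohom_right:
  assumes n: "\<And>t. t \<in> S \<Longrightarrow> nohom q ((\<Sigma> ^^ i) t)" and x: "x \<in> F"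
  shows "nohom q ((\<Sigma> ^^ i) x)"
proof -
  have "nohom q ((\<Sigma> ^^ i) x)" if "x \<in> filt n" for n x using that
  proof (induction n arbitrary: x)
    case 0
    then have "zero_object D ((\<Sigma> ^^ i) x)" using shift_power_zero_object by simp
    then show ?case using arr_zero_object(2) unfolding nohom_def by blast
  next
    case (Suc m)
    obtain t s f g h where t: "t \<in> S" "s \<in> filt m" "tri D t x s f g h" using filt_SucE[OF Suc(2)] .
    show ?case using tri_shift_power[OF t(3)] nohom_middle_right n[OF t(1)] Suc.IH[OF t(2)] by blast
  qed
  then show ?thesis using x by (auto simp: ext_closure_filt)
qed

text \<open>
  Let \<open>t1\<close> be the first factor of \<open>s\<close> and \<open>s'\<close> the quotient. If \<open>u\<close> vanishes in \<open>s'\<close>, it factors through \<open>t1\<close>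
  by an isomorphism and its cone is \<open>s'\<close>. Otherwise the cone of \<open>t \<rightarrow> s'\<close> is shorter by induction, and the
  cone of \<open>u\<close> is an extension of it by \<open>t1\<close>.
\<close>
lemma cone_of_simple:
  assumes "s \<in> filt (Suc n)" "t \<in> S" "arr t s u" "u \<noteq> 0"
  shows "\<exists>c\<in>filt n. \<exists>p q. tri D t s c u p q"
  using assms
proof (induction n arbitrary: s u rule: less_induct)
  case (less n)
  note t = \<open>t \<in> S\<close> and u = \<open>arr t s u\<close> \<open>u \<noteq> 0\<close>
  obtain t1 s' i p q where d: "t1 \<in> S" "s' \<in> filt n" "tri D t1 s s' i p q" using filt_SucE[OF less(2)] .
  note T = tri_arr[OF d(3)]
  have ob: "t1 \<in> Ob D" "t \<in> Ob D" "s \<in> Ob D" "s' \<in> Ob D" using T u by (auto simp: arr_def)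
  show ?case
  proof (cases "p \<cdot> u = 0")
    case True
    obtain v where v: "arr t t1 v" "u = i \<cdot> v" using weak_kernel[OF d(3) u(1) True] by blast
    have "v \<noteq> 0" using v(2) u(2) comp_zero_right[OF T(1) ob(2)] by auto
    then have "is_iso D t t1 v" using S_iso[OF t d(1) v(1)] by blast
    then obtain v' where v': "arr t1 t v'" "v' \<cdot> v = ident D t" "v \<cdot> v' = ident D t1" "is_iso D t1 t v'"
      using is_isoE ob by metis
    have "tri D t s s' u p (\<Sigma>m t1 t v' \<cdot> q)"
      by (rule tri_iso[OF d(3) u(1) T(2) _ v'(4) is_iso_ident[OF ob(3)] is_iso_ident[OF ob(4)]])
        (use T v(1) v'(1) shift_arr[OF v'(1)] in \<open>auto simp: paths v(2) v'(3)\<close>)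
    then show ?thesis using d(2) by blast
  next
    case False
    have pu: "arr t s' (p \<cdot> u)" using arr_comp[OF T(2) u(1)] .
    have "n \<noteq> 0" using d(2) arr_zero_object(2)[OF _ pu] False by (cases n) auto
    then obtain m where m: "n = Suc m" using not0_implies_Suc by blast
    obtain c' p' q' where c': "c' \<in> filt m" "tri D t s' c' (p \<cdot> u) p' q'"
      using less(1)[of m s' "p \<cdot> u"] d(2) t pu False m by auto
    obtain c g h where c: "tri D t s c u g h" using ex_tri[OF arrD[OF u(1)]] by blast
    obtain A B K where "tri D c c' (\<Sigma> t1) A B K" using octahedral[OF c tri_rot[OF d(3)] c'(2)] by blast
    then have "c \<in> filt n" using tri_unrot_ex[OF _ ob(1)] filt_SucI[OF d(1) c'(1)] m by blast
    then show ?thesis using c by blast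
  qed
qed

text \<open>
  If \<open>f\<close> vanishes on the first factor \<open>t1\<close>, it factors through the quotient \<open>s'\<close>, and its cocone is an
  extension of a shorter cocone by \<open>t1\<close>. Otherwise \<open>f\<close> is an isomorphism on \<open>t1\<close>; the octahedral axiom for
  \<open>t1 \<rightarrow> s \<rightarrow> t\<close> has a zero cone and identifies the cocone of \<open>f\<close> with \<open>s'\<close>.
\<close>
lemma cocone_of_simple:
  assumes "s \<in> filt (Suc n)" "t \<in> S" "arr s t f" "f \<noteq> 0"
  shows "\<exists>k\<in>filt n. \<exists>a d. tri D k s t a f d"
  using assms
proof (induction n arbitrary: s f rule: less_induct)
  case (less n)
  note t = \<open>t \<in> S\<close> and f = \<open>arr s t f\<close> \<open>f \<noteq> 0\<close>
  obtain t1 s' i p q where d: "t1 \<in> S" "s' \<in> filt n" "tri D t1 s s' i p q" using filt_SucE[OF less(2)] .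
  note T = tri_arr[OF d(3)]
  have ob: "t1 \<in> Ob D" "t \<in> Ob D" "s \<in> Ob D" "s' \<in> Ob D" using T f by (auto simp: arr_def)
  obtain k a b where k: "tri D k s t a f b" using ex_tri_second[OF f(1)] by blast
  have kob: "k \<in> Ob D" using tri_arr[OF k] by (simp add: arr_def)
  have "k \<in> filt n"
  proof (cases "f \<cdot> i = 0")
    case True
    obtain f' where f': "arr s' t f'" "f = f' \<cdot> p" using weak_cokernel[OF d(3) f(1) True] by blast
    have nz: "f' \<noteq> 0" using f'(2) f(2) comp_zero_left[OF T(2) ob(2)] by auto
    have "n \<noteq> 0" using d(2) arr_zero_object(1)[OF _ f'(1)] nz by (cases n) auto
    then obtain m where m: "n = Suc m" using not0_implies_Suc by blast
    obtain k' a' b' where k': "k' \<in> filt m" "tri D k' s' t a' f' b'"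
      using less(1)[of m s' f'] d(2) t f'(1) nz m by auto
    obtain A B K where "tri D (\<Sigma> t1) (\<Sigma> k) (\<Sigma> k') A B K"
      using octahedral[OF tri_rot[OF d(3)] tri_rot[OF k'(2)] tri_rot[OF k, unfolded f'(2)]] by blast
    from tri_unshift[OF this ob(1) kob filt_Ob[OF k'(1)]]
    show ?thesis using filt_SucI[OF d(1) k'(1)] m by blast
  next
    case False
    have fi: "arr t1 t (f \<cdot> i)" using arr_comp[OF f(1) T(1)] .
    have iso: "is_iso D t1 t (f \<cdot> i)" using S_iso[OF d(1) t fi False] .
    obtain o' where o': "zero_object D o'" using ex_zero_object by blast
    have oob: "o' \<in> Ob D" using zero_object_Ob[OF o'] .
    have "tri D t1 t o' (f \<cdot> i) 0 0"
    proof (rule tri_iso[OF tri_ident[OF ob(1) o'] fi arr_zero[OF ob(2) oob] arr_zero[OF oob shift_Ob[OF ob(1)]]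
          is_iso_ident[OF ob(1)] iso is_iso_ident[OF oob]])
      show "f \<cdot> i \<cdot> ident D t1 = f \<cdot> i \<cdot> ident D t1" ..
      show "ident D o' \<cdot> 0 = 0 \<cdot> (f \<cdot> i)"
        using comp_zero_left[OF fi oob] comp_zero_right[OF arr_ident[OF oob] ob(1)] by simp
      show "\<Sigma>m t1 t1 (ident D t1) \<cdot> 0 = 0 \<cdot> ident D o'"
        using comp_zero_left[OF arr_ident[OF oob] shift_Ob[OF ob(1)]]
          comp_zero_right[OF shift_arr[OF arr_ident[OF ob(1)]] oob] by simp
    qed
    then obtain A B K where "tri D s' o' (\<Sigma> k) A B K" using octahedral[OF d(3) tri_rot[OF k]] by blast
    from tri_zero_first[OF tri_rot[OF this] o'] have "isomorphic D (\<Sigma> k) (\<Sigma> s')"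
      using kob ob shift_Ob by (auto simp: isomorphic_def)
    then show ?thesis using shift_reflects_isomorphic[OF kob ob(4)] filt_iso[OF d(2) isomorphic_sym] by blast
  qed
  then show ?case using k by blast
qed

section \<open>Minimal approximations\<close>

abbreviation right_approx :: "'o \<Rightarrow> 'o \<Rightarrow> 'm \<Rightarrow> bool" where
  "right_approx s d f \<equiv> right_approximation D F s d f"

abbreviation left_approx :: "'o \<Rightarrow> 'o \<Rightarrow> 'm \<Rightarrow> bool" where
  "left_approx d s f \<equiv> left_approximation D F d s f"

lemma right_approx_arr: "d \<in> Ob D \<Longrightarrow> right_approx s d f \<Longrightarrow> arr s d f"
  using F_Ob by (auto simp: right_approximation_def arr_def)

lemma left_approx_arr: "d \<in> Ob D \<Longrightarrow> left_approx d s f \<Longrightarrow> arr d s f"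
  using F_Ob by (auto simp: left_approximation_def arr_def)

lemma right_approx_ex:
  assumes "right_approx s d f" "x \<in> F" "arr x d g"
  shows "\<exists>k. arr x s k \<and> g = f \<cdot> k"
  using assms F_Ob unfolding right_approximation_def arr_def by blast

lemma left_approx_ex:
  assumes "left_approx d s f" "x \<in> F" "arr d x g"
  shows "\<exists>k. arr s x k \<and> g = k \<cdot> f"
  using assms F_Ob unfolding left_approximation_def arr_def by blast

lemma filt_F: "s \<in> filt n \<Longrightarrow> s \<in> F"
  by (auto simp: ext_closure_filt)

text \<open>
  An approximation that kills a nonzero \<open>u\<close> out of an object of \<open>S\<close> factors through the cone of \<open>u\<close>, which
  is again in \<open>F\<close> and shorter.
\<close>
lemma right_approx_shorten:
  assumes d: "d \<in> Ob D" and f: "right_approx s d f" and s: "s \<in> filt n"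
    and t: "t \<in> S" and u: "arr t s u" "u \<noteq> 0" "f \<cdot> u = 0"
  shows "\<exists>c p f' m. m < n \<and> c \<in> filt m \<and> right_approx c d f' \<and> arr s c p \<and> arr c d f' \<and> f' \<cdot> p = f \<and> p \<cdot> u = 0"
proof -
  have fa: "arr s d f" using right_approx_arr[OF d f] .
  have "n \<noteq> 0" using s u arr_zero_object(2)[OF _ u(1)] by (cases n) auto
  then obtain m where m: "n = Suc m" using not0_implies_Suc by blast
  obtain c p q where c: "c \<in> filt m" "tri D t s c u p q" using cone_of_simple[OF s[unfolded m] t u(1,2)] by blast
  note T = tri_arr[OF c(2)]
  obtain f' where f': "arr c d f'" "f = f' \<cdot> p" using weak_cokernel[OF c(2) fa u(3)] by blast
  have "right_approx c d f'" unfolding right_approximation_def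
  proof (intro conjI ballI)
    show "c \<in> F" using filt_F[OF c(1)] .
    show "f' \<in> Hom D c d" using f' arrD by blast
    fix x g assume x: "x \<in> F" and g: "g \<in> Hom D x d"
    obtain k where k: "arr x s k" "g = f \<cdot> k" using right_approx_ex[OF f x arrI[OF F_Ob[OF x] d g]] by blast
    have "g = f' \<cdot> (p \<cdot> k)" using T f' k(1) by (simp add: paths k(2))
    then show "\<exists>k\<in>Hom D x c. g = f' \<cdot> k" using arrD(3)[OF arr_comp[OF T(2) k(1)]] by blast
  qed
  then show ?thesis using c(1) m f' T(2) tri_comp_zero(1)[OF c(2)] by blast
qed

lemma left_approx_shorten:
  assumes d: "d \<in> Ob D" and f: "left_approx d s f" and s: "s \<in> filt n"
    and t: "t \<in> S" and u: "arr s t u" "u \<noteq> 0" "u \<cdot> f = 0"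
  shows "\<exists>c p f' m. m < n \<and> c \<in> filt m \<and> left_approx d c f' \<and> arr c s p \<and> arr d c f' \<and> p \<cdot> f' = f \<and> u \<cdot> p = 0"
proof -
  have fa: "arr d s f" using left_approx_arr[OF d f] .
  have "n \<noteq> 0" using s u arr_zero_object(1)[OF _ u(1)] by (cases n) auto
  then obtain m where m: "n = Suc m" using not0_implies_Suc by blast
  obtain c p q where c: "c \<in> filt m" "tri D c s t p u q" using cocone_of_simple[OF s[unfolded m] t u(1,2)] by blast
  note T = tri_arr[OF c(2)]
  obtain f' where f': "arr d c f'" "f = p \<cdot> f'" using weak_kernel[OF c(2) fa u(3)] by blast
  have "left_approx d c f'" unfolding left_approximation_def
  proof (intro conjI ballI)
    show "c \<in> F" using filt_F[OF c(1)] .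
    show "f' \<in> Hom D d c" using f' arrD by blast
    fix x g assume x: "x \<in> F" and g: "g \<in> Hom D d x"
    obtain k where k: "arr s x k" "g = k \<cdot> f" using left_approx_ex[OF f x arrI[OF d F_Ob[OF x] g]] by blast
    have "g = (k \<cdot> p) \<cdot> f'" using T f' k(1) by (simp add: paths k(2))
    then show "\<exists>k\<in>Hom D c x. g = k \<cdot> f'" using arrD(3)[OF arr_comp[OF k(1) T(1)]] by blast
  qed
  then show ?thesis using c(1) m f' T(1) tri_comp_zero(1)[OF c(2)] by blast
qed

text \<open>
  A lift along \<open>g\<close> is constructed factor by factor: \<open>v - g \<cdot> v\<close> vanishes on the first factor of \<open>x\<close>, hence
  comes from the quotient, where it can be lifted.
\<close>
lemma lift_along_endo:
  assumes g: "arr s s g" and fixed: "\<And>t u. t \<in> S \<Longrightarrow> arr t s u \<Longrightarrow> g \<cdot> u = u"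
  shows "x \<in> filt n \<Longrightarrow> arr x s v \<Longrightarrow> \<exists>v'. arr x s v' \<and> g \<cdot> v' = v"
proof (induction n arbitrary: x v)
  case 0
  then have "v = 0" using arr_zero_object(1) by simp
  then show ?case using comp_zero_right[OF g arrD(1)[OF 0(2)]] 0(2) by blast
next
  case (Suc n)
  note v = Suc(3)
  obtain t x' i p q where d: "t \<in> S" "x' \<in> filt n" "tri D t x x' i p q" using filt_SucE[OF Suc(2)] .
  note T = tri_arr[OF d(3)]
  have gv: "arr x s (g \<cdot> v)" "arr x s (v - g \<cdot> v)" using g v by (simp_all add: paths arr_diff)
  have "(v - g \<cdot> v) \<cdot> i = 0"
    using comp_diff_left[OF T(1) v gv(1)] fixed[OF d(1) arr_comp[OF v T(1)]] g v T by (simp add: paths)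
  then obtain w where w: "arr x' s w" "v - g \<cdot> v = w \<cdot> p" using weak_cokernel[OF d(3) gv(2)] by blast
  obtain w' where w': "arr x' s w'" "g \<cdot> w' = w" using Suc.IH[OF d(2) w(1)] by blast
  have wp: "arr x s (w' \<cdot> p)" using w'(1) T by (simp add: paths)
  have "g \<cdot> (v + w' \<cdot> p) = v"
    using comp_add_right[OF v wp g] w(2) w'(1) g T by (simp add: comp_reduce[OF w'(2)] paths algebra_simps)
  then show ?case using arr_add[OF v wp] by blast
qed

text \<open>
  Take an approximation \<open>f\<close> of least length and \<open>g\<close> with \<open>f \<cdot> g = f\<close>. For \<open>u: t \<rightarrow> s\<close> with \<open>t \<in> S\<close> the
  difference \<open>u - g \<cdot> u\<close> is killed by \<open>f\<close>, hence zero. So \<open>g\<close> fixes all such \<open>u\<close> and has a right inverse, to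
  which the same argument applies.
\<close>
lemma ex_minimal_right_approx:
  assumes d: "d \<in> Ob D" and ex: "right_approx s0 d f0"
  shows "\<exists>s f. right_approx s d f \<and> right_minimal D s f"
proof -
  define P where "P n \<longleftrightarrow> (\<exists>s\<in>filt n. \<exists>f. right_approx s d f)" for n
  have "\<exists>n. P n" using ex unfolding P_def right_approximation_def ext_closure_filt by blast
  define n where "n = (LEAST n. P n)"
  have "P n" unfolding n_def by (rule LeastI_ex) fact
  then obtain s f where s: "s \<in> filt n" and f: "right_approx s d f" unfolding P_def by blast
  have fa: "arr s d f" using right_approx_arr[OF d f] .
  have inv: "\<exists>g'. arr s s g' \<and> g \<cdot> g' = ident D s \<and> f \<cdot> g' = f" if g: "arr s s g" "f \<cdot> g = f" for g
  proof -
    have fixed: "g \<cdot> u = u" if t: "t \<in> S" and u: "arr t s u" for t u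
    proof (rule ccontr)
      assume ne: "g \<cdot> u \<noteq> u"
      have gu: "arr t s (g \<cdot> u)" "arr t s (u - g \<cdot> u)" using g(1) u by (simp_all add: paths arr_diff)
      have "f \<cdot> (u - g \<cdot> u) = 0"
        using comp_diff_right[OF u gu(1) fa] g(1) u fa by (simp add: comp_reduce[OF g(2)] paths)
      then obtain c f' m where "m < n" "c \<in> filt m" "right_approx c d f'"
        using right_approx_shorten[OF d f s t gu(2)] ne by auto
      then show False using not_less_Least[of m P] unfolding P_def n_def by blast
    qed
    obtain g' where g': "arr s s g'" "g \<cdot> g' = ident D s"
      using lift_along_endo[OF g(1) _ s arr_ident[OF filt_Ob[OF s]]] fixed by blast
    have "f \<cdot> g' = f \<cdot> (g \<cdot> g')" using g g'(1) fa by (simp add: comp_reduce[OF g(2)] paths)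
    then have "f \<cdot> g' = f" using fa by (simp add: g'(2) paths)
    with g' show ?thesis by blast
  qed
  have "right_minimal D s f" unfolding right_minimal_def
  proof (intro ballI impI)
    fix g assume "g \<in> Hom D s s" and e: "f \<cdot> g = f"
    then have g: "arr s s g" using filt_Ob[OF s] by (simp add: arr_def)
    obtain g' where g': "arr s s g'" "g \<cdot> g' = ident D s" "f \<cdot> g' = f" using inv[OF g e] by blast
    obtain g'' where "arr s s g''" "g' \<cdot> g'' = ident D s" using inv[OF g'(1,3)] by blast
    then show "is_iso D s s g" using is_iso_if_inverses[OF g g'(1) _ g'(2)] by blast
  qed
  with f show ?thesis by blast
qed

text \<open>
  The counterpart of \<open>lift_along_endo\<close> for left approximations. As filtrations split off their first
  factor, the induction is phrased with \<open>c\<close>: if \<open>v \<cdot> (1 - c \<cdot> g)\<close> takes values in the first factor, multiplying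
  it with \<open>1 - g\<close> gives zero, and \<open>(1 - c \<cdot> g) \<cdot> (1 - g) = 1 - (1 + c - c \<cdot> g) \<cdot> g\<close>.
\<close>
lemma factor_through_endo:
  assumes g: "arr s s g" and fixed: "\<And>t u. t \<in> S \<Longrightarrow> arr s t u \<Longrightarrow> u \<cdot> g = u"
  shows "x \<in> filt n \<Longrightarrow> arr s x v \<Longrightarrow> \<exists>c. arr s s c \<and> v \<cdot> (c \<cdot> g) = v"
proof (induction n arbitrary: x v)
  case 0
  then have "v = 0" using arr_zero_object(2) by simp
  then show ?case using comp_zero_left[OF arr_comp[OF g g] arrD(2)[OF 0(2)]] g by blast
next
  case (Suc n)
  note v = Suc(3)
  obtain t x' i p q where d: "t \<in> S" "x' \<in> filt n" "tri D t x x' i p q" using filt_SucE[OF Suc(2)] .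
  note T = tri_arr[OF d(3)]
  have s: "s \<in> Ob D" using g by (simp add: arr_def)
  obtain c where c: "arr s s c" "(p \<cdot> v) \<cdot> (c \<cdot> g) = p \<cdot> v" using Suc.IH[OF d(2) arr_comp[OF T(2) v]] by blast
  have cg: "arr s s (c \<cdot> g)" "arr s s (c \<cdot> (g \<cdot> g))" "arr s s (ident D s)" "arr s s (ident D s + c)"
    "arr s s (ident D s + c - c \<cdot> g)"
    using c(1) g s by (simp_all add: paths arr_add arr_diff)
  have vcg: "arr s x (v \<cdot> (c \<cdot> g))" "arr s x (v - v \<cdot> (c \<cdot> g))" using v cg(1) by (simp_all add: paths arr_diff)
  have "p \<cdot> (v - v \<cdot> (c \<cdot> g)) = 0"
    using comp_diff_right[OF v vcg(1) T(2)] c v g T by (simp add: paths)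
  then obtain w where w: "arr s t w" "v - v \<cdot> (c \<cdot> g) = i \<cdot> w" using weak_kernel[OF d(3) vcg(2)] by blast
  have "(v - v \<cdot> (c \<cdot> g)) \<cdot> g = v - v \<cdot> (c \<cdot> g)"
    using fixed[OF d(1) w(1)] w(1) g T by (simp add: w(2) paths)
  then have e: "v \<cdot> g - v \<cdot> (c \<cdot> (g \<cdot> g)) = v - v \<cdot> (c \<cdot> g)"
    using comp_diff_left[OF g v vcg(1)] v c(1) g by (simp add: paths)
  have "(ident D s + c - c \<cdot> g) \<cdot> g = g + c \<cdot> g - c \<cdot> (g \<cdot> g)"
    using comp_diff_left[OF g cg(4,1)] comp_add_left[OF g cg(3) c(1)] c(1) g by (simp add: paths)
  then have "v \<cdot> ((ident D s + c - c \<cdot> g) \<cdot> g) = v \<cdot> g + v \<cdot> (c \<cdot> g) - v \<cdot> (c \<cdot> (g \<cdot> g))"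
    using comp_diff_right[OF arr_add[OF g cg(1)] cg(2) v] comp_add_right[OF g cg(1) v] by simp
  also have "\<dots> = v" using e by (simp add: algebra_simps)
  finally show ?case using cg(5) by blast
qed

lemma ex_minimal_left_approx:
  assumes d: "d \<in> Ob D" and ex: "left_approx d s0 f0"
  shows "\<exists>s f. left_approx d s f \<and> (\<forall>g. arr s s g \<longrightarrow> g \<cdot> f = f \<longrightarrow> is_iso D s s g)"
proof -
  define P where "P n \<longleftrightarrow> (\<exists>s\<in>filt n. \<exists>f. left_approx d s f)" for n
  have "\<exists>n. P n" using ex unfolding P_def left_approximation_def ext_closure_filt by blast
  define n where "n = (LEAST n. P n)"
  have "P n" unfolding n_def by (rule LeastI_ex) fact
  then obtain s f where s: "s \<in> filt n" and f: "left_approx d s f" unfolding P_def by blast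
  have fa: "arr d s f" using left_approx_arr[OF d f] .
  have inv: "\<exists>g'. arr s s g' \<and> g' \<cdot> g = ident D s \<and> g' \<cdot> f = f" if g: "arr s s g" "g \<cdot> f = f" for g
  proof -
    have fixed: "u \<cdot> g = u" if t: "t \<in> S" and u: "arr s t u" for t u
    proof (rule ccontr)
      assume ne: "u \<cdot> g \<noteq> u"
      have gu: "arr s t (u \<cdot> g)" "arr s t (u - u \<cdot> g)" using g(1) u by (simp_all add: paths arr_diff)
      have "(u - u \<cdot> g) \<cdot> f = 0"
        using comp_diff_left[OF fa u gu(1)] g u fa by (simp add: paths)
      then obtain c f' m where "m < n" "c \<in> filt m" "left_approx d c f'"
        using left_approx_shorten[OF d f s t gu(2)] ne by auto
      then show False using not_less_Least[of m P] unfolding P_def n_def by blast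
    qed
    have i: "arr s s (ident D s)" using arr_ident[OF filt_Ob[OF s]] .
    obtain g' where g': "arr s s g'" "ident D s \<cdot> (g' \<cdot> g) = ident D s"
      using factor_through_endo[OF g(1) _ s i] fixed by blast
    have gg: "g' \<cdot> g = ident D s" using g'(2) comp_ident_left[OF arr_comp[OF g'(1) g(1)]] by simp
    have "g' \<cdot> (g \<cdot> f) = f" using g(1) g'(1) fa by (simp add: comp_reduce[OF gg] paths)
    with g' gg g(2) show ?thesis by auto
  qed
  have "is_iso D s s g" if g: "arr s s g" and e: "g \<cdot> f = f" for g
  proof -
    obtain g' where g': "arr s s g'" "g' \<cdot> g = ident D s" "g' \<cdot> f = f" using inv[OF g e] by blast
    obtain g'' where g'': "arr s s g''" "g'' \<cdot> g' = ident D s" using inv[OF g'(1,3)] by blast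
    have "g'' = g'' \<cdot> (g' \<cdot> g)" using g''(1) by (simp add: g'(2) paths)
    also have "\<dots> = g" using g''(1) g'(1) g by (simp add: comp_reduce[OF g''(2)] paths)
    finally show ?thesis using is_isoI[OF g g'(1)] g'(2) g''(2) by blast
  qed
  with f show ?thesis by blast
qed

text \<open>
  If \<open>u\<close> were nonzero, \<open>f\<close> would factor through a shorter approximation \<open>c\<close>, which in turn factors through
  \<open>f\<close>. By minimality the composite \<open>s \<rightarrow> c \<rightarrow> s\<close> is an isomorphism, although it kills \<open>u\<close>.
\<close>
lemma right_minimal_inj:
  assumes d: "d \<in> Ob D" and f: "right_approx s d f" and m: "right_minimal D s f"
    and t: "t \<in> S" and u: "arr t s u" "f \<cdot> u = 0"
  shows "u = 0"
proof (rule ccontr)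
  assume "u \<noteq> 0"
  obtain n where n: "s \<in> filt n" using f by (auto simp: right_approximation_def ext_closure_filt)
  obtain c p f' m' where c: "c \<in> filt m'" "arr s c p" "arr c d f'" "f' \<cdot> p = f" "p \<cdot> u = 0"
    using right_approx_shorten[OF d f n t u(1) \<open>u \<noteq> 0\<close> u(2)] by blast
  obtain k where k: "arr c s k" "f' = f \<cdot> k" using right_approx_ex[OF f filt_F[OF c(1)] c(3)] by blast
  have fa: "arr s d f" using right_approx_arr[OF d f] .
  have kp: "arr s s (k \<cdot> p)" using k(1) c(2) by (simp add: paths)
  have "f \<cdot> (k \<cdot> p) = f" using comp_assoc[OF fa chain_arr[OF k(1) into_arr[OF c(2)]]] c(4) k(2) by simp
  then have "is_iso D s s (k \<cdot> p)" using m kp by (simp add: right_minimal_def arr_def)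
  then obtain e where e: "arr s s e" "e \<cdot> (k \<cdot> p) = ident D s" using is_isoE arrD[OF kp] by metis
  have "u = (e \<cdot> (k \<cdot> p)) \<cdot> u" using u(1) by (simp add: e(2) paths)
  also have "\<dots> = e \<cdot> (k \<cdot> (p \<cdot> u))" using e(1) k(1) c(2) u(1) by (simp add: paths)
  also have "\<dots> = 0"
    using c(5) comp_zero_right[OF k(1) arrD(1)[OF u(1)]] comp_zero_right[OF e(1) arrD(1)[OF u(1)]] by simp
  finally show False using \<open>u \<noteq> 0\<close> by simp
qed

lemma left_minimal_inj:
  assumes d: "d \<in> Ob D" and f: "left_approx d s f" and m: "\<And>g. arr s s g \<Longrightarrow> g \<cdot> f = f \<Longrightarrow> is_iso D s s g"
    and t: "t \<in> S" and u: "arr s t u" "u \<cdot> f = 0"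
  shows "u = 0"
proof (rule ccontr)
  assume "u \<noteq> 0"
  obtain n where n: "s \<in> filt n" using f by (auto simp: left_approximation_def ext_closure_filt)
  obtain c p f' m' where c: "c \<in> filt m'" "arr c s p" "arr d c f'" "p \<cdot> f' = f" "u \<cdot> p = 0"
    using left_approx_shorten[OF d f n t u(1) \<open>u \<noteq> 0\<close> u(2)] by blast
  obtain k where k: "arr s c k" "f' = k \<cdot> f" using left_approx_ex[OF f filt_F[OF c(1)] c(3)] by blast
  have fa: "arr d s f" using left_approx_arr[OF d f] .
  have pk: "arr s s (p \<cdot> k)" using k(1) c(2) by (simp add: paths)
  have "(p \<cdot> k) \<cdot> f = f" using comp_assoc[OF c(2) chain_arr[OF k(1) into_arr[OF fa]]] c(4) k(2) by simp
  from m[OF pk this] obtain e where e: "arr s s e" "(p \<cdot> k) \<cdot> e = ident D s" using is_isoE arrD[OF pk] by metis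
  have "u = u \<cdot> ((p \<cdot> k) \<cdot> e)" using u(1) by (simp add: e(2) paths)
  also have "\<dots> = (u \<cdot> p) \<cdot> (k \<cdot> e)" using e(1) k(1) c(2) u(1) by (simp add: paths)
  also have "\<dots> = 0" using c(5) comp_zero_left[OF arr_comp[OF k(1) e(1)] arrD(2)[OF u(1)]] by simp
  finally show False using \<open>u \<noteq> 0\<close> by simp
qed

text \<open>
  Wakamatsu's lemma. A morphism \<open>u: x \<rightarrow> z\<close> pulls the triangle back to an extension \<open>e\<close> of \<open>x\<close> by \<open>s\<close>, which
  lies in \<open>F\<close>. The map \<open>e \<rightarrow> d\<close> factors through the approximation, and minimality splits the extension.
  Therefore \<open>u\<close> lifts to \<open>d\<close>, and the lift factors through the approximation again.
\<close>
lemma wakamatsu_right: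
  assumes f: "right_approx s d f" and m: "right_minimal D s f" and t: "tri D s d z f b c" and x: "x \<in> F"
  shows "nohom x z"
  unfolding nohom_def
proof (intro allI impI)
  fix u assume u: "arr x z u"
  note T = tri_arr[OF t]
  have ob: "s \<in> Ob D" "d \<in> Ob D" "x \<in> Ob D" "z \<in> Ob D" using T u by (auto simp: arr_def)
  have cu: "arr x (\<Sigma> s) (c \<cdot> u)" using T u by (simp add: paths)
  obtain e i p where e: "tri D s e x i p (c \<cdot> u)" using ex_tri_third[OF cu ob(1)] by blast
  note E = tri_arr[OF e]
  have sF: "s \<in> F" using f by (simp add: right_approximation_def)
  have eF: "e \<in> F" by (rule F_ext[OF sF x e])
  have "c \<cdot> u = \<Sigma>m s s (ident D s) \<cdot> (c \<cdot> u)" using T u ob by (simp add: shift_ident paths)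
  from tri_morphism_outer[OF e t arr_ident[OF ob(1)] u this]
  obtain q where q: "arr e d q" "q \<cdot> i = f" using comp_ident_right[OF T(1)] by auto
  obtain k where k: "arr e s k" "q = f \<cdot> k" using right_approx_ex[OF f eF q(1)] by blast
  have ki: "arr s s (k \<cdot> i)" using k(1) E by (simp add: paths)
  have "f \<cdot> (k \<cdot> i) = f" using comp_assoc[OF T(1) chain_arr[OF k(1) into_arr[OF E(1)]]] q(2) k(2) by simp
  then have "is_iso D s s (k \<cdot> i)" using m ki by (simp add: right_minimal_def arr_def)
  then obtain g where g: "arr s s g" "g \<cdot> (k \<cdot> i) = ident D s" using is_isoE ob(1) by metis
  have gk: "arr e s (g \<cdot> k)" "(g \<cdot> k) \<cdot> i = ident D s" using g k(1) E by (simp_all add: paths)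
  note sgk = shift_arr[OF gk(1)] and si = shift_arr[OF E(1)]
  have 1: "\<Sigma>m e s (g \<cdot> k) \<cdot> \<Sigma>m s e i = ident D (\<Sigma> s)"
    using shift_comp[OF gk(1) E(1)] gk(2) shift_ident[OF ob(1)] by simp
  have "c \<cdot> u = (\<Sigma>m e s (g \<cdot> k) \<cdot> \<Sigma>m s e i) \<cdot> (c \<cdot> u)" using comp_ident_left[OF cu] 1 by simp
  also have "\<dots> = \<Sigma>m e s (g \<cdot> k) \<cdot> (\<Sigma>m s e i \<cdot> (c \<cdot> u))"
    by (rule comp_assoc[OF sgk chain_arr[OF si into_arr[OF cu]]])
  also have "\<dots> = 0" using tri_comp_zero(3)[OF e] comp_zero_right[OF sgk ob(3)] by simp
  finally obtain v where v: "arr x d v" "u = b \<cdot> v" using weak_kernel2[OF t u] by blast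
  obtain w where w: "arr x s w" "v = f \<cdot> w" using right_approx_ex[OF f x v(1)] by blast
  have "u = (b \<cdot> f) \<cdot> w" using T w(1) by (simp add: v(2) w(2) paths)
  then show "u = 0" using tri_comp_zero(1)[OF t] comp_zero_left[OF w(1) ob(4)] by simp
qed

text \<open>
  The dual argument, with the pushout of the triangle along \<open>v\<close>.
\<close>
lemma wakamatsu_left:
  assumes f: "left_approx d s f" and m: "\<And>g. arr s s g \<Longrightarrow> g \<cdot> f = f \<Longrightarrow> is_iso D s s g"
    and t: "tri D y d s k f c" and x: "x \<in> F"
  shows "nohom y x"
  unfolding nohom_def
proof (intro allI impI)
  fix v assume v: "arr y x v"
  note T = tri_arr[OF t]
  have ob: "s \<in> Ob D" "d \<in> Ob D" "x \<in> Ob D" "y \<in> Ob D" using T v by (auto simp: arr_def)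
  have vc: "arr s (\<Sigma> x) (\<Sigma>m y x v \<cdot> c)" using T shift_arr[OF v] by (simp add: paths)
  obtain e i p where e: "tri D x e s i p (\<Sigma>m y x v \<cdot> c)" using ex_tri_third[OF vc ob(3)] by blast
  note E = tri_arr[OF e]
  have sF: "s \<in> F" using f by (simp add: left_approximation_def)
  have eF: "e \<in> F" by (rule F_ext[OF x sF e])
  have "(\<Sigma>m y x v \<cdot> c) \<cdot> ident D s = \<Sigma>m y x v \<cdot> c" using comp_ident_right[OF vc] .
  from tri_morphism_outer[OF t e v arr_ident[OF ob(1)] this]
  obtain q where q: "arr d e q" "p \<cdot> q = f" using comp_ident_left[OF T(2)] by auto
  obtain g where g: "arr s e g" "q = g \<cdot> f" using left_approx_ex[OF f eF q(1)] by blast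
  have pg: "arr s s (p \<cdot> g)" using g(1) E by (simp add: paths)
  have "(p \<cdot> g) \<cdot> f = f" using comp_assoc[OF E(2) chain_arr[OF g(1) into_arr[OF T(2)]]] q(2) g(2) by simp
  from m[OF pg this] obtain h where h: "arr s s h" "(p \<cdot> g) \<cdot> h = ident D s" using is_isoE ob(1) by metis
  have gh: "arr s e (g \<cdot> h)" "p \<cdot> (g \<cdot> h) = ident D s" using h E g(1) by (simp_all add: paths)
  have "\<Sigma>m y x v \<cdot> c = (\<Sigma>m y x v \<cdot> c) \<cdot> (p \<cdot> (g \<cdot> h))" using comp_ident_right[OF vc] gh(2) by simp
  also have "\<dots> = ((\<Sigma>m y x v \<cdot> c) \<cdot> p) \<cdot> (g \<cdot> h)"
    by (rule comp_assoc[symmetric, OF vc chain_arr[OF E(2) into_arr[OF gh(1)]]])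
  also have "\<dots> = 0" using tri_comp_zero(2)[OF e] comp_zero_left[OF gh(1) shift_Ob[OF ob(3)]] by simp
  finally obtain w where w: "arr (\<Sigma> d) (\<Sigma> x) w" "\<Sigma>m y x v = w \<cdot> \<Sigma>m y d k"
    using weak_cokernel3[OF t shift_arr[OF v]] by blast
  obtain w' where w': "arr d x w'" "\<Sigma>m d x w' = w" using shift_full[OF ob(2,3) w(1)] by blast
  have "\<Sigma>m y x v = \<Sigma>m y x (w' \<cdot> k)" using shift_comp[OF w'(1) T(1)] w(2) w'(2) by simp
  then have vw: "v = w' \<cdot> k" using shift_faithful[OF v arr_comp[OF w'(1) T(1)]] by simp
  obtain r where r: "arr s x r" "w' = r \<cdot> f" using left_approx_ex[OF f x w'(1)] by blast
  have "v = r \<cdot> (f \<cdot> k)" using T r(1) by (simp add: vw r(2) paths)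
  then show "v = 0" using tri_comp_zero(1)[OF t] comp_zero_right[OF r(1) ob(4)] by simp
qed

end

section \<open>Simple-minded reduction\<close>

text \<open>
  \<open>Z_right\<close> and \<open>Z_left\<close> are the two one-sided descriptions of \<open>Z\<close> that Serre duality provides: the first
  suits reflections, the second the density of \<open>\<langle>1\<rangle>\<close>.
\<close>
locale simple_minded_reduction = orthogonal_collection D S
  for D :: "('k::field, 'o, 'm::ab_group_add, 'z) tri_cat_scheme" (structure) and S +
  fixes w :: nat and Z :: "'o set" and sh :: "'o \<Rightarrow> 'o" and \<beta> :: "'o \<Rightarrow> 'm"
  assumes w: "1 \<le> w"
    and negative: "\<lbrakk>1 \<le> k; k < w; t \<in> S; t' \<in> S\<rbrakk> \<Longrightarrow> nohom ((\<Sigma> ^^ k) t) t'"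
    and finite_F: "functorially_finite D F"
    and Z_right: "d \<in> Z \<longleftrightarrow> d \<in> Ob D \<and> (\<forall>i\<le>w. \<forall>t\<in>S. nohom ((\<Sigma> ^^ i) t) d)"
    and Z_left: "d \<in> Z \<longleftrightarrow> d \<in> Ob D \<and> (\<forall>i\<le>w. \<forall>t\<in>S. nohom ((\<Sigma> ^^ i) d) t)"
    and sh: "x \<in> Z \<Longrightarrow> \<exists>s a d. approximation_triangle D F s (\<Sigma> x) (sh x) a (\<beta> x) d"
begin

lemma Z_rightD: "d \<in> Z \<Longrightarrow> i \<le> w \<Longrightarrow> t \<in> S \<Longrightarrow> nohom ((\<Sigma> ^^ i) t) d"
  using Z_right by blast

lemma Z_leftD: "d \<in> Z \<Longrightarrow> i \<le> w \<Longrightarrow> t \<in> S \<Longrightarrow> nohom ((\<Sigma> ^^ i) d) t"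
  using Z_left by blast

lemma Z_in_Ob: "d \<in> Z \<Longrightarrow> d \<in> Ob D"
  using Z_right by blast

lemma F_orth: assumes s: "s \<in> F" shows "orth Z s"
proof -
  have "nohom s q \<and> nohom (\<Sigma> s) q \<and> nohom q s \<and> nohom (\<Sigma> q) s" if q: "q \<in> Z" for q
  proof -
    have 1: "nohom ((\<Sigma> ^^ i) t) q" "nohom ((\<Sigma> ^^ i) q) t" if "i \<le> 1" "t \<in> S" for i t
      using Z_rightD[OF q, of i t] Z_leftD[OF q, of i t] w that by auto
    show ?thesis
      using F_nohom_left[of 0 q s] F_nohom_left[of 1 q s] F_nohom_right[of q 0 s] F_nohom_right[of "\<Sigma> q" 0 s]
        1[of 0] 1[of 1] s by simp
  qed
  then show ?thesis unfolding orth_def using F_Ob[OF s] by blast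
qed

text \<open>
  Three reasons make \<open>Hom(\<Sigma>\<^sup>iS, z)\<close> vanish: Wakamatsu's lemma for \<open>i = 0\<close>, the injectivity of
  \<open>Hom(S, s) \<rightarrow> Hom(S, c)\<close> for \<open>i = 1\<close>, and the vanishing of \<open>Hom(\<Sigma>\<^sup>i\<^sup>-\<^sup>1S, s)\<close> for \<open>i \<ge> 2\<close>.
\<close>
lemma approximation_reflection:
  assumes a: "approximation_triangle D F s c z a b d"
    and c: "\<And>i t. 1 \<le> i \<Longrightarrow> i \<le> w \<Longrightarrow> t \<in> S \<Longrightarrow> nohom ((\<Sigma> ^^ i) t) c"
  shows "reflection Z c z b"
proof -
  have f: "right_approx s c a" and m: "right_minimal D s a" and t: "tri D s c z a b d"
    using a by (auto simp: approximation_triangle_def)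
  note T = tri_arr[OF t]
  have ob: "s \<in> Ob D" "c \<in> Ob D" "z \<in> Ob D" using T by (auto simp: arr_def)
  have sF: "s \<in> F" using f by (simp add: right_approximation_def)
  have "nohom ((\<Sigma> ^^ i) t') z" if i: "i \<le> w" and t': "t' \<in> S" for i t'
  proof (cases i)
    case 0 then show ?thesis using wakamatsu_right[OF f m t S_F[OF t']] by simp
  next
    case (Suc j)
    define x where "x = (\<Sigma> ^^ j) t'"
    have x: "x \<in> Ob D" unfolding x_def using shift_power_Ob S_Ob t' by blast
    show ?thesis unfolding nohom_def
    proof (intro allI impI)
      fix u assume "arr ((\<Sigma> ^^ i) t') z u"
      then have u: "arr (\<Sigma> x) z u" by (simp add: x_def Suc)
      have du: "arr (\<Sigma> x) (\<Sigma> s) (d \<cdot> u)" using T u by (simp add: paths)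
      obtain v where v: "arr x s v" "\<Sigma>m x s v = d \<cdot> u" using shift_full[OF x ob(1) du] by blast
      have "v = 0"
      proof (cases "j = 0")
        case True
        have "\<Sigma>m x c (a \<cdot> v) = (\<Sigma>m s c a \<cdot> d) \<cdot> u"
          using shift_comp[OF T(1) v(1)] v(2) shift_arr[OF T(1)] T(3) u by (simp add: paths)
        also have "\<dots> = \<Sigma>m x c 0"
          using tri_comp_zero(3)[OF t] comp_zero_left[OF u shift_Ob[OF ob(2)]] shift_zero[OF x ob(2)] by simp
        finally have "a \<cdot> v = 0"
          using shift_faithful[OF arr_comp[OF T(1) v(1)] arr_zero[OF x ob(2)]] by simp
        moreover have "arr t' s v" using v(1) True by (simp add: x_def)
        ultimately show ?thesis using right_minimal_inj[OF ob(2) f m t'] by blast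
      next
        case False
        have "nohom x ((\<Sigma> ^^ 0) s)" unfolding x_def
          by (rule F_nohom_right[OF _ sF]) (use negative[of j t'] False Suc i t' in auto)
        then show ?thesis using nohomD v(1) by simp
      qed
      then have "d \<cdot> u = 0" using v(2) shift_zero[OF x ob(1)] by simp
      then obtain v' where v': "arr (\<Sigma> x) c v'" "u = b \<cdot> v'" using weak_kernel2[OF t u] by blast
      have "nohom (\<Sigma> x) c" using c[of i t'] i t' by (simp add: x_def Suc)
      then show "u = 0" using nohomD[OF _ v'(1)] v'(2) comp_zero_right[OF T(2) shift_Ob[OF x]] by simp
    qed
  qed
  then have "z \<in> Z" using Z_right ob(3) by blast
  then show ?thesis unfolding reflection_def using F_orth[OF sF] t by blast
qed

lemma shift_nohom_Z:
  assumes x: "x \<in> Z" and i: "1 \<le> i" "i \<le> w" and t: "t \<in> S"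
  shows "nohom ((\<Sigma> ^^ i) t) (\<Sigma> x)"
proof -
  obtain j where j: "i = Suc j" using i(1) by (cases i) auto
  have "nohom ((\<Sigma> ^^ j) t) x" using Z_rightD[OF x, of j t] i(2) t j by simp
  moreover have "x \<in> Ob D" "(\<Sigma> ^^ j) t \<in> Ob D" using Z_in_Ob[OF x] shift_power_Ob S_Ob t by auto
  ultimately show ?thesis using shift_nohom j by simp
qed

lemma ex_approximation_triangle:
  assumes c: "c \<in> Ob D"
  shows "\<exists>s z a b d. approximation_triangle D F s c z a b d"
proof -
  obtain s0 f0 where "right_approx s0 c f0" using finite_F c unfolding functorially_finite_def by blast
  from ex_minimal_right_approx[OF c this] obtain s a where a: "right_approx s c a" "right_minimal D s a" by blast
  then obtain z b d where "tri D s c z a b d" using ex_tri[OF arrD[OF right_approx_arr[OF c a(1)]]] by blast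
  then show ?thesis unfolding approximation_triangle_def using a by blast
qed

text \<open>
  Dual to \<open>approximation_reflection\<close>: with \<open>z \<cong> \<Sigma>u\<close> and the triangle \<open>y \<rightarrow> u \<rightarrow> s\<close> of a minimal left
  approximation, the conditions \<open>Hom(\<Sigma>\<^sup>iy, S) = 0\<close> hold by the left versions of the same three reasons. The
  rotated triangle \<open>s \<rightarrow> \<Sigma>y \<rightarrow> \<Sigma>u\<close> is then a reflection of \<open>\<Sigma>y\<close>.
\<close>
lemma sh_dense:
  assumes z: "z \<in> Z"
  shows "\<exists>y\<in>Z. \<exists>r. reflection Z (\<Sigma> y) z r"
proof -
  have zob: "z \<in> Ob D" using Z_in_Ob[OF z] .
  obtain u where u: "u \<in> Ob D" "isomorphic D z (\<Sigma> u)" using shift_dense[OF zob] .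
  obtain s0 f0 where "left_approx u s0 f0" using finite_F u(1) unfolding functorially_finite_def by blast
  from ex_minimal_left_approx[OF u(1) this] obtain s f where f: "left_approx u s f"
    and m: "\<And>g. arr s s g \<Longrightarrow> g \<cdot> f = f \<Longrightarrow> is_iso D s s g" by blast
  have sF: "s \<in> F" using f by (simp add: left_approximation_def)
  obtain y k c where t: "tri D y u s k f c" using ex_tri_second[OF left_approx_arr[OF u(1) f]] by blast
  note t' = tri_rot[OF tri_rot[OF t]]
  note T = tri_arr[OF t]
  have ob: "y \<in> Ob D" "s \<in> Ob D" using T by (auto simp: arr_def)
  have zn: "nohom ((\<Sigma> ^^ i) (\<Sigma> u)) t0" if "i \<le> w" "t0 \<in> S" for i t0
  proof -
    have "isomorphic D ((\<Sigma> ^^ i) z) ((\<Sigma> ^^ i) (\<Sigma> u))" using u(2) by (rule shift_power_isomorphic)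
    then show ?thesis using nohom_iso_left Z_leftD[OF z that] by blast
  qed
  have "nohom ((\<Sigma> ^^ i) y) t0" if i: "i \<le> w" and t0: "t0 \<in> S" for i t0
  proof -
    consider "i = 0" | "i = 1" | j where "i = Suc (Suc j)" by (metis One_nat_def not0_implies_Suc)
    then show ?thesis
    proof cases
      case 1 then show ?thesis using wakamatsu_left[OF f m t S_F[OF t0]] by simp
    next
      case 2
      have "nohom (\<Sigma> y) t0" unfolding nohom_def
      proof (intro allI impI)
        fix v assume v: "arr (\<Sigma> y) t0 v"
        have vc: "arr s t0 (v \<cdot> c)" using arr_comp[OF v T(3)] .
        have "v \<cdot> c \<cdot> f = v \<cdot> (c \<cdot> f)" using v T by (simp add: paths)
        also have "\<dots> = 0" using tri_comp_zero(2)[OF t] comp_zero_right[OF v u(1)] by simp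
        finally have "v \<cdot> c = 0" using left_minimal_inj[OF u(1) f m t0 vc] by blast
        then obtain v' where v': "arr (\<Sigma> u) t0 v'" "v = v' \<cdot> (- \<Sigma>m y u k)" using weak_cokernel[OF t' v] by blast
        have "v' = 0" using nohomD[OF _ v'(1)] zn[of 0 t0] t0 by simp
        then show "v = 0" using v'(2) comp_zero_left[OF tri_arr(2)[OF t'] arrD(2)[OF v]] by simp
      qed
      then show ?thesis using 2 by simp
    next
      case 3
      have 1: "nohom ((\<Sigma> ^^ Suc j) s) t0"
        by (rule F_nohom_left[OF negative sF]) (use i 3 t0 in auto)
      have 2: "nohom ((\<Sigma> ^^ Suc j) (\<Sigma> u)) t0" by (rule zn) (use i 3 t0 in auto)
      obtain f' g' h' where "tri D ((\<Sigma> ^^ Suc j) s) ((\<Sigma> ^^ Suc j) (\<Sigma> y)) ((\<Sigma> ^^ Suc j) (\<Sigma> u)) f' g' h'"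
        using tri_shift_power[OF t'] by blast
      from nohom_middle_left[OF this 1 2] show ?thesis using 3 by (simp add: funpow_swap1)
    qed
  qed
  then have y: "y \<in> Z" using Z_left ob by blast
  have su: "\<Sigma> u \<in> Z" unfolding Z_right[of "\<Sigma> u"]
    using Z_rightD[OF z] nohom_iso_right[OF u(2)] shift_Ob[OF u(1)] by blast
  have r: "reflection Z (\<Sigma> y) (\<Sigma> u) (- \<Sigma>m y u k)" unfolding reflection_def using su F_orth[OF sF] t' by blast
  obtain e where "is_iso D (\<Sigma> u) z e" using isomorphic_sym[OF u(2)] by (auto simp: isomorphic_def)
  from reflection_iso[OF r this z zob] show ?thesis using y by blast
qed

sublocale triangulated_reduction D Z sh \<beta>
proof
  show "x \<in> Ob D" if "x \<in> Z" for x using that by (rule Z_in_Ob)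
  show "d \<in> Z" if xs: "\<And>i. i < n \<Longrightarrow> xs i \<in> Z" and ds: "direct_sum D d n xs \<iota> \<pi>" for n xs d \<iota> \<pi>
  proof -
    have d: "d \<in> Ob D" and id: "(\<Sum>i<n. \<iota> i \<cdot> \<pi> i) = ident D d"
      and ip: "\<And>i. i < n \<Longrightarrow> arr (xs i) d (\<iota> i) \<and> arr d (xs i) (\<pi> i)"
      using ds by (auto simp: direct_sum_def arr_def)
    have "nohom ((\<Sigma> ^^ j) t) d" if j: "j \<le> w" "t \<in> S" for j t
      unfolding nohom_def
    proof (intro allI impI)
      fix u assume u: "arr ((\<Sigma> ^^ j) t) d u"
      have "u = (\<Sum>i<n. \<iota> i \<cdot> \<pi> i) \<cdot> u" using comp_ident_left[OF u] id by simp
      also have "\<dots> = (\<Sum>i<n. (\<iota> i \<cdot> \<pi> i) \<cdot> u)"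
        by (rule comp_sum_left[OF u _ d, THEN conjunct2]) (use ip arr_comp in blast)
      also have "\<dots> = 0"
      proof (rule sum.neutral, intro ballI)
        fix i assume "i \<in> {..<n}"
        then have i: "i < n" by simp
        have "nohom ((\<Sigma> ^^ j) t) (xs i)" using Z_rightD[OF xs[OF i] j] .
        then have "\<pi> i \<cdot> u = 0" using nohomD arr_comp ip[OF i] u by blast
        then have 0: "\<iota> i \<cdot> (\<pi> i \<cdot> u) = 0" using comp_zero_right arrD(1)[OF u] ip[OF i] by metis
        show "(\<iota> i \<cdot> \<pi> i) \<cdot> u = 0"
          using conjunct1[OF ip[OF i]] conjunct2[OF ip[OF i]] u by (simp add: comp_assoc chain_arr into_arr 0)
      qed
      finally show "u = 0" .
    qed
    then show ?thesis using Z_right d by blast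
  qed
  show "reflection Z (\<Sigma> x) (sh x) (\<beta> x)" if x: "x \<in> Z" for x
    using sh[OF x] approximation_reflection shift_nohom_Z[OF x] by blast
  show "\<exists>z r. reflection Z c z r" if Z: "x \<in> Z" "y \<in> Z" and t: "tri D x y c f g h" for x y c f g h
  proof -
    have "nohom ((\<Sigma> ^^ i) t0) c" if i: "1 \<le> i" "i \<le> w" "t0 \<in> S" for i t0
      by (rule nohom_middle_right[OF tri_rot[OF t] Z_rightD[OF Z(2) i(2,3)] shift_nohom_Z[OF Z(1) i]])
    moreover have "c \<in> Ob D" using tri_arr[OF t] by (simp add: arr_def)
    ultimately show ?thesis using ex_approximation_triangle approximation_reflection by blast
  qed
  show "\<exists>x\<in>Z. \<exists>r. reflection Z (\<Sigma> x) z r" if "z \<in> Z" for z using sh_dense[OF that] .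
qed

end

context simple_minded_reduction
begin

lemma cone_nohom:
  assumes Z: "x \<in> Z" "y \<in> Z" and t: "tri D x y c f g h" and i: "1 \<le> i" "i \<le> w" "t0 \<in> S"
  shows "nohom ((\<Sigma> ^^ i) t0) c"
  by (rule nohom_middle_right[OF tri_rot[OF t] Z_rightD[OF Z(2) i(2,3)] shift_nohom_Z[OF Z(1) i]])

text \<open>
  Replaces the definite description of \<open>h\<close> by the equation that characterises it.
\<close>
lemma standard_triangle_iff:
  assumes Z: "Z = reduction_objects D w S"
  shows "standard_triangle D w S sh \<beta> x y z f g h \<longleftrightarrow> x \<in> Z \<and> y \<in> Z \<and> arr z (sh x) h \<and>
     (\<exists>c g1 h1 s a b d. tri D x y c f g1 h1 \<and> approximation_triangle D F s c z a b d \<and>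
        reflection Z c z b \<and> g = b \<cdot> g1 \<and> h \<cdot> b = \<beta> x \<cdot> h1)"
proof -
  have the: "h = (THE h. h \<in> Hom D z (sh x) \<and> h \<cdot> b = \<beta> x \<cdot> h1) \<longleftrightarrow>
      arr z (sh x) h \<and> h \<cdot> b = \<beta> x \<cdot> h1"
    if x: "x \<in> Z" and r: "reflection Z c z b" and t: "tri D x y c f g1 h1" for c b g1 h1
  proof -
    have ob: "z \<in> Ob D" "sh x \<in> Ob D" using Z_in_Ob reflection_in[OF r] sh_in[OF x] by blast+
    have hom: "k \<in> Hom D z (sh x) \<longleftrightarrow> arr z (sh x) k" for k using ob by (simp add: arr_def)
    have ex1: "\<exists>!k. arr z (sh x) k \<and> k \<cdot> b = \<beta> x \<cdot> h1"
      using reflection_ex[OF r arr_comp[OF beta_arr[OF x] tri_arr(3)[OF t]] sh_in[OF x]]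
        reflection_eq[OF r _ _ sh_in[OF x]] by metis
    show ?thesis unfolding hom using theI'[OF ex1] the1_equality[OF ex1, of h] by auto
  qed
  have r: "reflection Z c z b" if "x \<in> Z" "y \<in> Z" "tri D x y c f g1 h1" "approximation_triangle D F s c z a b d"
    for c s a b d g1 h1
    using approximation_reflection[OF that(4) cone_nohom[OF that(1-3)]] .
  show ?thesis
  proof
    assume "standard_triangle D w S sh \<beta> x y z f g h"
    then obtain c g1 h1 s a b d where xy: "x \<in> Z" "y \<in> Z" and t: "tri D x y c f g1 h1"
      and ap: "approximation_triangle D F s c z a b d" and e: "g = b \<cdot> g1"
      "h = (THE h. h \<in> Hom D z (sh x) \<and> h \<cdot> b = \<beta> x \<cdot> h1)"
      unfolding standard_triangle_def Z by blast
    show "x \<in> Z \<and> y \<in> Z \<and> arr z (sh x) h \<and>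
     (\<exists>c g1 h1 s a b d. tri D x y c f g1 h1 \<and> approximation_triangle D F s c z a b d \<and>
        reflection Z c z b \<and> g = b \<cdot> g1 \<and> h \<cdot> b = \<beta> x \<cdot> h1)"
      using xy t ap e(1) r[OF xy t ap] iffD1[OF the[OF xy(1) r[OF xy t ap] t] e(2)] by blast
  next
    assume "x \<in> Z \<and> y \<in> Z \<and> arr z (sh x) h \<and>
     (\<exists>c g1 h1 s a b d. tri D x y c f g1 h1 \<and> approximation_triangle D F s c z a b d \<and>
        reflection Z c z b \<and> g = b \<cdot> g1 \<and> h \<cdot> b = \<beta> x \<cdot> h1)"
    then obtain c g1 h1 s a b d where xy: "x \<in> Z" "y \<in> Z" and t: "tri D x y c f g1 h1"
      and ap: "approximation_triangle D F s c z a b d" and rb: "reflection Z c z b" and e: "g = b \<cdot> g1"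
      and h: "arr z (sh x) h \<and> h \<cdot> b = \<beta> x \<cdot> h1" by blast
    show "standard_triangle D w S sh \<beta> x y z f g h"
      unfolding standard_triangle_def Z[symmetric]
      using xy t ap e arrD(3)[OF tri_arr(1)[OF t]] iffD2[OF the[OF xy(1) rb t] h] by blast
  qed
qed

text \<open>
  Both classes are closed under isomorphism, and two reflections of the same cone are uniquely isomorphic.
\<close>
lemma reduction_triangle_red_tri:
  assumes Z: "Z = reduction_objects D w S"
  shows "reduction_triangle D w S sh \<beta> = red_tri"
proof (intro ext iffI)
  fix x y z f g h
  let ?C = "reduction_shift_cat D w S sh \<beta>"
  have iso: "is_iso ?C = is_iso D" by (intro ext) (simp add: is_iso_def reduction_shift_cat_def)
  have iso_iff: "diagrams_isomorphic ?C x y z f g h x' y' z' f' g' h' \<longleftrightarrow>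
     (\<exists>a b c. is_iso D x x' a \<and> is_iso D y y' b \<and> is_iso D z z' c \<and>
        b \<cdot> f = f' \<cdot> a \<and> c \<cdot> g = g' \<cdot> b \<and> shm x x' a \<cdot> h = h' \<cdot> c)" for x' y' z' f' g' h'
    unfolding diagrams_isomorphic_def iso by (simp add: reduction_shift_cat_def)
  have diag: "diagram ?C x y z f g h \<longleftrightarrow> x \<in> Z \<and> y \<in> Z \<and> z \<in> Z \<and> arr x y f \<and> arr y z g \<and> arr z (sh x) h"
    using Z_in_Ob sh_in by (auto simp: diagram_def arr_def reduction_shift_cat_def Z[symmetric])
  {
    assume "reduction_triangle D w S sh \<beta> x y z f g h"
    then obtain x' y' z' f' g' h' where d: "diagram ?C x y z f g h"
      and s: "standard_triangle D w S sh \<beta> x' y' z' f' g' h'"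
      and i: "diagrams_isomorphic ?C x y z f g h x' y' z' f' g' h'" unfolding reduction_triangle_def by blast
    have t: "red_tri x' y' z' f' g' h'" using s unfolding standard_triangle_iff[OF Z] red_tri_def by blast
    have xyz: "x \<in> Z" "y \<in> Z" "z \<in> Z" and A: "arr x y f" "arr y z g" "arr z (sh x) h" using d diag by auto
    note Z' = red_tri_in[OF t] and A' = red_tri_arr[OF t]
    note ob = Z_in_Ob[OF xyz(1)] Z_in_Ob[OF xyz(2)] Z_in_Ob[OF xyz(3)]
      Z_in_Ob[OF Z'(1)] Z_in_Ob[OF Z'(2)] Z_in_Ob[OF Z'(3)]
    obtain a b c where abc: "is_iso D x x' a" "is_iso D y y' b" "is_iso D z z' c"
      and e: "b \<cdot> f = f' \<cdot> a" "c \<cdot> g = g' \<cdot> b" "shm x x' a \<cdot> h = h' \<cdot> c" using i unfolding iso_iff by blast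
    obtain a' where a: "arr x x' a" "arr x' x a'" "a' \<cdot> a = ident D x" "a \<cdot> a' = ident D x'" "is_iso D x' x a'"
      using is_isoE[OF abc(1) ob(1,4)] .
    obtain b' where b: "arr y y' b" "arr y' y b'" "b' \<cdot> b = ident D y" "b \<cdot> b' = ident D y'" "is_iso D y' y b'"
      using is_isoE[OF abc(2) ob(2,5)] .
    obtain c' where c: "arr z z' c" "arr z' z c'" "c' \<cdot> c = ident D z" "c \<cdot> c' = ident D z'" "is_iso D z' z c'"
      using is_isoE[OF abc(3) ob(3,6)] .
    note T = A A' a(1,2) b(1,2) c(1,2) shm(1)[OF xyz(1) Z'(1) a(1)] shm(1)[OF Z'(1) xyz(1) a(2)]
    show "red_tri x y z f g h"
    proof (rule red_tri_iso[OF t xyz A a(5) b(5) c(5)])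
      have "b' \<cdot> f' = b' \<cdot> ((f' \<cdot> a) \<cdot> a')" using T by (simp add: paths a(4))
      also have "\<dots> = f \<cdot> a'" unfolding e(1)[symmetric] using T by (simp add: paths comp_reduce[OF b(3)])
      finally show "b' \<cdot> f' = f \<cdot> a'" .
      have "c' \<cdot> g' = c' \<cdot> ((g' \<cdot> b) \<cdot> b')" using T by (simp add: paths b(4))
      also have "\<dots> = g \<cdot> b'" unfolding e(2)[symmetric] using T by (simp add: paths comp_reduce[OF c(3)])
      finally show "c' \<cdot> g' = g \<cdot> b'" .
      have sa: "shm x' x a' \<cdot> shm x x' a = ident D (sh x)"
        using shm_comp[OF xyz(1) Z'(1) xyz(1) a(1,2)] shm_ident[OF xyz(1)] a(3) by simp
      have "shm x' x a' \<cdot> h' = shm x' x a' \<cdot> ((h' \<cdot> c) \<cdot> c')" using T by (simp add: paths c(4))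
      also have "\<dots> = h \<cdot> c'" unfolding e(3)[symmetric] using T by (simp add: paths comp_reduce[OF sa])
      finally show "shm x' x a' \<cdot> h' = h \<cdot> c'" .
    qed
  }
  {
    assume t: "red_tri x y z f g h"
    note xyz = red_tri_in[OF t] and A = red_tri_arr[OF t]
    have ob: "x \<in> Ob D" "y \<in> Ob D" "z \<in> Ob D" using Z_in_Ob xyz by blast+
    obtain c g1 h1 r where T: "tri D x y c f g1 h1" and r: "reflection Z c z r" and g: "g = r \<cdot> g1"
      and h: "h \<cdot> r = \<beta> x \<cdot> h1" using t by (auto simp: red_tri_def)
    have "c \<in> Ob D" using tri_arr[OF T] by (simp add: arr_def)
    then obtain s z' a b d where ap: "approximation_triangle D F s c z' a b d"
      using ex_approximation_triangle by blast
    have r': "reflection Z c z' b" using approximation_reflection[OF ap cone_nohom[OF xyz(1,2) T]] .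
    obtain e where e: "is_iso D z z' e" "e \<cdot> r = b" using reflection_unique[OF r r'] by blast
    have ea: "arr z z' e" using is_isoE[OF e(1) ob(3) Z_in_Ob[OF reflection_in[OF r']]] by metis
    obtain h' where h': "arr z' (sh x) h'" "h' \<cdot> b = \<beta> x \<cdot> h1"
      using reflection_ex[OF r' arr_comp[OF beta_arr[OF xyz(1)] tri_arr(3)[OF T]] sh_in[OF xyz(1)]] by blast
    have "standard_triangle D w S sh \<beta> x y z' f (b \<cdot> g1) h'"
      unfolding standard_triangle_iff[OF Z] using xyz T ap r' h' by blast
    moreover have "diagrams_isomorphic ?C x y z f g h x y z' f (b \<cdot> g1) h'"
      unfolding iso_iff
    proof (intro exI conjI)
      show "is_iso D x x (ident D x)" "is_iso D y y (ident D y)" "is_iso D z z' e"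
        using is_iso_ident ob e by auto
      note B = A ea tri_arr[OF T] reflection_arr[OF r] reflection_arr[OF r'] h'(1)
      show "ident D y \<cdot> f = f \<cdot> ident D x" using B by (simp add: paths)
      show "e \<cdot> g = b \<cdot> g1 \<cdot> ident D y" using B by (simp add: paths g flip: e(2))
      have "h = h' \<cdot> e"
        by (rule reflection_eq[OF r _ _ sh_in[OF xyz(1)]]) (use B in \<open>simp_all add: paths h e(2) h'(2)\<close>)
      then show "shm x x (ident D x) \<cdot> h = h' \<cdot> e" using B by (simp add: shm_ident[OF xyz(1)] paths)
    qed
    ultimately show "reduction_triangle D w S sh \<beta> x y z f g h"
      unfolding reduction_triangle_def diag using xyz A by blast
  }
qed

theorem reduction_triangulated:
  assumes Z: "Z = reduction_objects D w S"
  shows "triangulated_category (reduction_tri_cat D w S sh \<beta>)"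
  using reduced_triangulated unfolding reduction_tri_cat_def reduction_triangle_red_tri[OF Z] Z .

end

section \<open>Serre duality\<close>

context triangulated_category
begin

lemma shift_power_nohom:
  "x \<in> Ob D \<Longrightarrow> y \<in> Ob D \<Longrightarrow> nohom ((\<Sigma> ^^ i) x) ((\<Sigma> ^^ i) y) \<longleftrightarrow> nohom x y"
  by (induction i) (auto simp: shift_nohom shift_power_Ob)

lemma shift_power_dense: "x \<in> Ob D \<Longrightarrow> \<exists>y\<in>Ob D. isomorphic D x ((\<Sigma> ^^ i) y)"
proof (induction i arbitrary: x)
  case 0 then show ?case using isomorphic_refl by auto
next
  case (Suc i)
  obtain y where y: "y \<in> Ob D" "isomorphic D x (\<Sigma> y)" using shift_dense[OF Suc(2)] .
  obtain y' where "y' \<in> Ob D" "isomorphic D y ((\<Sigma> ^^ i) y')" using Suc.IH[OF y(1)] by blast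
  then show ?case using isomorphic_trans[OF y(2) shift_isomorphic] by auto
qed

text \<open>
  If \<open>Hom(y, \<S>x) = 0\<close>, its dual has one element, hence \<open>Hom(x, y) = 0\<close>. For the converse write
  \<open>y \<cong> \<S>y'\<close>: then \<open>Hom(y, \<S>x) \<cong> Hom(y', x)\<close>, and the first part applies to \<open>y'\<close> and \<open>x\<close>.
\<close>
lemma serre_nohom:
  assumes serre: "serre_functor D So Sm" and ob: "x \<in> Ob D" "y \<in> Ob D"
  shows "nohom y (So x) \<longleftrightarrow> nohom x y"
proof -
  have aut: "autoequivalence D So Sm" using serre by (simp add: serre_functor_def)
  note SoOb = linear_functor_Ob[OF autoequivalence_linear[OF aut]]
  have 1: "nohom x y" if ob: "x \<in> Ob D" "y \<in> Ob D" and n: "nohom y (So x)" for x y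
    unfolding nohom_def
  proof (intro allI impI)
    fix f assume f: "arr x y f"
    obtain \<eta> :: "'o \<Rightarrow> 'o \<Rightarrow> 'm \<Rightarrow> 'm \<Rightarrow> 'k"
      where bij: "bij_betw (\<eta> x y) (Hom D x y) (dual_space D (Hom D y (So x)))"
      using serre ob unfolding serre_functor_def
      apply (elim conjE exE)
      subgoal for \<eta> by (rule that[of \<eta>]) blast
      done
    have h: "Hom D y (So x) = {0}" using n nohom_iff[OF ob(2) SoOb[OF ob(1)]] by simp
    have "\<phi> = \<psi>" if "\<phi> \<in> dual_space D {0}" "\<psi> \<in> dual_space D {0}" for \<phi> \<psi> :: "'m \<Rightarrow> 'k"
    proof (rule extensionalityI)
      show "\<phi> \<in> extensional {0}" "\<psi> \<in> extensional {0}" using that by (auto simp: dual_space_def)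
      fix u :: 'm assume u: "u \<in> {0}"
      have "\<phi> (0 + 0) = \<phi> 0 + \<phi> 0" "\<psi> (0 + 0) = \<psi> 0 + \<psi> 0"
        using that unfolding dual_space_def by blast+
      then have "\<phi> 0 = 0" "\<psi> 0 = 0" by (metis add.right_neutral add_left_cancel)+
      then show "\<phi> u = \<psi> u" using u by simp
    qed
    then have "\<eta> x y f = \<eta> x y 0"
      using bij_betwE[OF bij] f arr_zero[OF ob] h by (auto simp: arr_def)
    then show "f = 0" using bij f arr_zero[OF ob] unfolding bij_betw_def inj_on_def arr_def by blast
  qed
  show ?thesis
  proof
    assume "nohom y (So x)" then show "nohom x y" using 1 ob by blast
  next
    assume n: "nohom x y"
    obtain Go Gm where G: "autoequivalence D Go Gm" "\<And>x. x \<in> Ob D \<Longrightarrow> isomorphic D (So (Go x)) x"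
      using autoequivalence_quasi_inverse[OF aut] by metis
    have g: "Go y \<in> Ob D" "isomorphic D (So (Go y)) y"
      using linear_functor_Ob[OF autoequivalence_linear[OF G(1)]] G(2) ob by auto
    have "nohom x (So (Go y))" using nohom_iso_right[OF isomorphic_sym[OF g(2)] n] .
    then have "nohom (Go y) x" using 1 g(1) ob(1) by blast
    then have "nohom (So (Go y)) (So x)" using autoequivalence_nohom[OF aut g(1) ob(1)] by simp
    then show "nohom y (So x)" using nohom_iso_left[OF g(2)] by blast
  qed
qed

lemma serre_shift_subcategoryD:
  assumes serre: "serre_functor D So Sm" and S: "S \<subseteq> Ob D" and stable: "serre_shift_subcategory D So (- int w) S"
  shows "t \<in> S \<Longrightarrow> \<exists>t'\<in>S. isomorphic D t (So ((\<Sigma> ^^ w) t'))"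
    and "t \<in> S \<Longrightarrow> \<exists>t'\<in>S. isomorphic D (So ((\<Sigma> ^^ w) t)) t'"
proof -
  have aut: "linear_functor D So Sm" using serre by (simp add: serre_functor_def autoequivalence_def)
  have eq: "iso_closure D S = functor_image D So (functor_image D (\<Sigma> ^^ w) S)"
    using stable by (simp add: serre_shift_subcategory_def shift_subcat_def)
  show "\<exists>t'\<in>S. isomorphic D t (So ((\<Sigma> ^^ w) t'))" if t: "t \<in> S"
  proof -
    have "t \<in> iso_closure D S" using t S isomorphic_refl by (auto simp: iso_closure_def)
    then obtain u t' where "t' \<in> S" "isomorphic D u ((\<Sigma> ^^ w) t')" "isomorphic D t (So u)"
      unfolding eq functor_image_def by blast
    then show ?thesis using isomorphic_trans linear_functor_isomorphic[OF aut] by blast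
  qed
  show "\<exists>t'\<in>S. isomorphic D (So ((\<Sigma> ^^ w) t)) t'" if t: "t \<in> S"
  proof -
    have ob: "(\<Sigma> ^^ w) t \<in> Ob D" "So ((\<Sigma> ^^ w) t) \<in> Ob D"
      using t S shift_power_Ob linear_functor_Ob[OF aut] by blast+
    have "So ((\<Sigma> ^^ w) t) \<in> functor_image D So (functor_image D (\<Sigma> ^^ w) S)"
      using t isomorphic_refl ob unfolding functor_image_def by blast
    then show ?thesis unfolding eq[symmetric] iso_closure_def by blast
  qed
qed

lemma reduction_objects_iff:
  assumes S: "S \<subseteq> Ob D"
  shows "d \<in> reduction_objects D w S \<longleftrightarrow>
    d \<in> Ob D \<and> (\<forall>i<w. \<forall>t\<in>S. nohom ((\<Sigma> ^^ i) t) d \<and> nohom ((\<Sigma> ^^ i) d) t)"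
proof -
  have 1: "hom_vanish D (shift_subcat D (int i) S) {d} \<longleftrightarrow> (\<forall>t\<in>S. nohom ((\<Sigma> ^^ i) t) d)"
    if d: "d \<in> Ob D" for i
  proof
    assume v: "hom_vanish D (shift_subcat D (int i) S) {d}"
    show "\<forall>t\<in>S. nohom ((\<Sigma> ^^ i) t) d"
    proof
      fix t assume t: "t \<in> S"
      have ob: "(\<Sigma> ^^ i) t \<in> Ob D" using t S shift_power_Ob by blast
      then have "(\<Sigma> ^^ i) t \<in> shift_subcat D (int i) S"
        using t isomorphic_refl by (auto simp: shift_subcat_def functor_image_def)
      then show "nohom ((\<Sigma> ^^ i) t) d" using v nohom_iff[OF ob d] by (simp add: hom_vanish_def)
    qed
  next
    assume v: "\<forall>t\<in>S. nohom ((\<Sigma> ^^ i) t) d"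
    have "Hom D y d = {0}" if "y \<in> shift_subcat D (int i) S" for y
    proof -
      obtain t where t: "t \<in> S" "isomorphic D y ((\<Sigma> ^^ i) t)"
        using \<open>y \<in> _\<close> by (auto simp: shift_subcat_def functor_image_def)
      then have "nohom y d" "y \<in> Ob D"
        using nohom_iso_left[OF isomorphic_sym] v by (blast, simp add: isomorphic_def)
      then show ?thesis using nohom_iff d by blast
    qed
    then show "hom_vanish D (shift_subcat D (int i) S) {d}" by (simp add: hom_vanish_def)
  qed
  have sub: "y \<in> shift_subcat D (- int i) S \<longleftrightarrow> y \<in> Ob D \<and> (\<exists>t\<in>S. isomorphic D ((\<Sigma> ^^ i) y) t)" for y i
    by (cases "i = 0") (auto simp: shift_subcat_def functor_image_def functor_preimage_def isomorphic_def)
  have 2: "hom_vanish D {d} (shift_subcat D (- int i) S) \<longleftrightarrow> (\<forall>t\<in>S. nohom ((\<Sigma> ^^ i) d) t)"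
    if d: "d \<in> Ob D" for i
  proof
    assume v: "hom_vanish D {d} (shift_subcat D (- int i) S)"
    show "\<forall>t\<in>S. nohom ((\<Sigma> ^^ i) d) t"
    proof
      fix t assume t: "t \<in> S"
      obtain y where y: "y \<in> Ob D" "isomorphic D t ((\<Sigma> ^^ i) y)" using shift_power_dense t S by blast
      then have "y \<in> shift_subcat D (- int i) S" using sub t isomorphic_sym by blast
      then have "nohom d y" using v nohom_iff[OF d y(1)] by (simp add: hom_vanish_def)
      then have "nohom ((\<Sigma> ^^ i) d) ((\<Sigma> ^^ i) y)" using shift_power_nohom[OF d y(1)] by simp
      then show "nohom ((\<Sigma> ^^ i) d) t" using nohom_iso_right[OF isomorphic_sym[OF y(2)]] by blast
    qed
  next
    assume v: "\<forall>t\<in>S. nohom ((\<Sigma> ^^ i) d) t"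
    have "Hom D d y = {0}" if y: "y \<in> shift_subcat D (- int i) S" for y
    proof -
      obtain t where t: "y \<in> Ob D" "t \<in> S" "isomorphic D ((\<Sigma> ^^ i) y) t" using y sub by blast
      have "nohom ((\<Sigma> ^^ i) d) ((\<Sigma> ^^ i) y)" using nohom_iso_right[OF isomorphic_sym[OF t(3)]] v t(2) by blast
      then show ?thesis using shift_power_nohom[OF d t(1)] nohom_iff[OF d t(1)] by simp
    qed
    then show "hom_vanish D {d} (shift_subcat D (- int i) S)" by (simp add: hom_vanish_def)
  qed
  show ?thesis unfolding reduction_objects_def using 1 2 by blast
qed

lemma shift_power_cancel:
  assumes "x \<in> Ob D" "y \<in> Ob D"
  shows "nohom ((\<Sigma> ^^ (i + k)) x) ((\<Sigma> ^^ i) y) \<longleftrightarrow> nohom ((\<Sigma> ^^ k) x) y"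
    and "nohom ((\<Sigma> ^^ i) y) ((\<Sigma> ^^ (i + k)) x) \<longleftrightarrow> nohom y ((\<Sigma> ^^ k) x)"
  using shift_power_nohom shift_power_Ob assms by (simp_all add: funpow_add)

text \<open>
  By Serre duality \<open>Hom(\<Sigma>\<^sup>id, S) = 0\<close> if and only if \<open>Hom(\<Sigma>\<^sup>w\<^sup>-\<^sup>iS, d) = 0\<close>. The conditions of the
  first kind in degrees \<open>0, \<dots>, w - 1\<close> thus become conditions of the second kind in degrees \<open>1, \<dots>, w\<close>, and
  vice versa. Since \<open>w \<ge> 1\<close>, these and the degrees \<open>0, \<dots>, w - 1\<close> together cover \<open>0, \<dots>, w\<close>.
\<close>
lemma reduction_objects_onesided:
  assumes serre: "serre_functor D So Sm" and S: "S \<subseteq> Ob D"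
    and stable: "serre_shift_subcategory D So (- int w) S" and w: "1 \<le> w"
  shows "d \<in> reduction_objects D w S \<longleftrightarrow> d \<in> Ob D \<and> (\<forall>i\<le>w. \<forall>t\<in>S. nohom ((\<Sigma> ^^ i) t) d)" (is ?R)
    and "d \<in> reduction_objects D w S \<longleftrightarrow> d \<in> Ob D \<and> (\<forall>i\<le>w. \<forall>t\<in>S. nohom ((\<Sigma> ^^ i) d) t)" (is ?L)
proof -
  note A = serre_shift_subcategoryD(1)[OF serre S stable] and B = serre_shift_subcategoryD(2)[OF serre S stable]
  have tob: "t \<in> Ob D" "(\<Sigma> ^^ w) t \<in> Ob D" if "t \<in> S" for t using that S shift_power_Ob by blast+
  \<comment> \<open>Serre duality exchanges the degrees \<open>i\<close> and \<open>w - i\<close>\<close>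
  have dual: "(\<forall>t\<in>S. nohom ((\<Sigma> ^^ i) d) t) \<longleftrightarrow> (\<forall>t\<in>S. nohom ((\<Sigma> ^^ (w - i)) t) d)"
    if d: "d \<in> Ob D" and i: "i \<le> w" for i
  proof -
    have dob: "(\<Sigma> ^^ i) d \<in> Ob D" using shift_power_Ob d by blast
    have e: "nohom ((\<Sigma> ^^ i) d) (So ((\<Sigma> ^^ w) t)) \<longleftrightarrow> nohom ((\<Sigma> ^^ (w - i)) t) d" if t: "t \<in> S" for t
      using serre_nohom[OF serre tob(2)[OF t] dob] shift_power_cancel(1)[OF tob(1)[OF t] d, of i "w - i"] i by simp
    show ?thesis
    proof
      assume l: "\<forall>t\<in>S. nohom ((\<Sigma> ^^ i) d) t"
      show "\<forall>t\<in>S. nohom ((\<Sigma> ^^ (w - i)) t) d"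
        using B e l nohom_iso_right[OF isomorphic_sym] by blast
    next
      assume r: "\<forall>t\<in>S. nohom ((\<Sigma> ^^ (w - i)) t) d"
      show "\<forall>t\<in>S. nohom ((\<Sigma> ^^ i) d) t"
        using A e r nohom_iso_right[OF isomorphic_sym] by blast
    qed
  qed
  have Z: "d \<in> reduction_objects D w S \<longleftrightarrow>
      d \<in> Ob D \<and> (\<forall>i<w. \<forall>t\<in>S. nohom ((\<Sigma> ^^ i) t) d) \<and> (\<forall>i<w. \<forall>t\<in>S. nohom ((\<Sigma> ^^ i) d) t)"
    unfolding reduction_objects_iff[OF S] by blast
  have split: "(\<forall>i<w. P i) \<and> (\<forall>i<w. P (w - i)) \<longleftrightarrow> (\<forall>i\<le>w. P i)" for P
  proof (intro iffI allI impI)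
    fix i assume P: "(\<forall>i<w. P i) \<and> (\<forall>i<w. P (w - i))" and i: "i \<le> w"
    show "P i"
    proof (cases "i = w")
      case True then show ?thesis using P w by (auto dest: spec[of _ 0])
    next
      case False then show ?thesis using P i by simp
    qed
  qed simp
  show ?R
  proof (cases "d \<in> Ob D")
    case d: True
    have "(\<forall>i<w. \<forall>t\<in>S. nohom ((\<Sigma> ^^ i) d) t) \<longleftrightarrow> (\<forall>i<w. \<forall>t\<in>S. nohom ((\<Sigma> ^^ (w - i)) t) d)"
      using dual[OF d] by simp
    then show ?thesis using Z split[of "\<lambda>i. \<forall>t\<in>S. nohom ((\<Sigma> ^^ i) t) d"] by blast
  qed (use Z in blast)
  show ?L
  proof (cases "d \<in> Ob D")
    case d: True
    have "(\<forall>i\<le>w. \<forall>t\<in>S. nohom ((\<Sigma> ^^ i) d) t) \<longleftrightarrow> (\<forall>i\<le>w. \<forall>t\<in>S. nohom ((\<Sigma> ^^ (w - i)) t) d)"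
      using dual[OF d] by simp
    also have "\<dots> \<longleftrightarrow> (\<forall>i\<le>w. \<forall>t\<in>S. nohom ((\<Sigma> ^^ i) t) d)"
      by (metis diff_diff_cancel diff_le_self)
    finally show ?thesis using \<open>?R\<close> by blast
  qed (use Z in blast)
qed

text \<open>
  A Hom-space of dimension \<open>1\<close> between isomorphic objects consists of the multiples of an isomorphism.
  Finite-dimensionality ensures that dimension \<open>0\<close> means zero.
\<close>
lemma w_orthogonal_iso:
  assumes fin: "hom_finite D" and S: "w_orthogonal D w S"
    and t: "t \<in> S" "t' \<in> S" and f: "arr t t' f" "f \<noteq> 0"
  shows "is_iso D t t' f"
proof -
  interpret vs: vector_space "scl D" by (rule vector_space)
  have ob: "t \<in> Ob D" "t' \<in> Ob D" using t S by (auto simp: w_orthogonal_def)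
  have dim: "vs.dim (Hom D t t') = (if isomorphic D t t' then 1 else 0)"
    using S t unfolding w_orthogonal_def by blast
  obtain T where T: "finite T" "vs.span T = Hom D t t'" using fin ob unfolding hom_finite_def by blast
  obtain B where B: "B \<subseteq> Hom D t t'" "vs.independent B" "Hom D t t' \<subseteq> vs.span B" "card B = vs.dim (Hom D t t')"
    using vs.basis_exists by blast
  have finB: "finite B" using vs.independent_span_bound[OF T(1) B(2)] B(1) T(2) by simp
  have fH: "f \<in> vs.span B" using B(3) f(1) arrD(3) by blast
  have iso: "isomorphic D t t'"
  proof (rule ccontr)
    assume "\<not> isomorphic D t t'"
    then have "B = {}" using dim B(4) finB by simp
    then show False using fH f(2) by simp
  qed
  then have "card B = 1" using dim B(4) by simp
  then obtain b where b: "B = {b}" by (rule card_1_singletonE)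
  obtain p where p: "is_iso D t t' p" using iso by (auto simp: isomorphic_def)
  obtain q where q: "arr t t' p" "arr t' t q" "q \<cdot> p = ident D t" "p \<cdot> q = ident D t'"
    using is_isoE[OF p ob] .
  have "p \<noteq> 0"
  proof
    assume "p = 0"
    then have "ident D t = 0" using q(3) comp_zero_right[OF q(2) ob(1)] by simp
    then show False using f comp_ident_right[OF f(1)] comp_zero_right[OF f(1) ob(1)] by simp
  qed
  have "p \<in> vs.span B" using B(3) q(1) arrD(3) by blast
  then obtain c e where c: "f = scl D c b" and e: "p = scl D e b" using fH unfolding b vs.span_singleton by blast
  have "e \<noteq> 0" "c \<noteq> 0" using e c \<open>p \<noteq> 0\<close> f(2) by auto
  have fp: "f = scl D (c / e) p" using c e \<open>e \<noteq> 0\<close> by simp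
  show ?thesis
  proof (rule is_isoI[OF f(1) arr_scl[OF q(2)]])
    show "scl D (e / c) q \<cdot> f = ident D t" "f \<cdot> scl D (e / c) q = ident D t'"
      using q \<open>e \<noteq> 0\<close> \<open>c \<noteq> 0\<close> unfolding fp
      by (simp_all add: comp_scl_left[OF arr_scl[OF q(1)] q(2)] comp_scl_right[OF q(1,2)]
          comp_scl_left[OF arr_scl[OF q(2)] q(1)] comp_scl_right[OF q(2,1)])
  qed
qed

end

section \<open>The reduction theorem\<close>

theorem theorem1:
  fixes D :: "('k::alg_closed_field, 'o, 'm::ab_group_add) tri_cat"
    and So :: "'o \<Rightarrow> 'o" and Sm :: "'o \<Rightarrow> 'o \<Rightarrow> 'm \<Rightarrow> 'm"
    and w :: nat and S :: "'o set"
    and s sh :: "'o \<Rightarrow> 'o" and \<alpha> \<beta> \<gamma> :: "'o \<Rightarrow> 'm"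
  assumes "triangulated_category D"
    and "hom_finite D"
    and "krull_schmidt D"
    and "serre_functor D So Sm"
    and "1 \<le> w"
    and "w_orthogonal D w S"
    and "functorially_finite D (ext_closure D S)"
    and "serre_shift_subcategory D So (- int w) S"
    and "\<And>x. x \<in> reduction_objects D w S \<Longrightarrow>
           approximation_triangle D (ext_closure D S) (s x) (shift D x) (sh x) (\<alpha> x) (\<beta> x) (\<gamma> x)"
  shows "triangulated_category (reduction_tri_cat D w S sh \<beta>)"
proof -
  interpret triangulated_category D by (rule assms(1))
  have S: "S \<subseteq> Ob D" using assms(6) by (simp add: w_orthogonal_def)
  interpret orthogonal_collection D S
  proof
    show "t \<in> Ob D" if "t \<in> S" for t using that S by blast
    show "is_iso D t t' f" if "t \<in> S" "t' \<in> S" "arr t t' f" "f \<noteq> 0" for t t' f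
      using w_orthogonal_iso[OF assms(2,6) that] .
  qed
  interpret simple_minded_reduction D S w "reduction_objects D w S" sh \<beta>
  proof
    show "nohom ((\<Sigma> ^^ k) t) t'" if "1 \<le> k" "k < w" "t \<in> S" "t' \<in> S" for k t t'
    proof -
      have "Hom D ((\<Sigma> ^^ k) t) t' = {0}" using assms(6) that unfolding w_orthogonal_def by auto
      then show ?thesis using nohom_iff shift_power_Ob S that by blast
    qed
    show "\<exists>s a d. approximation_triangle D F s (\<Sigma> x) (sh x) a (\<beta> x) d"
      if "x \<in> reduction_objects D w S" for x using assms(9)[OF that] by blast
  qed (use assms(5,7) reduction_objects_onesided[OF assms(4) S assms(8,5)] in blast)+
  show ?thesis by (rule reduction_triangulated) simp
qed

end
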